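(* Let $M\subset\mathbb{R}^3$ be a closed sphere of constant curvature $\kappa>0$ and let $\Omega\subset M$ be an open set. Then $$\dim H^1_{\mathrm{kf}}(\Omega,T)=3 .$$
   Context: $M$ carries the metric $g=\langle\cdot,\cdot\rangle$ induced from the Euclidean metric of $\mathbb{R}^3$, with Levi-Civita connection $D$; $M_x$ is the tangent space at $x$. For a vector field $W$ on $\Omega$ put $DW(X,Y)=\langle D_YW,X\rangle$. $H^1(\Omega,T)$ is the Sobolev space of vector fields $W$ on $\Omega$ with $W$ and $DW$ square integrable. $H^1_{\mathrm{kf}}(\Omega,T)$ is the space of all $W\in H^1(\Omega,T)$ such that $DW(X,Y)+DW(Y,X)=0$ for all $X,Y\in M_x$, for almost every $x\in\Omega$.
   Formalization: The open set Ω is additionally assumed nonempty and connected; without this the claim is false (the empty set gives dimension 0, two disjoint open caps give dimension 6), and it holds for no other open sets. *)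

theory Defs
  imports "HOL-Analysis.Analysis" "Jordan_Normal_Form.Missing_VectorSpace"
begin

section \<open>Surfaces in Euclidean space\<close>

text \<open>A vector field on a surface \<open>M\<close> is a function on \<open>real^3\<close>, of which only the
  values on (the relevant part of) \<open>M\<close> matter.\<close>

definition tangent_space :: "(real^3) set \<Rightarrow> real^3 \<Rightarrow> (real^3) set" where
  "tangent_space M x = {v. \<exists>\<gamma>::real \<Rightarrow> real^3. \<exists>\<epsilon>>0. (\<forall>t. \<bar>t\<bar> < \<epsilon> \<longrightarrow> \<gamma> t \<in> M) \<and> \<gamma> 0 = x \<and>
     (\<gamma> has_vector_derivative v) (at 0)}"

text \<open>Orthogonal projection onto the tangent space.\<close>

definition tproj :: "(real^3) set \<Rightarrow> real^3 \<Rightarrow> real^3 \<Rightarrow> real^3" where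
  "tproj M x = closest_point (tangent_space M x)"

text \<open>The determinant of the differential of a local unit normal field \<open>N\<close> (Gauss map) as an
  endomorphism of the tangent plane, computed in an orthonormal basis \<open>u, v\<close>.\<close>

definition has_gauss_curvature :: "(real^3) set \<Rightarrow> real^3 \<Rightarrow> real \<Rightarrow> bool" where
  "has_gauss_curvature M x K \<longleftrightarrow>
     (\<exists>N U u v. open U \<and> x \<in> U \<and> (\<forall>y\<in>U. N differentiable (at y)) \<and>
        (\<forall>y\<in>M \<inter> U. norm (N y) = 1 \<and> (\<forall>w\<in>tangent_space M y. N y \<bullet> w = 0)) \<and>
        norm u = 1 \<and> norm v = 1 \<and> u \<bullet> v = 0 \<and> real_vector.span {u, v} = tangent_space M x \<and>
        K = (frechet_derivative N (at x) u \<bullet> u) * (frechet_derivative N (at x) v \<bullet> v)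
          - (frechet_derivative N (at x) u \<bullet> v) * (frechet_derivative N (at x) v \<bullet> u))"

text \<open>The Levi-Civita connection of the metric induced from \<open>real^3\<close>: \<open>cov_deriv M X x v\<close>
  is $D_v X$ at \<open>x\<close> for a tangent field \<open>X\<close> and \<open>v\<close> in the tangent space at \<open>x\<close>, i.e. the
  tangential part of the directional derivative. That it is metric and torsion-free on a sphere
  is shown in \<open>cov_deriv_metric\<close> and \<open>cov_deriv_sphere_torsion_free\<close> below.\<close>

definition cov_deriv :: "(real^3) set \<Rightarrow> (real^3 \<Rightarrow> real^3) \<Rightarrow> real^3 \<Rightarrow> real^3 \<Rightarrow> real^3" where
  "cov_deriv M X x v = tproj M x (frechet_derivative X (at x) v)"

text \<open>Trace of $v \mapsto D_v Y$ over the tangent space.\<close>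

definition surface_div :: "(real^3) set \<Rightarrow> (real^3 \<Rightarrow> real^3) \<Rightarrow> real^3 \<Rightarrow> real" where
  "surface_div M Y x = (\<Sum>e\<in>Basis. cov_deriv M Y x (tproj M x e) \<bullet> e)"

text \<open>Surface measure of the sphere as in the polar coordinate formula: the area of a
  subset \<open>A\<close> is \<open>3/r\<close> times the volume of the solid cone over \<open>A\<close> with apex \<open>c\<close>.\<close>

definition sphere_area :: "real^3 \<Rightarrow> real \<Rightarrow> (real^3) measure" where
  "sphere_area c r =
     distr (density lborel (\<lambda>x. ennreal (3 / r) * indicator (cball c r) x)) borel
       (\<lambda>x. c + (r / norm (x - c)) *\<^sub>R (x - c))"


section \<open>Sobolev fields\<close>

primrec Ck :: "nat \<Rightarrow> ('a::euclidean_space \<Rightarrow> 'b::real_normed_vector) \<Rightarrow> bool" where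
  "Ck 0 f \<longleftrightarrow> continuous_on UNIV f"
| "Ck (Suc k) f \<longleftrightarrow> (\<forall>x. f differentiable (at x)) \<and>
     (\<forall>v. Ck k (\<lambda>x. frechet_derivative f (at x) v))"

text \<open>Smooth tangent fields on \<open>M\<close> with compact support in \<open>\<Omega>\<close>. Smoothness is required of an
  extension to \<open>real^3\<close>; for a compact surface \<open>M\<close> every smooth field on \<open>M\<close> has one.\<close>

definition test_fields :: "(real^3) set \<Rightarrow> (real^3) set \<Rightarrow> (real^3 \<Rightarrow> real^3) set" where
  "test_fields M \<Omega> = {X. (\<forall>k. Ck k X) \<and> (\<forall>x\<in>M. X x \<in> tangent_space M x) \<and>
     (\<exists>K. compact K \<and> K \<subseteq> \<Omega> \<and> (\<forall>x\<in>M - K. X x = 0))}"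

definition set_square_integrable ::
  "'a measure \<Rightarrow> 'a set \<Rightarrow> ('a \<Rightarrow> 'b::euclidean_space) \<Rightarrow> bool" where
  "set_square_integrable \<mu> \<Omega> f \<longleftrightarrow>
     set_borel_measurable \<mu> \<Omega> f \<and> set_integrable \<mu> \<Omega> (\<lambda>x. (norm (f x))\<^sup>2)"

text \<open>\<open>A x\<close> is the endomorphism $Y \mapsto D_Y W$ of the tangent space at \<open>x\<close>, extended by zero
  to the normal line; hence $DW(X,Y)$ is \<open>(A x *v Y) \<bullet> X\<close>. The integral identity is
  the divergence theorem for the field $\langle W, X\rangle Y$.\<close>

definition weak_cov_deriv ::
  "(real^3) set \<Rightarrow> (real^3) measure \<Rightarrow> (real^3) set \<Rightarrow> (real^3 \<Rightarrow> real^3) \<Rightarrow> (real^3 \<Rightarrow> real^3^3) \<Rightarrow> bool"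
  where
  "weak_cov_deriv M \<mu> \<Omega> W A \<longleftrightarrow>
     (\<forall>x\<in>\<Omega>. \<forall>v. tproj M x (A x *v tproj M x v) = A x *v v) \<and>
     (\<forall>X\<in>test_fields M \<Omega>. \<forall>Y\<in>test_fields M \<Omega>.
        (LINT x:\<Omega>|\<mu>. (A x *v Y x) \<bullet> X x) =
        - (LINT x:\<Omega>|\<mu>. W x \<bullet> cov_deriv M X x (Y x) + (W x \<bullet> X x) * surface_div M Y x))"

definition H1 ::
  "(real^3) set \<Rightarrow> (real^3) measure \<Rightarrow> (real^3) set \<Rightarrow> (real^3 \<Rightarrow> real^3) set" where
  "H1 M \<mu> \<Omega> = {W. (\<forall>x\<in>\<Omega>. W x \<in> tangent_space M x) \<and> set_square_integrable \<mu> \<Omega> W \<and>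
     (\<exists>A. set_square_integrable \<mu> \<Omega> A \<and> weak_cov_deriv M \<mu> \<Omega> W A)}"

definition H1_kf ::
  "(real^3) set \<Rightarrow> (real^3) measure \<Rightarrow> (real^3) set \<Rightarrow> (real^3 \<Rightarrow> real^3) set" where
  "H1_kf M \<mu> \<Omega> = {W \<in> H1 M \<mu> \<Omega>.
     \<exists>A. set_square_integrable \<mu> \<Omega> A \<and> weak_cov_deriv M \<mu> \<Omega> W A \<and>
       (AE x\<in>\<Omega> in \<mu>. \<forall>X\<in>tangent_space M x. \<forall>Y\<in>tangent_space M x.
          (A x *v Y) \<bullet> X + (A x *v X) \<bullet> Y = 0)}"


section \<open>The vector space of almost-everywhere classes\<close>

definition ae_rel :: "'a measure \<Rightarrow> 'a set \<Rightarrow> ('a \<Rightarrow> 'b) set \<Rightarrow> (('a \<Rightarrow> 'b) \<times> ('a \<Rightarrow> 'b)) set" where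
  "ae_rel \<mu> \<Omega> V = {(f, g). f \<in> V \<and> g \<in> V \<and> (AE x\<in>\<Omega> in \<mu>. f x = g x)}"

text \<open>The multiplicative fields of the module record are irrelevant.\<close>

definition ae_space ::
  "'a measure \<Rightarrow> 'a set \<Rightarrow> ('a \<Rightarrow> 'b::real_vector) set \<Rightarrow> (real, ('a \<Rightarrow> 'b) set) module" where
  "ae_space \<mu> \<Omega> V =
     \<lparr>carrier = V // ae_rel \<mu> \<Omega> V,
      mult = undefined,
      one = undefined,
      zero = ae_rel \<mu> \<Omega> V `` {\<lambda>x. 0},
      add = (\<lambda>C D. \<Union>f\<in>C. \<Union>g\<in>D. ae_rel \<mu> \<Omega> V `` {\<lambda>x. f x + g x}),
      smult = (\<lambda>a C. \<Union>f\<in>C. ae_rel \<mu> \<Omega> V `` {\<lambda>x. a *\<^sub>R f x})\<rparr>"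

definition real_ring :: "real ring" where
  "real_ring = \<lparr>carrier = UNIV, mult = (*), one = 1, zero = 0, add = (+)\<rparr>"

definition has_dimension :: "(real, 'v, 'x) module_scheme \<Rightarrow> nat \<Rightarrow> bool" where
  "has_dimension V n \<longleftrightarrow> vectorspace real_ring V \<and>
     vectorspace.fin_dim real_ring V \<and> vectorspace.dim real_ring V = n"


section \<open>The case of spheres\<close>

lemma tangent_space_sphere:
  assumes r: "r > 0" and x: "x \<in> sphere c r"
  shows "tangent_space (sphere c r) x = {v. v \<bullet> (x - c) = 0}"
proof (intro equalityI subsetI)
  fix v assume "v \<in> tangent_space (sphere c r) x"
  then obtain \<gamma> \<epsilon> where g: "\<epsilon> > 0" "\<And>t::real. \<bar>t\<bar> < \<epsilon> \<Longrightarrow> \<gamma> t \<in> sphere c r" "\<gamma> 0 = x"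
    "(\<gamma> has_vector_derivative v) (at 0)"
    unfolding tangent_space_def by blast
  have d: "((\<lambda>t. (\<gamma> t - c) \<bullet> (\<gamma> t - c)) has_derivative (\<lambda>h. 2 * h * (v \<bullet> (x - c)))) (at 0)"
    using g(4) unfolding has_vector_derivative_def
    by (auto intro!: derivative_eq_intros simp: g(3) inner_commute)
  have "((\<lambda>t. r\<^sup>2) has_derivative (\<lambda>h. 2 * h * (v \<bullet> (x - c)))) (at 0)"
  proof (rule has_derivative_transform_within[OF d g(1)])
    fix t :: real assume "dist t 0 < \<epsilon>"
    hence "\<gamma> t \<in> sphere c r" using g(2) by simp
    thus "(\<gamma> t - c) \<bullet> (\<gamma> t - c) = r\<^sup>2"
      by (simp add: dist_norm norm_minus_commute power2_norm_eq_inner[symmetric])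
  qed simp
  hence "(\<lambda>h::real. 2 * h * (v \<bullet> (x - c))) = (\<lambda>h. 0)"
    using has_derivative_const has_derivative_unique by blast
  from fun_cong[OF this, of 1] show "v \<in> {v. v \<bullet> (x - c) = 0}" by simp
next
  fix v assume "v \<in> {v. v \<bullet> (x - c) = 0}"
  hence v: "v \<bullet> (x - c) = 0" by simp
  have n: "norm (x - c) = r" using x by (simp add: dist_norm norm_minus_commute)
  define k where "k = norm v / r"
  define \<gamma> where "\<gamma> t = c + cos (k * t) *\<^sub>R (x - c) + (sin (k * t) / k) *\<^sub>R v" for t
  show "v \<in> tangent_space (sphere c r) x"
  proof (cases "v = 0")
    case True
    have "((\<lambda>t::real. x) has_vector_derivative v) (at 0)" using True by simp
    thus ?thesis unfolding tangent_space_def using x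
      by (intro CollectI exI[of _ "\<lambda>t. x"] exI[of _ 1]) simp
  next
    case False
    hence k: "k > 0" using r by (simp add: k_def)
    have 1: "\<gamma> t \<in> sphere c r" for t
    proof -
      have aux: "(norm (p *\<^sub>R (x - c) + q *\<^sub>R v))\<^sup>2 = p\<^sup>2 * r\<^sup>2 + q\<^sup>2 * (norm v)\<^sup>2" for p q
      proof -
        have "orthogonal (p *\<^sub>R (x - c)) (q *\<^sub>R v)"
          using v by (simp add: orthogonal_def inner_commute)
        from norm_add_Pythagorean[OF this] show ?thesis
          by (simp add: n power_mult_distrib)
      qed
      have "\<gamma> t - c = cos (k * t) *\<^sub>R (x - c) + (sin (k * t) / k) *\<^sub>R v"
        by (simp add: \<gamma>_def)
      from aux[of "cos (k * t)" "sin (k * t) / k", folded this]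
      have "(norm (\<gamma> t - c))\<^sup>2 = (cos (k * t))\<^sup>2 * r\<^sup>2 + (sin (k * t) / k)\<^sup>2 * (norm v)\<^sup>2" .
      also have "(norm v)\<^sup>2 = k\<^sup>2 * r\<^sup>2" using r by (simp add: k_def power_divide)
      also have "(cos (k * t))\<^sup>2 * r\<^sup>2 + (sin (k * t) / k)\<^sup>2 * (k\<^sup>2 * r\<^sup>2) =
          ((cos (k * t))\<^sup>2 + (sin (k * t))\<^sup>2) * r\<^sup>2"
      proof -
        have "(sin (k * t) / k)\<^sup>2 * (k\<^sup>2 * r\<^sup>2) = (sin (k * t))\<^sup>2 * r\<^sup>2"
          using k by (simp add: power_divide)
        thus ?thesis by (simp only: distrib_right)
      qed
      also have "\<dots> = r\<^sup>2" by simp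
      finally have "(norm (\<gamma> t - c))\<^sup>2 = r\<^sup>2" .
      hence "norm (\<gamma> t - c) = r" using r by (simp add: power2_eq_iff_nonneg)
      thus ?thesis by (simp add: dist_norm norm_minus_commute)
    qed
    have 2: "(\<gamma> has_vector_derivative v) (at 0)"
      unfolding \<gamma>_def has_vector_derivative_def using k
      by (auto intro!: derivative_eq_intros)
    have 3: "\<gamma> 0 = x" by (simp add: \<gamma>_def)
    show ?thesis unfolding tangent_space_def using 1 2 3
      by (intro CollectI exI[of _ \<gamma>] exI[of _ 1]) simp
  qed
qed

lemma has_gauss_curvature_sphere:
  assumes r: "r > 0" and x: "x \<in> sphere c r"
  shows "has_gauss_curvature (sphere c r) x (1 / r\<^sup>2)"
proof -
  let ?T = "tangent_space (sphere c r) x"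
  define N :: "real^3 \<Rightarrow> real^3" where "N = (\<lambda>y. (1 / r) *\<^sub>R (y - c))"
  have norm_c: "norm (y - c) = r" if "y \<in> sphere c r" for y
    using that by (simp add: dist_norm norm_minus_commute)
  have T: "?T = {w. (x - c) \<bullet> w = 0}"
    using tangent_space_sphere[OF r x] by (simp add: inner_commute)
  have sub: "real_vector.subspace ?T" unfolding T by (rule subspace_hyperplane)
  have "x - c \<noteq> 0" using norm_c[OF x] r by auto
  hence dimT: "real_vector.dim ?T = 2" unfolding T by (simp add: dim_hyperplane)
  obtain B where B: "B \<subseteq> ?T" "pairwise orthogonal B" "\<And>b. b \<in> B \<Longrightarrow> norm b = 1"
    "card B = real_vector.dim ?T" "real_vector.span B = ?T"
    using orthonormal_basis_subspace[OF sub] by metis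
  obtain u v where uv: "B = {u, v}" "u \<noteq> v" using B(4) dimT by (auto simp: card_2_iff)
  have uv1: "norm u = 1" "norm v = 1" "u \<bullet> v = 0"
    using B(2,3) uv by (auto simp: pairwise_def orthogonal_def)
  have uu: "u \<bullet> u = 1" "v \<bullet> v = 1" using uv1 by (simp_all add: norm_eq_1)
  have dN: "(N has_derivative (\<lambda>h. (1 / r) *\<^sub>R h)) (at y)" for y
    unfolding N_def by (auto intro!: derivative_eq_intros)
  have fN: "frechet_derivative N (at x) = (\<lambda>h. (1 / r) *\<^sub>R h)"
    using frechet_derivative_at[OF dN] by simp
  have unit: "norm (N y) = 1 \<and> (\<forall>w\<in>tangent_space (sphere c r) y. N y \<bullet> w = 0)"
    if "y \<in> sphere c r" for y
    using norm_c[OF that] r tangent_space_sphere[OF r that]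
    by (auto simp: N_def inner_commute)
  show ?thesis unfolding has_gauss_curvature_def
  proof (intro exI conjI)
    show "open (UNIV :: (real^3) set)" "x \<in> UNIV" by simp_all
    show "\<forall>y\<in>UNIV. N differentiable (at y)" using dN by (auto simp: differentiable_def)
    show "\<forall>y\<in>sphere c r \<inter> UNIV.
        norm (N y) = 1 \<and> (\<forall>w\<in>tangent_space (sphere c r) y. N y \<bullet> w = 0)"
      using unit by simp
    show "norm u = 1" "norm v = 1" "u \<bullet> v = 0" by (fact uv1)+
    show "real_vector.span {u, v} = ?T" using B(5) uv by simp
    show "1 / r\<^sup>2 = (frechet_derivative N (at x) u \<bullet> u) * (frechet_derivative N (at x) v \<bullet> v)
        - (frechet_derivative N (at x) u \<bullet> v) * (frechet_derivative N (at x) v \<bullet> u)"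
      using uv1 uu by (simp add: fN inner_commute power2_eq_square)
  qed
qed

lemma tproj_orthogonal:
  assumes "real_vector.subspace (tangent_space M x)"
  shows "tproj M x v \<in> tangent_space M x"
    and "\<And>w. w \<in> tangent_space M x \<Longrightarrow> (v - tproj M x v) \<bullet> w = 0"
proof -
  let ?T = "tangent_space M x"
  have c: "closed ?T" "convex ?T" "?T \<noteq> {}"
    using assms closed_subspace subspace_imp_convex real_vector.subspace_0 by blast+
  show in_T: "tproj M x v \<in> ?T"
    unfolding tproj_def using c closest_point_in_set by blast
  have le: "(v - tproj M x v) \<bullet> w \<le> 0" if "w \<in> ?T" for w
  proof -
    have "tproj M x v + w \<in> ?T" using assms in_T that by (simp add: real_vector.subspace_add)
    from closest_point_dot[OF c(2,1) this, of v] show ?thesis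
      unfolding tproj_def by simp
  qed
  fix w assume w: "w \<in> ?T"
  hence "- w \<in> ?T" using assms by (simp add: real_vector.subspace_neg)
  from le[OF w] le[OF this] show "(v - tproj M x v) \<bullet> w = 0" by simp
qed

lemma cov_deriv_metric:
  assumes "real_vector.subspace (tangent_space M x)"
    and "X differentiable (at x)" "Z differentiable (at x)"
    and "X x \<in> tangent_space M x" "Z x \<in> tangent_space M x"
  shows "frechet_derivative (\<lambda>p. X p \<bullet> Z p) (at x) v =
    cov_deriv M X x v \<bullet> Z x + X x \<bullet> cov_deriv M Z x v"
proof -
  have "((\<lambda>p. X p \<bullet> Z p) has_derivative (\<lambda>v. X x \<bullet> frechet_derivative Z (at x) v
      + frechet_derivative X (at x) v \<bullet> Z x)) (at x)"
    using assms(2,3) by (intro has_derivative_inner) (simp_all add: frechet_derivative_works)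
  from fun_cong[OF frechet_derivative_at[OF this], of v]
  have "frechet_derivative (\<lambda>p. X p \<bullet> Z p) (at x) v =
      X x \<bullet> frechet_derivative Z (at x) v + frechet_derivative X (at x) v \<bullet> Z x" by simp
  thus ?thesis
    using tproj_orthogonal(2)[OF assms(1,5), of "frechet_derivative X (at x) v"]
      tproj_orthogonal(2)[OF assms(1,4), of "frechet_derivative Z (at x) v"]
    by (simp add: cov_deriv_def inner_diff_left inner_commute[of "X x"])
qed

text \<open>The right-hand side is the Lie bracket \<open>[X, Y]\<close> at \<open>x\<close>.\<close>

lemma cov_deriv_sphere_torsion_free:
  assumes r: "r > 0" and x: "x \<in> sphere c r"
    and dX: "X differentiable (at x)" and dY: "Y differentiable (at x)"
    and tX: "\<And>y. y \<in> sphere c r \<Longrightarrow> X y \<in> tangent_space (sphere c r) y"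
    and tY: "\<And>y. y \<in> sphere c r \<Longrightarrow> Y y \<in> tangent_space (sphere c r) y"
  shows "cov_deriv (sphere c r) Y x (X x) - cov_deriv (sphere c r) X x (Y x) =
    frechet_derivative Y (at x) (X x) - frechet_derivative X (at x) (Y x)"
proof -
  let ?M = "sphere c r" and ?T = "tangent_space (sphere c r) x"
  have normal: "frechet_derivative Z (at x) v \<bullet> (x - c) = - (Z x \<bullet> v)"
    if Z: "Z differentiable (at x)" "\<And>y. y \<in> ?M \<Longrightarrow> Z y \<in> tangent_space ?M y" and v: "v \<in> ?T" for Z v
  proof -
    obtain \<gamma> \<epsilon> where g: "\<epsilon> > 0" "\<And>t::real. \<bar>t\<bar> < \<epsilon> \<Longrightarrow> \<gamma> t \<in> ?M" "\<gamma> 0 = x"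
      "(\<gamma> has_vector_derivative v) (at 0)"
      using v unfolding tangent_space_def by blast
    let ?Z' = "frechet_derivative Z (at x)"
    have Z': "(Z has_derivative ?Z') (at (\<gamma> 0))" using Z(1) g(3) by (simp add: frechet_derivative_works)
    have lin: "?Z' (h *\<^sub>R v) = h *\<^sub>R ?Z' v" for h
      using Z(1) by (simp add: linear_frechet_derivative linear_cmul)
    have gd: "(\<gamma> has_derivative (\<lambda>h. h *\<^sub>R v)) (at 0)"
      using g(4) by (simp add: has_vector_derivative_def)
    have comp: "((\<lambda>t. Z (\<gamma> t)) has_derivative (\<lambda>h. h *\<^sub>R ?Z' v)) (at 0)"
      using has_derivative_compose[OF gd Z'] lin by simp
    have gc: "((\<lambda>t. \<gamma> t - c) has_derivative (\<lambda>h. h *\<^sub>R v)) (at 0)"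
      using has_derivative_diff[OF gd has_derivative_const[of c]] by simp
    have d: "((\<lambda>t. Z (\<gamma> t) \<bullet> (\<gamma> t - c)) has_derivative
        (\<lambda>h. h * (?Z' v \<bullet> (x - c) + Z x \<bullet> v))) (at 0)"
      using has_derivative_inner[OF comp gc] g(3)
      by (simp add: algebra_simps)
    have "((\<lambda>t::real. 0::real) has_derivative (\<lambda>h. h * (?Z' v \<bullet> (x - c) + Z x \<bullet> v))) (at 0)"
    proof (rule has_derivative_transform_within[OF d g(1)])
      fix t :: real assume "dist t 0 < \<epsilon>"
      hence m: "\<gamma> t \<in> ?M" using g(2) by simp
      show "Z (\<gamma> t) \<bullet> (\<gamma> t - c) = 0"
        using Z(2)[OF m] tangent_space_sphere[OF r m] by simp
    qed simp
    hence "(\<lambda>h::real. h * (?Z' v \<bullet> (x - c) + Z x \<bullet> v)) = (\<lambda>h. 0)"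
      using has_derivative_const has_derivative_unique by blast
    from fun_cong[OF this, of 1] show ?thesis by simp
  qed
  have T: "?T = {v. v \<bullet> (x - c) = 0}" by (rule tangent_space_sphere[OF r x])
  have sub: "real_vector.subspace ?T" unfolding T by (auto simp: real_vector.subspace_def inner_add_left)
  let ?a = "frechet_derivative Y (at x) (X x)" and ?b = "frechet_derivative X (at x) (Y x)"
  let ?u = "?a - ?b" and ?w = "tproj ?M x ?a - tproj ?M x ?b"
  have u: "?u \<in> ?T"
    using normal[OF dX tX tY[OF x]] normal[OF dY tY tX[OF x]]
    by (simp add: T inner_diff_left inner_commute[of "X x" "Y x"])
  have w: "?w \<in> ?T" using tproj_orthogonal(1)[OF sub] sub by (simp add: real_vector.subspace_diff)
  have "(?u - ?w) \<bullet> z = 0" if "z \<in> ?T" for z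
    using tproj_orthogonal(2)[OF sub that, of ?a] tproj_orthogonal(2)[OF sub that, of ?b]
    by (simp add: inner_diff_left)
  moreover have "?u - ?w \<in> ?T" using u w sub by (simp add: real_vector.subspace_diff)
  ultimately have "(?u - ?w) \<bullet> (?u - ?w) = 0" by blast
  hence "?u = ?w" by simp
  thus ?thesis by (simp add: cov_deriv_def)
qed

end

theory Submission
  imports Defs
begin

text \<open>
  On the sphere with centre \<open>c\<close> the Killing fields are the rotation fields
  \<open>x \<mapsto> \<omega> \<times> (x - c)\<close>. That these satisfy the weak equations is the divergence theorem
  for tangent fields, which follows from the rotation invariance of the area: a tangent field
  \<open>Y\<close> is \<open>y \<times> \<xi>\<close> with \<open>\<xi> = x - c\<close> and \<open>y = (\<xi> \<times> Y) / r\<^sup>2\<close>, and its divergence is the sum of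
  the derivatives of the components \<open>y \<bullet> e\<close> along the rotations about the axes \<open>e\<close>.

  Conversely, for a weak Killing field \<open>W\<close> the weak derivative is \<open>v \<mapsto> \<alpha> \<xi> \<times> v\<close> for a scalar
  function \<open>\<alpha>\<close>. If \<open>W\<close> is \<open>\<omega> \<times> \<xi>\<close> then \<open>\<omega> = \<alpha> \<xi> + (\<xi> \<times> W) / r\<^sup>2\<close>, so one shows that the right-hand
  side has zero weak derivative along every rotation. Its averages against bump functions
  \<open>k(\<bar>x - p\<bar>)\<close> are then locally independent of \<open>p\<close>, since moving \<open>p\<close> by a rotation amounts to
  moving \<open>x\<close> by the inverse rotation; letting the bumps shrink, it is almost everywhere constant.
\<close>

section \<open>Smooth functions and flat bumps\<close>

text \<open>The obstacle is one missing derivative: \<open>\<alpha>\<close> is only known to be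
  integrable, while constancy of the angular velocity involves a derivative of
  \<open>\<alpha>\<close>, that is, second derivatives of \<open>W\<close>. No derivative of
  \<open>\<alpha>\<close> is ever formed; the weak equation is tested with derivatives of a bump
  instead, and the second derivatives of the test function cancel. Rotations replace the
  translations of ordinary mollification: they act transitively on the sphere and preserve its area,
  so all differentiation is along rotations and no chart occurs. A pair of test fields requires two
  compactly supported factors; this is why the bumps use \<open>exp (- 2 / s)\<close>, which splits
  into two factors \<open>exp (- 1 / s)\<close>. Connectedness of \<open>\<Omega>\<close> turns a
  locally constant angular velocity into a single vector, and non-emptiness makes that vector
  unique.\<close>

abbreviation fd :: "('a::euclidean_space \<Rightarrow> 'b::real_normed_vector) \<Rightarrow> 'a \<Rightarrow> 'a \<Rightarrow> 'b" where
  "fd f x \<equiv> frechet_derivative f (at x)"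

definition smooth :: "('a::euclidean_space \<Rightarrow> 'b::real_normed_vector) \<Rightarrow> bool" where
  "smooth f \<longleftrightarrow> (\<forall>k. Ck k f)"

lemma fd_eq: "(f has_derivative f') (at x) \<Longrightarrow> fd f x = f'"
  using frechet_derivative_at by metis

lemma fd_works: "f differentiable (at x) \<Longrightarrow> (f has_derivative fd f x) (at x)"
  by (simp add: frechet_derivative_works)

lemma Ck_imp_continuous: "Ck k f \<Longrightarrow> continuous_on UNIV f"
  by (cases k)
    (auto intro!: differentiable_imp_continuous_on simp: differentiable_on_def differentiable_at_imp_differentiable_on)

lemma Ck_SucD: "Ck (Suc k) f \<Longrightarrow> Ck k f"
proof (induction k arbitrary: f)
  case 0
  thus ?case using Ck_imp_continuous[of "Suc 0" f] by (simp only: Ck.simps(1))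
next
  case (Suc k)
  show ?case unfolding Ck.simps(2)[of k]
  proof (intro conjI allI)
    show "f differentiable at x" for x using Suc.prems by simp
    show "Ck k (\<lambda>x. fd f x v)" for v using Suc.IH Suc.prems by (metis Ck.simps(2))
  qed
qed

lemma Ck_const: "Ck k (\<lambda>x::'a::euclidean_space. c::'b::real_normed_vector)"
proof (induction k arbitrary: c)
  case (Suc k)
  have "fd (\<lambda>x. c) x = (\<lambda>v. 0)" for x :: 'a by (rule fd_eq) simp
  with Suc show ?case by simp
qed simp

lemma Ck_bounded_linear:
  assumes "bounded_linear f"
  shows "Ck k f"
proof (cases k)
  case (Suc j)
  have "fd f x = f" for x by (rule fd_eq) (rule bounded_linear_imp_has_derivative[OF assms])
  thus ?thesis using Suc bounded_linear_imp_differentiable[OF assms] by (simp add: Ck_const)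
qed (use assms in \<open>simp add: linear_continuous_on\<close>)

lemma Ck_add: "Ck k f \<Longrightarrow> Ck k g \<Longrightarrow> Ck k (\<lambda>x. f x + g x)"
proof (induction k arbitrary: f g)
  case (Suc k)
  hence d: "f differentiable at x" "g differentiable at x" for x by simp_all
  have "fd (\<lambda>x. f x + g x) x = (\<lambda>v. fd f x v + fd g x v)" for x
    by (rule fd_eq) (intro has_derivative_add fd_works d)
  with Suc d show ?case by (simp add: differentiable_add)
qed (simp add: continuous_on_add)

text \<open>One product rule serves for scaling, multiplication, inner and cross product. Each
  summand of the derivative still contains an undifferentiated factor, which \<open>Ck_SucD\<close>
  lowers to class \<open>k\<close> for the induction.\<close>

lemma Ck_bilinear:
  assumes p: "bounded_bilinear p"
  shows "Ck k f \<Longrightarrow> Ck k g \<Longrightarrow> Ck k (\<lambda>x. p (f x) (g x))"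
proof (induction k arbitrary: f g)
  case 0
  thus ?case using bounded_bilinear.continuous_on[OF p] by simp
next
  case (Suc k)
  hence d: "f differentiable at x" "g differentiable at x" for x by simp_all
  have 1: "((\<lambda>x. p (f x) (g x)) has_derivative (\<lambda>v. p (f x) (fd g x v) + p (fd f x v) (g x))) (at x)" for x
    by (intro bounded_bilinear.FDERIV[OF p] fd_works d)
  have "Ck k (\<lambda>x. p (f x) (fd g x v) + p (fd f x v) (g x))" for v
    using Suc.prems by (intro Ck_add Suc.IH Ck_SucD[OF Suc.prems(1)] Ck_SucD[OF Suc.prems(2)]) auto
  thus ?case using fd_eq[OF 1] 1 by (auto simp: differentiable_def)
qed

lemma smooth_const: "smooth (\<lambda>x. c)"
  by (simp add: smooth_def Ck_const)

lemma smooth_bounded_linear: "bounded_linear h \<Longrightarrow> smooth h"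
  by (simp add: smooth_def Ck_bounded_linear)

lemma smooth_add: "smooth f \<Longrightarrow> smooth g \<Longrightarrow> smooth (\<lambda>x. f x + g x)"
  by (simp add: smooth_def Ck_add)

lemma smooth_bilinear:
  "bounded_bilinear p \<Longrightarrow> smooth f \<Longrightarrow> smooth g \<Longrightarrow> smooth (\<lambda>x. p (f x) (g x))"
  by (simp add: smooth_def Ck_bilinear)

lemma smooth_id: "smooth (\<lambda>x. x)"
  by (rule smooth_bounded_linear) (rule bounded_linear_ident)

lemmas smooth_scaleR = smooth_bilinear[OF bounded_bilinear_scaleR]
  and smooth_mult = smooth_bilinear[OF bounded_bilinear_mult]
  and smooth_inner = smooth_bilinear[OF bounded_bilinear_inner]

lemma smooth_minus: "smooth f \<Longrightarrow> smooth (\<lambda>x. - f x)"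
  using smooth_scaleR[OF smooth_const[of "-1"], of f] by simp

lemma smooth_diff: "smooth f \<Longrightarrow> smooth g \<Longrightarrow> smooth (\<lambda>x. f x - g x)"
  using smooth_add[OF _ smooth_minus, of f g] by simp

lemma smooth_sum: "(\<And>i. i \<in> I \<Longrightarrow> smooth (f i)) \<Longrightarrow> smooth (\<lambda>x. \<Sum>i\<in>I. f i x)"
  by (induction I rule: infinite_finite_induct) (auto intro: smooth_const smooth_add)

lemma smooth_power: "smooth f \<Longrightarrow> smooth (\<lambda>x. (f x :: real) ^ n)"
  by (induction n) (auto intro: smooth_const smooth_mult)

lemma smooth_fd: "smooth f \<Longrightarrow> smooth (\<lambda>x. fd f x v)"
  unfolding smooth_def by (metis Ck.simps(2))

lemma smooth_imp_differentiable: "smooth f \<Longrightarrow> f differentiable (at x)"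
  unfolding smooth_def by (metis Ck.simps(2))

lemma smooth_imp_continuous: "smooth f \<Longrightarrow> continuous_on S f"
  unfolding smooth_def by (metis Ck_imp_continuous continuous_on_subset subset_UNIV)

lemma smooth_has_derivative: "smooth f \<Longrightarrow> (f has_derivative fd f x) (at x)"
  by (intro fd_works smooth_imp_differentiable)

lemmas smooth_intros = smooth_const smooth_id smooth_add smooth_diff smooth_minus smooth_mult
  smooth_scaleR smooth_inner smooth_power smooth_sum smooth_fd

text \<open>\<open>Ck\<close> only speaks of derivatives in a fixed direction. A direction that
  varies with \<open>x\<close> is expanded in the basis, using linearity of the derivative.\<close>

lemma smooth_fd_comp:
  fixes f :: "'a::euclidean_space \<Rightarrow> 'b::real_normed_vector"
  assumes "smooth f" "smooth g"
  shows "smooth (\<lambda>x. fd f x (g x))"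
proof -
  have "fd f x (g x) = (\<Sum>i\<in>Basis. (g x \<bullet> i) *\<^sub>R fd f x i)" for x
  proof -
    have l: "linear (fd f x)"
      by (rule linear_frechet_derivative[OF smooth_imp_differentiable[OF assms(1)]])
    have "fd f x (\<Sum>i\<in>Basis. (g x \<bullet> i) *\<^sub>R i) = (\<Sum>i\<in>Basis. (g x \<bullet> i) *\<^sub>R fd f x i)"
      using l by (simp add: linear_sum linear_cmul)
    thus ?thesis by (simp only: euclidean_representation)
  qed
  moreover have "smooth (\<lambda>x. \<Sum>i\<in>Basis. (g x \<bullet> i) *\<^sub>R fd f x i)"
    by (intro smooth_intros assms)
  ultimately show ?thesis by simp
qed

text \<open>The denominators \<open>s ^ j\<close> make the family closed under differentiation.\<close>

definition eflat :: "real \<Rightarrow> nat \<Rightarrow> real \<Rightarrow> real" where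
  "eflat \<kappa> j s = (if s > 0 then exp (- \<kappa> / s) / s ^ j else 0)"

lemma eflat_nonneg: "eflat \<kappa> j s \<ge> 0"
  by (simp add: eflat_def)

lemma eflat_pos: "s > 0 \<Longrightarrow> eflat \<kappa> j s > 0"
  by (simp add: eflat_def)

text \<open>Read from right to left, this splits a flat function into two smooth factors with the
  same support, one for each field of a test pair.\<close>

lemma eflat_mult: "eflat \<kappa> i s * eflat \<mu> j s = eflat (\<kappa> + \<mu>) (i + j) s"
  by (simp add: eflat_def power_add exp_add[symmetric] diff_divide_distrib)

lemma eflat_shift: "s ^ i * eflat \<kappa> (i + j) s = eflat \<kappa> j s"
  by (simp add: eflat_def power_add)

text \<open>The substitution \<open>y = \<kappa> / s\<close> reduces this to
  \<open>y ^ j / exp y\<close> tending to 0 at infinity.\<close>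

lemma eflat_quotient_tendsto: assumes "\<kappa> > 0" shows "(eflat \<kappa> j \<longlongrightarrow> 0) (at_right 0)"
proof -
  have "((\<lambda>y. (1/\<kappa>)^j * (y ^ j / exp y)) \<longlongrightarrow> (1/\<kappa>)^j * 0) at_top"
    by (intro tendsto_mult tendsto_const tendsto_power_div_exp_0)
  moreover have "filterlim (\<lambda>s. \<kappa> / s) at_top (at_right (0::real))"
    unfolding divide_inverse
    by (rule filterlim_tendsto_pos_mult_at_top[OF tendsto_const assms filterlim_inverse_at_top_right])
  ultimately have "((\<lambda>s. (1/\<kappa>)^j * ((\<kappa> / s) ^ j / exp (\<kappa> / s))) \<longlongrightarrow> 0) (at_right 0)"
    using filterlim_compose[of "\<lambda>y. (1/\<kappa>)^j * (y ^ j / exp y)" "nhds 0" at_top "\<lambda>s. \<kappa> / s" "at_right 0"] by simp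
  thus ?thesis
  proof (rule Lim_transform_eventually)
    show "\<forall>\<^sub>F s in at_right 0. (1 / \<kappa>) ^ j * ((\<kappa> / s) ^ j / exp (\<kappa> / s)) = eflat \<kappa> j s"
      using assms by (auto simp: eventually_at_filter eflat_def exp_minus field_simps power_divide)
  qed
qed

text \<open>To the left of 0 the function is locally zero, to the right this is the quotient rule.
  At 0 the right difference quotient is \<open>eflat \<kappa> (Suc j)\<close>, which tends to 0, and
  the claimed value is 0 as well.\<close>

lemma eflat_derivative:
  assumes "\<kappa> > 0"
  shows "(eflat \<kappa> j has_real_derivative \<kappa> * eflat \<kappa> (j + 2) s - j * eflat \<kappa> (j + 1) s) (at s)"
proof (rule linorder_cases[of s 0])
  assume s: "s < 0"
  have "((\<lambda>s. 0) has_real_derivative 0) (at s)" by simp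
  moreover have "eventually (\<lambda>t. t < 0) (nhds s)" using s eventually_nhds_in_open[of "{..<0}" s] by simp
  hence "eventually (\<lambda>t. 0 = eflat \<kappa> j t) (nhds s)" by eventually_elim (simp add: eflat_def)
  ultimately show ?thesis
    using s has_field_derivative_cong_eventually DERIV_cong_ev[of s s "\<lambda>s. 0" "eflat \<kappa> j" 0 0]
    by (simp add: eflat_def)
next
  assume s: "0 < s"
  have e: "((\<lambda>s. exp (- \<kappa> / s)) has_real_derivative exp (- \<kappa> / s) * (\<kappa> / s\<^sup>2)) (at s)"
    using s by (auto intro!: derivative_eq_intros simp: power2_eq_square)
  have "((\<lambda>s. exp (- \<kappa> / s) / s ^ j) has_real_derivative (exp (- \<kappa> / s) * (\<kappa> / s\<^sup>2) * s ^ j -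
      exp (- \<kappa> / s) * (real j * s ^ (j - Suc 0))) / (s ^ j * s ^ j)) (at s)"
    using DERIV_divide[OF e DERIV_pow] s by simp
  \<comment> \<open>The exponent \<open>j - Suc 0\<close> is truncated at \<open>j = 0\<close>,
    where its factor \<open>real j\<close> vanishes; hence the case split on
    \<open>j\<close>.\<close>
  moreover have "(exp (- \<kappa> / s) * (\<kappa> / s\<^sup>2) * s ^ j - exp (- \<kappa> / s) * (real j * s ^ (j - Suc 0))) /
      (s ^ j * s ^ j) = \<kappa> * eflat \<kappa> (j + 2) s - j * eflat \<kappa> (j + 1) s"
    using s by (cases j) (simp_all add: eflat_def field_simps power2_eq_square)
  ultimately have 1: "((\<lambda>s. exp (- \<kappa> / s) / s ^ j) has_real_derivative
      \<kappa> * eflat \<kappa> (j + 2) s - j * eflat \<kappa> (j + 1) s) (at s)"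
    by simp
  have "eventually (\<lambda>t. t > 0) (nhds s)" using s eventually_nhds_in_open[of "{0<..}" s] by simp
  hence "eventually (\<lambda>t. exp (- \<kappa> / t) / t ^ j = eflat \<kappa> j t) (nhds s)" by eventually_elim (simp add: eflat_def)
  from DERIV_cong_ev[OF refl this refl] 1 show ?thesis by blast
next
  assume s: "s = 0"
  have "((\<lambda>t. (eflat \<kappa> j t - eflat \<kappa> j 0) / (t - 0)) \<longlongrightarrow> 0) (at 0)"
    unfolding filterlim_split_at_real
  proof (intro filterlim_split_at)
    show "((\<lambda>t. (eflat \<kappa> j t - eflat \<kappa> j 0) / (t - 0)) \<longlongrightarrow> 0) (at_left 0)"
      by (rule tendsto_eventually) (auto simp: eventually_at_filter eflat_def)
    show "((\<lambda>t. (eflat \<kappa> j t - eflat \<kappa> j 0) / (t - 0)) \<longlongrightarrow> 0) (at_right 0)"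
      by (rule Lim_transform_eventually[OF eflat_quotient_tendsto[OF assms, of "Suc j"]])
        (auto simp: eventually_at_filter eflat_def)
  qed
  thus ?thesis using s by (simp add: eflat_def has_field_derivative_iff)
qed

text \<open>The derivative is \<open>fd q\<close> times a combination of members of the family with
  larger \<open>j\<close>, so the induction on \<open>k\<close> has to leave \<open>j\<close>
  arbitrary.\<close>

lemma Ck_eflat:
  fixes q :: "'a::euclidean_space \<Rightarrow> real"
  assumes q: "smooth q" and "\<kappa> > 0"
  shows "Ck k (\<lambda>x. eflat \<kappa> j (q x))"
proof (induction k arbitrary: j)
  have 1: "((\<lambda>x. eflat \<kappa> j (q x)) has_derivative
      (\<lambda>v. (\<kappa> * eflat \<kappa> (j + 2) (q x) + - real j * eflat \<kappa> (j + 1) (q x)) * fd q x v)) (at x)" for j x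
    using has_derivative_compose[OF smooth_has_derivative[OF q]
        eflat_derivative[OF assms(2), unfolded has_field_derivative_def], of j x] by simp
  {
    case 0
    show ?case using 1 by (auto intro!: has_derivative_continuous_on simp: has_derivative_at_withinI)
  next
    case (Suc k)
    have "Ck k (\<lambda>x. (\<kappa> * eflat \<kappa> (j + 2) (q x) + - real j * eflat \<kappa> (j + 1) (q x)) * fd q x v)" for v
      using Suc smooth_fd[OF q]
      by (intro Ck_add Ck_bilinear[OF bounded_bilinear_mult] Ck_const) (auto simp: smooth_def)
    thus ?case unfolding Ck.simps(2) fd_eq[OF 1] using 1 differentiable_def by blast
  }
qed

lemma smooth_eflat: "smooth q \<Longrightarrow> \<kappa> > 0 \<Longrightarrow> smooth (\<lambda>x. eflat \<kappa> j (q x))"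
  by (simp add: smooth_def Ck_eflat)

section \<open>Area of the sphere and rotations\<close>

unbundle cross3_syntax

lemma sphere_area_sets [simp, measurable_cong]: "sets (sphere_area c r) = sets borel"
  and sphere_area_space [simp]: "space (sphere_area c r) = UNIV"
  by (simp_all add: sphere_area_def)

text \<open>The radial projection inside \<open>sphere_area\<close>. At \<open>x = c\<close> the
  division by zero yields the value \<open>c\<close>, which is off the sphere when
  \<open>r > 0\<close>; statements about the area exclude this null set.\<close>

definition rproj :: "real^3 \<Rightarrow> real \<Rightarrow> real^3 \<Rightarrow> real^3" where
  "rproj c r x = c + (r / norm (x - c)) *\<^sub>R (x - c)"

lemma rproj_measurable [measurable]: "rproj c r \<in> borel_measurable borel"
  unfolding rproj_def by measurable

lemma sphere_area_alt: "sphere_area c r =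
    distr (density lborel (\<lambda>x. ennreal (3 / r) * indicator (cball c r) x)) borel (rproj c r)"
  unfolding sphere_area_def rproj_def ..

lemma weight_measurable [measurable, simp]:
  "(\<lambda>x. ennreal a * indicator (cball c r) x) \<in> borel_measurable borel"
  by (intro borel_measurable_times_ennreal borel_measurable_const borel_measurable_indicator) simp

lemma finite_measure_sphere_area: "finite_measure (sphere_area c r)"
proof
  have "emeasure (sphere_area c r) UNIV = (\<integral>\<^sup>+x. ennreal (3 / r) * indicator (cball c r) x \<partial>lborel)"
    by (simp add: sphere_area_alt emeasure_distr emeasure_density)
  also have "\<dots> = ennreal (3 / r) * emeasure lborel (cball c r)"
    by (subst nn_integral_cmult_indicator) auto
  also have "\<dots> < \<infinity>"
    using emeasure_bounded_finite[OF bounded_cball, of c r] by (simp add: ennreal_mult_less_top)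
  finally show "emeasure (sphere_area c r) (space (sphere_area c r)) \<noteq> \<infinity>" by simp
qed

lemma rproj_in_sphere: "r > 0 \<Longrightarrow> x \<noteq> c \<Longrightarrow> rproj c r x \<in> sphere c r"
  by (simp add: rproj_def dist_norm)

lemma AE_sphere_area: assumes "r > 0" shows "AE x in sphere_area c r. x \<in> sphere c r"
proof -
  have "AE x in lborel. x \<noteq> c"
    by (rule AE_I'[of "{c}"]) (auto simp: null_sets_def)
  hence "AE x in lborel. rproj c r x \<in> sphere c r"
    by eventually_elim (rule rproj_in_sphere[OF assms])
  thus ?thesis
    unfolding sphere_area_alt
    by (subst AE_distr_iff) (auto simp: AE_density elim: eventually_mono intro!: borel_closed)
qed

text \<open>The midpoint of \<open>c\<close> and \<open>x\<close> projects to \<open>x\<close>, so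
  the part of the cone over \<open>U\<close> inside the open ball contains a small ball around it.
  This is what makes almost everywhere statements decide values on open sets later on.\<close>

lemma emeasure_sphere_area_pos:
  assumes "r > 0" "open U" "x \<in> U" "x \<in> sphere c r"
  shows "emeasure (sphere_area c r) U > 0"
proof -
  have [measurable]: "U \<in> sets borel" using assms by simp
  let ?B = "ball c r - {c}"
  let ?V = "?B \<inter> rproj c r -` U"
  let ?y = "c + (1/2) *\<^sub>R (x - c)"
  have nx: "norm (x - c) = r" using assms by (simp add: dist_norm norm_minus_commute)
  have "open ?V"
  proof (rule continuous_open_preimage)
    show "continuous_on ?B (rproj c r)"
      unfolding rproj_def by (intro continuous_intros) auto
  qed (auto simp: assms)
  moreover have "?y \<in> ?V" using assms nx by (auto simp: rproj_def dist_norm)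
  ultimately obtain e where e: "e > 0" "ball ?y e \<subseteq> ?V" by (meson open_contains_ball)
  have "0 < emeasure lborel (ball ?y e)"
    using e by (simp add: emeasure_ball unit_ball_vol_pos)
  also have "\<dots> \<le> emeasure lborel ?V"
    using e \<open>open ?V\<close> by (intro emeasure_mono) auto
  finally have pos: "0 < emeasure lborel ?V" .
  have "0 < ennreal (3 / r) * emeasure lborel ?V" using pos assms by (simp add: ennreal_zero_less_mult_iff)
  also have "\<dots> = (\<integral>\<^sup>+x. ennreal (3 / r) * indicator ?V x \<partial>lborel)"
    using \<open>open ?V\<close> by (subst nn_integral_cmult_indicator) auto
  also have "\<dots> \<le> (\<integral>\<^sup>+x. ennreal (3 / r) * indicator (cball c r) x * indicator (rproj c r -` U) x \<partial>lborel)"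
    by (intro nn_integral_mono) (auto simp: indicator_def)
  also have "\<dots> = emeasure (sphere_area c r) U"
  proof -
    have "rproj c r -` U \<in> sets borel" using measurable_sets[OF rproj_measurable, of U c r] by simp
    thus ?thesis by (simp add: sphere_area_alt emeasure_distr emeasure_density)
  qed
  finally show ?thesis .
qed

section \<open>Rotation invariance of the area\<close>

lemma lborel_distr_orthogonal:
  fixes f :: "real^3 \<Rightarrow> real^3"
  assumes f: "orthogonal_transformation f"
  shows "distr lborel borel f = lborel"
proof (rule lborel_eqI[symmetric])
  have lin: "linear f" by (rule orthogonal_transformation_linear[OF f])
  hence [measurable]: "f \<in> borel_measurable borel"
    by (intro borel_measurable_continuous_onI linear_continuous_on) (simp add: linear_conv_bounded_linear)
  fix l u :: "real^3"
  obtain g where g: "orthogonal_transformation g" "\<And>x. g (f x) = x" "\<And>x. f (g x) = x"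
    using orthogonal_transformation_inv[OF f] orthogonal_transformation_bij[OF f]
    by (metis bij_inv_eq_iff)
  \<comment> \<open>The preimage is rewritten as an image under the inverse, because the invariance
    of Lebesgue measure is available for orthogonal images.\<close>
  have im: "f -` box l u = g ` box l u" using g by (auto simp: image_iff) metis
  have [measurable]: "f -` box l u \<in> sets borel" using measurable_sets[of f borel borel "box l u"] by simp
  have lm: "box l u \<in> lmeasurable" by simp
  have glm: "g ` box l u \<in> lmeasurable" by (rule measurable_orthogonal_image[OF g(1) lm])
  have "emeasure (distr lborel borel f) (box l u) = emeasure lborel (f -` box l u)"
    by (simp add: emeasure_distr)
  also have "\<dots> = emeasure lebesgue (g ` box l u)"
    using \<open>f -` box l u \<in> sets borel\<close> unfolding im by simp
  also have "\<dots> = ennreal (measure lebesgue (g ` box l u))"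
    using fmeasurableD2[OF glm] by (intro emeasure_eq_ennreal_measure) simp
  also have "\<dots> = ennreal (measure lebesgue (box l u))"
    using measure_orthogonal_image[OF g(1) lm] by simp
  also have "\<dots> = emeasure lborel (box l u)"
    using lm by (simp add: emeasure_eq_ennreal_measure fmeasurableD2)
  finally show "emeasure (distr lborel borel f) (box l u) = (\<Prod>b\<in>Basis. (u - l) \<bullet> b)"
    if "\<And>b. b \<in> Basis \<Longrightarrow> l \<bullet> b \<le> u \<bullet> b"
    using that by (simp add: emeasure_lborel_box)
qed simp

lemma lborel_distr_translate: "distr lborel borel (\<lambda>x. t + x) = (lborel :: ('a::euclidean_space) measure)"
  using lborel_affine[of 1 t] by (simp add: density_1)

lemma lborel_distr_rigid:
  fixes f :: "real^3 \<Rightarrow> real^3"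
  assumes f: "orthogonal_transformation f"
  shows "distr lborel borel (\<lambda>x. c + f (x - c)) = lborel"
proof -
  have lin: "linear f" by (rule orthogonal_transformation_linear[OF f])
  hence [measurable]: "f \<in> borel_measurable borel"
    by (intro borel_measurable_continuous_onI linear_continuous_on) (simp add: linear_conv_bounded_linear)
  have "distr lborel borel (\<lambda>x. c + f (x - c)) =
      distr (distr lborel borel f) borel (\<lambda>y. (c - f c) + y)"
    by (subst distr_distr) (auto simp: linear_diff[OF lin] o_def algebra_simps)
  thus ?thesis by (simp add: lborel_distr_orthogonal[OF f] lborel_distr_translate)
qed

text \<open>An orthogonal map about \<open>c\<close> preserves the ball and commutes with the radial
  projection, so the claim reduces to invariance of Lebesgue measure.\<close>

lemma sphere_area_rigid:
  fixes f :: "real^3 \<Rightarrow> real^3"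
  assumes f: "orthogonal_transformation f"
  shows "distr (sphere_area c r) borel (\<lambda>x. c + f (x - c)) = sphere_area c r"
proof -
  have lin: "linear f" by (rule orthogonal_transformation_linear[OF f])
  hence [measurable]: "f \<in> borel_measurable borel"
    by (intro borel_measurable_continuous_onI linear_continuous_on) (simp add: linear_conv_bounded_linear)
  let ?F = "\<lambda>x. c + f (x - c)" and ?w = "\<lambda>x. ennreal (3 / r) * indicator (cball c r) x"
  have nf: "norm (f x) = norm x" for x using f by (simp add: orthogonal_transformation)
  have comm: "?F (rproj c r x) = rproj c r (?F x)" for x
    by (simp add: rproj_def nf linear_cmul[OF lin])
  have w: "?w (?F x) = ?w x" for x
    by (simp add: indicator_def dist_norm nf norm_minus_commute[of c])
  have "distr (density lborel ?w) borel ?F = density (distr lborel borel ?F) ?w"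
    by (subst density_distr) (simp_all add: w)
  hence inv: "distr (density lborel ?w) borel ?F = density lborel ?w"
    by (simp add: lborel_distr_rigid[OF f])
  have "distr (sphere_area c r) borel ?F = distr (density lborel ?w) borel (\<lambda>x. ?F (rproj c r x))"
    unfolding sphere_area_alt by (subst distr_distr) (auto simp: o_def)
  also have "\<dots> = distr (distr (density lborel ?w) borel ?F) borel (rproj c r)"
    by (subst distr_distr) (auto simp: o_def comm)
  finally show ?thesis by (simp add: inv sphere_area_alt)
qed

text \<open>Rodrigues' formula: for a unit vector \<open>b\<close>, the rotation by the angle
  \<open>t\<close> about the axis \<open>b\<close>.\<close>

definition rot :: "real^3 \<Rightarrow> real \<Rightarrow> real^3 \<Rightarrow> real^3" where
  "rot b t v = cos t *\<^sub>R v + sin t *\<^sub>R (b \<times> v) + ((1 - cos t) * (b \<bullet> v)) *\<^sub>R b"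

lemma linear_rot: "linear (rot b t)"
  by (rule linearI) (simp_all add: rot_def cross_add_right Cross3.right_diff_distrib cross_mult_right inner_add_right algebra_simps)

lemma cross_cross_unit: assumes "norm b = 1" shows "b \<times> (b \<times> v) = (b \<bullet> v) *\<^sub>R b - v"
proof -
  have "b \<bullet> b = 1" using assms by (simp add: norm_eq_1)
  thus ?thesis by (simp add: Lagrange)
qed

lemma norm_rot: assumes "norm b = 1" shows "norm (rot b t v) = norm v"
proof -
  have bb: "b \<bullet> b = 1" using assms by (simp add: norm_eq_1)
  have cc: "(b \<times> v) \<bullet> (b \<times> v) = v \<bullet> v - (b \<bullet> v)^2"
    using norm_cross_dot[of b v] assms by (simp add: power2_norm_eq_inner)
  have z: "v \<bullet> (b \<times> v) = 0" "b \<bullet> (b \<times> v) = 0" "(b \<times> v) \<bullet> v = 0" "(b \<times> v) \<bullet> b = 0"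
    by (simp_all add: dot_cross_self)
  have "rot b t v \<bullet> rot b t v = (cos t)^2 * (v \<bullet> v) + (sin t)^2 * (v \<bullet> v - (b \<bullet> v)^2)
      + (1 - cos t)^2 * (b \<bullet> v)^2 + 2 * cos t * (1 - cos t) * (b \<bullet> v)^2"
    unfolding rot_def inner_add_left inner_add_right inner_scaleR_left inner_scaleR_right z cc bb
      inner_commute[of v b]
    by (simp add: power2_eq_square algebra_simps)
  also have "\<dots> = v \<bullet> v"
    unfolding sin_squared_eq by (simp add: power2_eq_square algebra_simps)
  finally show ?thesis by (simp add: norm_eq_sqrt_inner)
qed

lemma orthogonal_rot: "norm b = 1 \<Longrightarrow> orthogonal_transformation (rot b t)"
  by (simp add: orthogonal_transformation linear_rot norm_rot)

lemma rot_derivative: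
  assumes "norm b = 1"
  shows "((\<lambda>t. rot b t v) has_vector_derivative b \<times> rot b t v) (at t)"
proof -
  have 1: "b \<times> rot b t v = (- sin t) *\<^sub>R v + cos t *\<^sub>R (b \<times> v) + (sin t * (b \<bullet> v)) *\<^sub>R b"
    by (simp add: rot_def cross_add_right Cross3.right_diff_distrib cross_mult_right cross_cross_unit[OF assms] algebra_simps)
  show ?thesis unfolding 1 unfolding rot_def
    by (auto intro!: derivative_eq_intros simp: has_vector_derivative_def algebra_simps)
qed

lemma rot_0 [simp]: "rot b 0 v = v"
  by (simp add: rot_def)

lemma rot_rot: assumes "norm b = 1" shows "rot b s (rot b t v) = rot b (s + t) v"
proof -
  have bb: "b \<bullet> b = 1" using assms by (simp add: norm_eq_1)
  have 1: "b \<bullet> rot b t v = b \<bullet> v"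
    by (simp add: rot_def inner_add_right dot_cross_self bb algebra_simps)
  have "rot b s (rot b t v) = cos s *\<^sub>R rot b t v + sin s *\<^sub>R (b \<times> rot b t v) + ((1 - cos s) * (b \<bullet> v)) *\<^sub>R b"
    by (simp add: rot_def[of b s] 1)
  thus ?thesis
    by (simp add: rot_def[of b t] rot_def[of b "s + t"] cos_add sin_add cross_add_right Cross3.right_diff_distrib cross_mult_right
        cross_cross_unit[OF assms] algebra_simps)
qed

section \<open>Differentiation along rotations\<close>

text \<open>By the mean value theorem the difference quotients are bounded by \<open>B\<close>, so
  \<open>\<bar>w x\<bar> * B\<close> dominates. The bounds are only required almost everywhere
  because smooth functions are bounded on the sphere, not on the whole space.\<close>

lemma has_derivative_under_integral:
  fixes w :: "'a \<Rightarrow> real" and h h' :: "'a \<Rightarrow> real \<Rightarrow> real"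
  assumes w: "integrable M w"
    and hm [measurable]: "\<And>t. (\<lambda>x. h x t) \<in> borel_measurable M"
    and h'm [measurable]: "\<And>t. (\<lambda>x. h' x t) \<in> borel_measurable M"
    and der: "AE x in M. \<forall>t. (h x has_real_derivative h' x t) (at t)"
    and hB: "AE x in M. \<forall>t. \<bar>h x t\<bar> \<le> B"
    and h'B: "AE x in M. \<forall>t. \<bar>h' x t\<bar> \<le> B"
  shows "((\<lambda>t. \<integral>x. w x * h x t \<partial>M) has_real_derivative (\<integral>x. w x * h' x s \<partial>M)) (at s)"
proof -
  have [measurable]: "w \<in> borel_measurable M" using w by simp
  have wa: "integrable M (\<lambda>x. \<bar>w x\<bar> * B)" using w by simp
  have int: "integrable M (\<lambda>x. w x * h x t)" for t
  proof (rule Bochner_Integration.integrable_bound[OF wa])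
    show "AE x in M. norm (w x * h x t) \<le> norm (\<bar>w x\<bar> * B)"
      using hB
    proof eventually_elim
      fix x assume "\<forall>t. \<bar>h x t\<bar> \<le> B"
      hence "\<bar>w x\<bar> * \<bar>h x t\<bar> \<le> \<bar>w x\<bar> * \<bar>B\<bar>" by (intro mult_left_mono) (auto intro: order_trans)
      thus "norm (w x * h x t) \<le> norm (\<bar>w x\<bar> * B)" by (simp add: abs_mult)
    qed
  qed measurable
  show ?thesis
    unfolding has_field_derivative_iff tendsto_at_iff_sequentially comp_def
  proof (intro allI impI)
    fix X :: "nat \<Rightarrow> real" assume X: "\<forall>i. X i \<in> UNIV - {s}" "X \<longlonglongrightarrow> s"
    have "(\<lambda>i. \<integral>x. w x * ((h x (X i) - h x s) / (X i - s)) \<partial>M) \<longlonglongrightarrow> (\<integral>x. w x * h' x s \<partial>M)"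
    proof (rule integral_dominated_convergence[OF _ _ wa])
      show "AE x in M. (\<lambda>i. w x * ((h x (X i) - h x s) / (X i - s))) \<longlonglongrightarrow> w x * h' x s"
        using der
      proof eventually_elim
        fix x assume "\<forall>t. (h x has_real_derivative h' x t) (at t)"
        hence "((\<lambda>t. (h x t - h x s) / (t - s)) \<longlongrightarrow> h' x s) (at s)"
          by (simp add: has_field_derivative_iff)
        hence "(\<lambda>i. (h x (X i) - h x s) / (X i - s)) \<longlonglongrightarrow> h' x s"
          using X unfolding tendsto_at_iff_sequentially comp_def by blast
        thus "(\<lambda>i. w x * ((h x (X i) - h x s) / (X i - s))) \<longlonglongrightarrow> w x * h' x s"
          by (intro tendsto_intros)
      qed
      fix i
      have Xi: "X i \<noteq> s" using X(1) by auto
      show "AE x in M. norm (w x * ((h x (X i) - h x s) / (X i - s))) \<le> \<bar>w x\<bar> * B"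
        using der h'B
      proof eventually_elim
        fix x assume d: "\<forall>t. (h x has_real_derivative h' x t) (at t)" and b: "\<forall>t. \<bar>h' x t\<bar> \<le> B"
        have "norm (h x (X i) - h x s) \<le> B * norm (X i - s)"
          by (rule field_differentiable_bound[of UNIV "h x" "h' x"]) (use d b in auto)
        hence "\<bar>(h x (X i) - h x s) / (X i - s)\<bar> \<le> B" using Xi by (simp add: field_simps)
        thus "norm (w x * ((h x (X i) - h x s) / (X i - s))) \<le> \<bar>w x\<bar> * B"
          unfolding real_norm_def abs_mult by (intro mult_left_mono) auto
      qed
    qed auto
    moreover have "(\<integral>x. w x * ((h x (X i) - h x s) / (X i - s)) \<partial>M) =
        ((\<integral>x. w x * h x (X i) \<partial>M) - (\<integral>x. w x * h x s \<partial>M)) / (X i - s)" for i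
      by (subst Bochner_Integration.integral_diff[symmetric, OF int int])
        (simp add: right_diff_distrib diff_divide_distrib flip: integral_divide_zero)
    ultimately show "(\<lambda>i. ((\<integral>x. w x * h x (X i) \<partial>M) - (\<integral>x. w x * h x s \<partial>M)) / (X i - s))
        \<longlonglongrightarrow> (\<integral>x. w x * h' x s \<partial>M)" by (simp only:)
  qed
qed

definition rotc :: "real^3 \<Rightarrow> real^3 \<Rightarrow> real \<Rightarrow> real^3 \<Rightarrow> real^3" where
  "rotc c b t x = c + rot b t (x - c)"

text \<open>For unit \<open>b\<close> and smooth \<open>f\<close>, the derivative at
  \<open>t = 0\<close> of \<open>f\<close> along the orbit \<open>rotc c b t x\<close>. Orbits stay
  in the sphere, so on the sphere it depends only on the values of \<open>f\<close> there. As a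
  formula it makes sense for every \<open>b\<close>.\<close>

definition lie :: "real^3 \<Rightarrow> real^3 \<Rightarrow> (real^3 \<Rightarrow> real) \<Rightarrow> real^3 \<Rightarrow> real" where
  "lie c b f x = fd f x (b \<times> (x - c))"

lemma bounded_bilinear_cross3: "bounded_bilinear (\<times>)"
  using bilinear_cross by (simp add: bilinear_conv_bounded_bilinear)

lemmas smooth_cross = smooth_bilinear[OF bounded_bilinear_cross3]

lemma smooth_lie: "smooth f \<Longrightarrow> smooth (lie c b f)"
  unfolding lie_def[abs_def] by (intro smooth_fd_comp smooth_cross smooth_intros)

lemma rotc_in_sphere: "norm b = 1 \<Longrightarrow> x \<in> sphere c r \<Longrightarrow> rotc c b t x \<in> sphere c r"
  by (simp add: rotc_def dist_norm norm_rot norm_minus_commute)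

lemma continuous_rotc [continuous_intros]: "continuous_on S (rotc c b t)"
  unfolding rotc_def[abs_def]
  by (intro continuous_intros linear_continuous_on_compose[OF _ linear_rot])

lemma rotc_measurable [measurable]: "rotc c b t \<in> borel_measurable borel"
  by (intro borel_measurable_continuous_onI continuous_rotc)

lemma rotc_derivative:
  assumes "norm b = 1"
  shows "((\<lambda>t. rotc c b t x) has_vector_derivative b \<times> (rotc c b t x - c)) (at t)"
  unfolding rotc_def using rot_derivative[OF assms]
  by (auto intro!: derivative_eq_intros)

lemma rotc_compose_derivative:
  assumes "norm b = 1" "smooth f"
  shows "((\<lambda>t. f (rotc c b t x)) has_real_derivative lie c b f (rotc c b t x)) (at t)"
proof -
  have "((\<lambda>t. f (rotc c b t x)) has_derivative (\<lambda>h. fd f (rotc c b t x) (h *\<^sub>R (b \<times> (rotc c b t x - c))))) (at t)"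
    using has_derivative_compose[OF _ smooth_has_derivative[OF assms(2)]]
      rotc_derivative[OF assms(1)] unfolding has_vector_derivative_def by blast
  moreover have "fd f (rotc c b t x) (h *\<^sub>R v) = h *\<^sub>R fd f (rotc c b t x) v" for h v
    by (intro linear_cmul linear_frechet_derivative smooth_imp_differentiable assms)
  moreover have "(\<lambda>h. h * D) = (*) D" for D :: real by (simp add: fun_eq_iff)
  ultimately show ?thesis by (simp add: lie_def has_field_derivative_def)
qed

lemma rotc_0 [simp]: "rotc c b 0 x = x"
  by (simp add: rotc_def)

lemma rotc_rotc: "norm b = 1 \<Longrightarrow> rotc c b s (rotc c b t x) = rotc c b (s + t) x"
  by (simp add: rotc_def rot_rot)

lemma integral_rotc:
  fixes f :: "real^3 \<Rightarrow> 'b::{banach, second_countable_topology}"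
  assumes "norm b = 1" and [measurable]: "f \<in> borel_measurable borel"
  shows "(\<integral>x. f (rotc c b t x) \<partial>sphere_area c r) = (\<integral>x. f x \<partial>sphere_area c r)"
proof -
  have "(\<integral>x. f x \<partial>sphere_area c r) = (\<integral>x. f x \<partial>distr (sphere_area c r) borel (rotc c b t))"
    unfolding rotc_def[abs_def] by (simp add: sphere_area_rigid[OF orthogonal_rot[OF assms(1)]])
  also have "\<dots> = (\<integral>x. f (rotc c b t x) \<partial>sphere_area c r)"
    by (rule integral_distr) measurable
  finally show ?thesis ..
qed

lemma continuous_bounded_on_sphere:
  fixes f :: "real^3 \<Rightarrow> 'b::real_normed_vector"
  assumes "continuous_on UNIV f"
  obtains B where "B > 0" "\<And>x. x \<in> sphere c r \<Longrightarrow> norm (f x) \<le> B"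
proof -
  have "compact (f ` sphere c r)"
    by (intro compact_continuous_image continuous_on_subset[OF assms]) auto
  hence "bounded (f ` sphere c r)" by (rule compact_imp_bounded)
  then obtain B where "B > 0" "\<forall>y\<in>f ` sphere c r. norm y \<le> B" unfolding bounded_pos by blast
  thus ?thesis using that by auto
qed

lemma continuous_imp_measurable_sphere_area:
  "continuous_on UNIV (f :: real^3 \<Rightarrow> 'b::topological_space) \<Longrightarrow> f \<in> borel_measurable (sphere_area c r)"
  using borel_measurable_continuous_onI[of f] by simp

lemma integrable_mult_continuous:
  fixes f w :: "real^3 \<Rightarrow> real"
  assumes "r > 0" "continuous_on UNIV f" "integrable (sphere_area c r) w"
  shows "integrable (sphere_area c r) (\<lambda>x. w x * f x)"
proof -
  obtain B where B: "B > 0" "\<And>x. x \<in> sphere c r \<Longrightarrow> norm (f x) \<le> B"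
    using continuous_bounded_on_sphere[OF assms(2)] by blast
  have [measurable]: "f \<in> borel_measurable (sphere_area c r)" "w \<in> borel_measurable (sphere_area c r)"
    using continuous_imp_measurable_sphere_area[OF assms(2)] assms(3) by auto
  have "integrable (sphere_area c r) (\<lambda>x. \<bar>w x\<bar> * B)" using assms(3) by simp
  thus ?thesis
  proof (rule Bochner_Integration.integrable_bound)
    show "AE x in sphere_area c r. norm (w x * f x) \<le> norm (\<bar>w x\<bar> * B)"
      using AE_sphere_area[OF assms(1)]
    proof eventually_elim
      fix x assume "x \<in> sphere c r"
      from B(2)[OF this] show "norm (w x * f x) \<le> norm (\<bar>w x\<bar> * B)"
        using B(1) by (simp add: abs_mult mult_left_mono)
    qed
  qed measurable
qed

lemma integrable_continuous:
  fixes f :: "real^3 \<Rightarrow> real"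
  assumes "r > 0" "continuous_on UNIV f"
  shows "integrable (sphere_area c r) f"
  using integrable_mult_continuous[OF assms finite_measure.integrable_const[OF finite_measure_sphere_area, of c r 1]]
  by simp

lemma rotation_average_derivative:
  assumes "r > 0" "norm b = 1" "smooth f" "integrable (sphere_area c r) w"
  shows "((\<lambda>t. \<integral>x. w x * f (rotc c b t x) \<partial>sphere_area c r) has_real_derivative
     (\<integral>x. w x * lie c b f (rotc c b s x) \<partial>sphere_area c r)) (at s)"
proof -
  obtain B1 where B1: "\<And>x. x \<in> sphere c r \<Longrightarrow> norm (f x) \<le> B1"
    using continuous_bounded_on_sphere[OF smooth_imp_continuous[OF assms(3)]] by blast
  obtain B2 where B2: "\<And>x. x \<in> sphere c r \<Longrightarrow> norm (lie c b f x) \<le> B2"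
    using continuous_bounded_on_sphere[OF smooth_imp_continuous[OF smooth_lie[OF assms(3)]]] by blast
  have m: "(\<lambda>x. g (rotc c b t x)) \<in> borel_measurable (sphere_area c r)" if "smooth g"
    for g :: "real^3 \<Rightarrow> real" and t
    by (intro continuous_imp_measurable_sphere_area continuous_on_compose2[OF smooth_imp_continuous[OF that]]
        continuous_rotc) auto
  show ?thesis
  proof (rule has_derivative_under_integral[OF assms(4), where B = "max B1 B2"])
    show "AE x in sphere_area c r. \<forall>t. \<bar>f (rotc c b t x)\<bar> \<le> max B1 B2"
      using AE_sphere_area[OF assms(1), of c]
    proof eventually_elim
      fix x assume "x \<in> sphere c r"
      hence "rotc c b t x \<in> sphere c r" for t by (rule rotc_in_sphere[OF assms(2)])
      from B1[OF this] show "\<forall>t. \<bar>f (rotc c b t x)\<bar> \<le> max B1 B2" by (auto simp: le_max_iff_disj)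
    qed
    show "AE x in sphere_area c r. \<forall>t. \<bar>lie c b f (rotc c b t x)\<bar> \<le> max B1 B2"
      using AE_sphere_area[OF assms(1), of c]
    proof eventually_elim
      fix x assume "x \<in> sphere c r"
      hence "rotc c b t x \<in> sphere c r" for t by (rule rotc_in_sphere[OF assms(2)])
      from B2[OF this] show "\<forall>t. \<bar>lie c b f (rotc c b t x)\<bar> \<le> max B1 B2" by (auto simp: le_max_iff_disj)
    qed
  qed (use assms m smooth_lie rotc_compose_derivative in auto)
qed

text \<open>Rotating \<open>f\<close> does not change its integral, so the derivative of the
  integral along the rotation is zero. This is the only form in which the divergence theorem is
  used.\<close>

lemma integral_lie_eq_0_unit:
  assumes "r > 0" "norm b = 1" "smooth f"
  shows "(\<integral>x. lie c b f x \<partial>sphere_area c r) = 0"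
proof -
  have "integrable (sphere_area c r) (\<lambda>x. 1::real)"
    by (simp add: finite_measure.integrable_const[OF finite_measure_sphere_area])
  from rotation_average_derivative[OF assms this, of 0]
  have "((\<lambda>t. \<integral>x. f (rotc c b t x) \<partial>sphere_area c r) has_real_derivative
     (\<integral>x. lie c b f x \<partial>sphere_area c r)) (at 0)" by simp
  moreover have "(\<integral>x. f (rotc c b t x) \<partial>sphere_area c r) = (\<integral>x. f x \<partial>sphere_area c r)" for t
    by (intro integral_rotc assms borel_measurable_continuous_onI smooth_imp_continuous)
  ultimately show ?thesis using DERIV_unique DERIV_const by (metis (no_types, lifting) ext)
qed

text \<open>Off the sphere \<open>f\<close> may be nonzero arbitrarily close to \<open>x\<close>;
  the argument therefore follows the orbit, which stays in the sphere and, for small angles, outside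
  the closed set \<open>K\<close>.\<close>

lemma lie_eq_0_outside:
  assumes "norm b = 1" "smooth f" "closed K" "x \<in> sphere c r - K" "\<And>y. y \<in> sphere c r - K \<Longrightarrow> f y = 0"
  shows "lie c b f x = 0"
proof -
  have d: "((\<lambda>t. f (rotc c b t x)) has_real_derivative lie c b f x) (at 0)"
    using rotc_compose_derivative[OF assms(1,2), of c x 0] by simp
  have "continuous (at 0) (\<lambda>t. rotc c b t x)"
    using has_vector_derivative_continuous[OF rotc_derivative[OF assms(1)]] .
  hence "((\<lambda>t. rotc c b t x) \<longlongrightarrow> x) (at 0)" by (simp add: continuous_within)
  hence "eventually (\<lambda>t. rotc c b t x \<in> - K) (at 0)"
    by (rule topological_tendstoD) (use assms in auto)
  hence "eventually (\<lambda>t. f (rotc c b t x) = 0) (at 0)"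
  proof eventually_elim
    case (elim t)
    thus ?case using assms(5) rotc_in_sphere[OF assms(1)] assms(4) by simp
  qed
  hence "eventually (\<lambda>t. f (rotc c b t x) = 0) (nhds 0)"
    using assms(4,5) by (simp add: eventually_nhds_conv_at)
  from DERIV_cong_ev[OF refl this refl] d have "((\<lambda>t. 0) has_real_derivative lie c b f x) (at 0)" by blast
  thus ?thesis using DERIV_unique DERIV_const by blast
qed

section \<open>Rotation fields\<close>

lemma norm_sphere: "x \<in> sphere c r \<Longrightarrow> norm (x - c) = r"
  by (simp add: dist_norm norm_minus_commute)

lemma inner_sphere: "x \<in> sphere c r \<Longrightarrow> (x - c) \<bullet> (x - c) = r\<^sup>2"
  using norm_sphere[of x c r] by (simp add: power2_norm_eq_inner[symmetric])

lemma tangent_sphere_iff: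
  "r > 0 \<Longrightarrow> x \<in> sphere c r \<Longrightarrow> v \<in> tangent_space (sphere c r) x \<longleftrightarrow> v \<bullet> (x - c) = 0"
  by (simp only: tangent_space_sphere mem_Collect_eq)

lemma tproj_sphere:
  assumes r: "r > 0" and x: "x \<in> sphere c r"
  shows "tproj (sphere c r) x v = v - ((v \<bullet> (x - c)) / r\<^sup>2) *\<^sub>R (x - c)"
proof -
  let ?T = "tangent_space (sphere c r) x" and ?p = "v - ((v \<bullet> (x - c)) / r\<^sup>2) *\<^sub>R (x - c)"
  have T: "?T = {v. v \<bullet> (x - c) = 0}" by (rule tangent_space_sphere[OF r x])
  have sub: "real_vector.subspace ?T" unfolding T by (auto simp: real_vector.subspace_def inner_add_left)
  have p: "?p \<in> ?T" unfolding T using r inner_sphere[OF x] by (simp add: inner_diff_left)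
  let ?d = "tproj (sphere c r) x v - ?p"
  have d: "?d \<in> ?T" using tproj_orthogonal(1)[OF sub] p sub by (simp add: real_vector.subspace_diff)
  have "(v - tproj (sphere c r) x v) \<bullet> ?d = 0" by (rule tproj_orthogonal(2)[OF sub d])
  moreover have "(v - ?p) \<bullet> ?d = 0" using d unfolding T by (simp add: inner_commute)
  moreover have "?d \<bullet> ?d = (v - ?p) \<bullet> ?d - (v - tproj (sphere c r) x v) \<bullet> ?d"
    by (simp add: inner_diff_left)
  ultimately have "?d \<bullet> ?d = 0" by simp
  thus ?thesis by simp
qed

lemma tproj_sphere_inner:
  assumes "r > 0" "x \<in> sphere c r" "w \<bullet> (x - c) = 0"
  shows "w \<bullet> tproj (sphere c r) x v = w \<bullet> v"
  using assms by (simp add: tproj_sphere inner_diff_right)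

text \<open>The trace over the tangent plane is the full trace less the entry in the direction of
  the unit normal.\<close>

lemma surface_div_sphere:
  assumes r: "r > 0" and x: "x \<in> sphere c r" and Y: "Y differentiable (at x)"
  shows "surface_div (sphere c r) Y x =
    (\<Sum>e\<in>Basis. fd Y x e \<bullet> e) - (fd Y x (x - c) \<bullet> (x - c)) / r\<^sup>2"
proof -
  define \<xi> B where "\<xi> = x - c" and "B = fd Y x"
  have xx: "\<xi> \<bullet> \<xi> = r\<^sup>2" using inner_sphere[OF x] by (simp add: \<xi>_def)
  have lin: "linear B" unfolding B_def by (rule linear_frechet_derivative[OF Y])
  have S1: "(\<Sum>e\<in>Basis. (B e \<bullet> \<xi>) * (\<xi> \<bullet> e)) = B \<xi> \<bullet> \<xi>"
  proof -
    have "B \<xi> = (\<Sum>e\<in>Basis. (\<xi> \<bullet> e) *\<^sub>R B e)"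
      using linear_sum[OF lin, of "\<lambda>e. (\<xi> \<bullet> e) *\<^sub>R e" Basis]
      by (simp add: euclidean_representation linear_cmul[OF lin])
    thus ?thesis by (simp add: inner_sum_left mult.commute)
  qed
  have S2: "(\<Sum>e\<in>Basis. (\<xi> \<bullet> e) * (B \<xi> \<bullet> e)) = B \<xi> \<bullet> \<xi>"
    using euclidean_inner[of "B \<xi>" \<xi>] by (simp add: mult.commute)
  have S3: "(\<Sum>e\<in>Basis. (\<xi> \<bullet> e) * (\<xi> \<bullet> e)) = r\<^sup>2"
    using euclidean_inner[of \<xi> \<xi>] xx by simp
  \<comment> \<open>The trace of \<open>P B P\<close> with \<open>P\<close> the tangential
    projection, multiplied out: the two mixed terms and the doubly normal term each sum to
    \<open>B \<xi> \<bullet> \<xi> / r\<^sup>2\<close> up to sign.\<close>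
  have "surface_div (sphere c r) Y x = (\<Sum>e\<in>Basis. B e \<bullet> e - ((\<xi> \<bullet> e) * (B \<xi> \<bullet> e)) / r\<^sup>2
      - ((B e \<bullet> \<xi>) * (\<xi> \<bullet> e)) / r\<^sup>2 + ((\<xi> \<bullet> e) * (\<xi> \<bullet> e)) * (B \<xi> \<bullet> \<xi>) / (r\<^sup>2 * r\<^sup>2))"
    unfolding surface_div_def cov_deriv_def tproj_sphere[OF r x] B_def[symmetric] \<xi>_def[symmetric]
    by (intro sum.cong refl)
      (simp add: linear_diff[OF lin] linear_cmul[OF lin] inner_diff_left inner_diff_right inner_commute[of _ \<xi>]
        diff_divide_distrib add_divide_distrib left_diff_distrib right_diff_distrib mult.commute)
  also have "\<dots> = (\<Sum>e\<in>Basis. B e \<bullet> e) - (B \<xi> \<bullet> \<xi>) / r\<^sup>2 - (B \<xi> \<bullet> \<xi>) / r\<^sup>2 + r\<^sup>2 * (B \<xi> \<bullet> \<xi>) / (r\<^sup>2 * r\<^sup>2)"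
    by (simp add: sum.distrib sum_subtractf S1 S2 S3 flip: sum_divide_distrib sum_distrib_right)
  also have "\<dots> = (\<Sum>e\<in>Basis. B e \<bullet> e) - (B \<xi> \<bullet> \<xi>) / r\<^sup>2"
  proof -
    have "r\<^sup>2 * (B \<xi> \<bullet> \<xi>) / (r\<^sup>2 * r\<^sup>2) = (B \<xi> \<bullet> \<xi>) / r\<^sup>2"
      using r by (intro mult_divide_mult_cancel_left) simp
    thus ?thesis by linarith
  qed
  finally show ?thesis by (simp add: B_def \<xi>_def)
qed

section \<open>Linear algebra of the cross product\<close>

lemma sum_Basis_3: "(\<Sum>e\<in>(Basis :: (real^3) set). f e) = f (axis 1 1) + f (axis 2 1) + f (axis 3 1)"
proof -
  have B: "(Basis :: (real^3) set) = {axis 1 1, axis 2 1, axis 3 1}"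
    by (auto simp: Basis_vec_def UNIV_3)
  show ?thesis unfolding B by (simp add: axis_eq_axis add.assoc)
qed

lemma linear_3:
  fixes B :: "real^3 \<Rightarrow> 'b::real_vector"
  assumes "linear B"
  shows "B v = v$1 *\<^sub>R B (axis 1 1) + v$2 *\<^sub>R B (axis 2 1) + v$3 *\<^sub>R B (axis 3 1)"
proof -
  have "v = v$1 *\<^sub>R axis 1 1 + v$2 *\<^sub>R axis 2 1 + v$3 *\<^sub>R axis 3 1"
    by (simp add: vec_eq_iff axis_def forall_3)
  hence "B v = B (v$1 *\<^sub>R axis 1 1 + v$2 *\<^sub>R axis 2 1 + v$3 *\<^sub>R axis 3 1)" by simp
  thus ?thesis using assms by (simp add: linear_add linear_cmul)
qed

lemma axis_cross:
  fixes v :: "real^3"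
  shows "axis 1 1 \<times> v = vector [0, - v$3, v$2]" "axis 2 1 \<times> v = vector [v$3, 0, - v$1]"
    "axis 3 1 \<times> v = vector [- v$2, v$1, 0]"
  by (simp_all add: cross3_def axis_def)

text \<open>The rank-one maps built from \<open>e \<times> \<xi>\<close> add up to
  \<open>\<xi> \<bullet> \<xi>\<close> times the projection orthogonal to \<open>\<xi>\<close>; the
  sum is thus a multiple of the tangential trace of \<open>B\<close>. This links derivatives along
  the three rotations with \<open>surface_div\<close>.\<close>

lemma sum_cross_linear:
  fixes B :: "real^3 \<Rightarrow> real^3"
  assumes "linear B"
  shows "(\<Sum>e\<in>Basis. B (e \<times> \<xi>) \<bullet> (e \<times> \<xi>)) = (\<xi> \<bullet> \<xi>) * (\<Sum>e\<in>Basis. B e \<bullet> e) - B \<xi> \<bullet> \<xi>"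
proof -
  obtain u1 u2 u3 where u: "u1 = B (axis 1 1)" "u2 = B (axis 2 1)" "u3 = B (axis 3 1)" by blast
  have ax: "axis i (1::real) $ j = (if i = j then 1 else 0)" for i j :: 3 by (simp add: axis_def)
  have L: "B v = v$1 *\<^sub>R u1 + v$2 *\<^sub>R u2 + v$3 *\<^sub>R u3" for v
    unfolding u by (rule linear_3[OF assms])
  show ?thesis
    unfolding sum_Basis_3 u[symmetric] axis_cross inner_axis inner_axis' L
    by (simp add: inner_vec_def sum_3 ax algebra_simps)
qed

lemma cross_cross_left: "(a \<times> b) \<times> d = (a \<bullet> d) *\<^sub>R b - (b \<bullet> d) *\<^sub>R (a :: real^3)"
  by (simp add: cross3_simps forall_3)

lemma fd_cross_right: "(f has_derivative f') (at x) \<Longrightarrow>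
    ((\<lambda>x. a \<times> f x) has_derivative (\<lambda>v. a \<times> f' v)) (at x)"
  using bounded_bilinear.FDERIV[OF bounded_bilinear_cross3 has_derivative_const, of f f' x UNIV a] by simp

lemma fd_scaleR_cross:
  assumes "smooth f"
  shows "fd (\<lambda>x. f x *\<^sub>R (a \<times> (x - c))) x v = fd f x v *\<^sub>R (a \<times> (x - c)) + f x *\<^sub>R (a \<times> v)"
proof -
  have "((\<lambda>x. a \<times> (x - c)) has_derivative (\<lambda>v. a \<times> v)) (at x)"
    by (rule fd_cross_right) (auto intro!: derivative_eq_intros)
  from fd_eq[OF has_derivative_scaleR[OF smooth_has_derivative[OF assms] this]]
  show ?thesis by simp
qed

text \<open>Rotation fields are divergence free: \<open>v \<mapsto> b \<times> v\<close> is skew, so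
  its trace and its normal entry vanish and only the derivative of \<open>g\<close> is left.\<close>

lemma surface_div_scaled_rotation:
  assumes "r > 0" "x \<in> sphere c r" "smooth g"
  shows "surface_div (sphere c r) (\<lambda>x. g x *\<^sub>R (b \<times> (x - c))) x = fd g x (b \<times> (x - c))"
proof -
  have lin: "linear (fd g x)"
    by (rule linear_frechet_derivative[OF smooth_imp_differentiable[OF assms(3)]])
  have "fd g x (b \<times> (x - c)) = (\<Sum>e\<in>Basis. ((b \<times> (x - c)) \<bullet> e) *\<^sub>R fd g x e)"
    using linear_sum[OF lin, of "\<lambda>e. ((b \<times> (x - c)) \<bullet> e) *\<^sub>R e" Basis]
    by (simp add: euclidean_representation linear_cmul[OF lin])
  moreover have "(\<lambda>x. g x *\<^sub>R (b \<times> (x - c))) differentiable (at x)"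
    by (intro smooth_imp_differentiable smooth_intros smooth_cross assms)
  ultimately show ?thesis
    by (simp add: surface_div_sphere[OF assms(1,2)] fd_scaleR_cross[OF assms(3)] inner_add_left
        dot_cross_self mult.commute)
qed

definition rotfield :: "real^3 \<Rightarrow> real^3 \<Rightarrow> real^3 \<Rightarrow> real^3" where
  "rotfield c \<omega> x = \<omega> \<times> (x - c)"

text \<open>For tangent \<open>v\<close> the tangential part of \<open>\<omega> \<times> v\<close>
  comes from the component of \<open>\<omega>\<close> along \<open>x - c\<close> alone, as the cross
  product of two tangent vectors is normal. The formula vanishes on the normal line, as
  \<open>weak_cov_deriv\<close> demands.\<close>

definition rotgrad :: "real^3 \<Rightarrow> real \<Rightarrow> real^3 \<Rightarrow> real^3 \<Rightarrow> real^3^3" where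
  "rotgrad c r \<omega> x = matrix (\<lambda>v. ((\<omega> \<bullet> (x - c)) / r\<^sup>2) *\<^sub>R ((x - c) \<times> v))"

lemma rotgrad_apply: "rotgrad c r \<omega> x *v v = ((\<omega> \<bullet> (x - c)) / r\<^sup>2) *\<^sub>R ((x - c) \<times> v)"
proof -
  have "linear (\<lambda>v. ((\<omega> \<bullet> (x - c)) / r\<^sup>2) *\<^sub>R ((x - c) \<times> v))"
    by (rule linearI) (simp_all add: cross_add_right cross_mult_right scaleR_add_right)
  thus ?thesis unfolding rotgrad_def by (simp add: matrix_works)
qed

lemma continuous_rotgrad: "continuous_on UNIV (rotgrad c r \<omega>)"
  unfolding rotgrad_def[abs_def] matrix_def divide_inverse
  by (intro continuous_intros continuous_on_cross)

lemma weak_cov_deriv_rotfield: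
  assumes r: "r > 0" and \<Omega>: "\<Omega> \<subseteq> sphere c r" "\<Omega> \<in> sets borel"
  shows "weak_cov_deriv (sphere c r) (sphere_area c r) \<Omega> (rotfield c \<omega>) (rotgrad c r \<omega>)"
  unfolding weak_cov_deriv_def
proof (intro conjI ballI allI)
  let ?M = "sphere c r"
  fix x v assume "x \<in> \<Omega>"
  hence x: "x \<in> ?M" using \<Omega> by auto
  have t: "((x - c) \<times> u) \<bullet> (x - c) = 0" for u by (simp add: dot_cross_self)
  show "tproj ?M x (rotgrad c r \<omega> x *v tproj ?M x v) = rotgrad c r \<omega> x *v v"
    by (simp add: tproj_sphere[OF r x] rotgrad_apply Cross3.right_diff_distrib cross_mult_right t)
next
  let ?M = "sphere c r" and ?\<mu> = "sphere_area c r"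
  fix X Y assume "X \<in> test_fields ?M \<Omega>" "Y \<in> test_fields ?M \<Omega>"
  then obtain K where X: "smooth X" "\<forall>x\<in>?M. X x \<bullet> (x - c) = 0"
    and Y: "smooth Y" "\<forall>x\<in>?M. Y x \<bullet> (x - c) = 0"
    and K: "compact K" "K \<subseteq> \<Omega>" "\<forall>x\<in>?M - K. Y x = 0"
    by (auto simp: test_fields_def smooth_def tangent_sphere_iff[OF r] simp del: mem_sphere)
  \<comment> \<open>On the sphere \<open>y x \<times> (x - c) = Y x\<close>, so each
    \<open>\<psi> e\<close> is a coefficient of \<open>F x *\<^sub>R Y x\<close> with respect to the
    rotation about \<open>e\<close>, and \<open>G\<close> is the divergence of that field.\<close>
  define F where "F x = rotfield c \<omega> x \<bullet> X x" for x
  define y where "y x = (1 / r\<^sup>2) *\<^sub>R ((x - c) \<times> Y x)" for x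
  define \<psi> where "\<psi> e x = F x * (y x \<bullet> e)" for e x
  define G where "G x = (\<Sum>e\<in>Basis. lie c e (\<psi> e) x)" for x
  define J1 where "J1 x = (rotgrad c r \<omega> x *v Y x) \<bullet> X x" for x
  define J2 where "J2 x = rotfield c \<omega> x \<bullet> cov_deriv ?M X x (Y x) + (rotfield c \<omega> x \<bullet> X x) * surface_div ?M Y x" for x
  have sF: "smooth F" unfolding F_def[abs_def] rotfield_def
    by (intro smooth_intros smooth_cross X)
  have sy: "smooth y" unfolding y_def[abs_def]
    by (intro smooth_intros smooth_cross Y)
  have s\<psi>: "smooth (\<psi> e)" for e unfolding \<psi>_def[abs_def]
    by (intro smooth_intros sF sy)
  have dF: "fd F x v = (\<omega> \<times> v) \<bullet> X x + rotfield c \<omega> x \<bullet> fd X x v" for x v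
  proof -
    have "(rotfield c \<omega> has_derivative (\<lambda>v. \<omega> \<times> v)) (at x)"
      unfolding rotfield_def[abs_def] by (rule fd_cross_right) (auto intro!: derivative_eq_intros)
    from fd_eq[OF has_derivative_inner[OF this smooth_has_derivative[OF X(1)]]]
    show ?thesis by (simp add: F_def[abs_def])
  qed
  have dy: "fd y x v = (1 / r\<^sup>2) *\<^sub>R ((x - c) \<times> fd Y x v + v \<times> Y x)" for x v
  proof -
    have "((\<lambda>x. x - c) has_derivative (\<lambda>v. v)) (at x)" by (auto intro!: derivative_eq_intros)
    from bounded_bilinear.FDERIV[OF bounded_bilinear_cross3 this smooth_has_derivative[OF Y(1)]]
    show ?thesis unfolding y_def[abs_def] by (subst fd_eq[OF has_derivative_scaleR_right]) auto
  qed
  have d\<psi>: "fd (\<psi> e) x v = F x * (fd y x v \<bullet> e) + fd F x v * (y x \<bullet> e)" for e x v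
  proof -
    have "((\<lambda>x. y x \<bullet> e) has_derivative (\<lambda>v. fd y x v \<bullet> e)) (at x)"
      by (rule has_derivative_inner_left[OF smooth_has_derivative[OF sy]])
    from fd_eq[OF has_derivative_mult[OF smooth_has_derivative[OF sF] this]]
    show ?thesis by (simp add: \<psi>_def[abs_def])
  qed
  \<comment> \<open>The divergence is the derivative of \<open>F\<close> along \<open>Y\<close> plus
    \<open>F\<close> times the divergence of \<open>Y\<close>. Differentiating the first factor of
    \<open>F\<close> gives \<open>J1\<close>, the rest is \<open>J2\<close>.\<close>
  have G: "G x = J1 x + J2 x" if x: "x \<in> ?M" for x
  proof -
    define \<xi> where "\<xi> = x - c"
    have xx: "\<xi> \<bullet> \<xi> = r\<^sup>2" using inner_sphere[OF x] by (simp add: \<xi>_def)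
    have Xx: "X x \<bullet> \<xi> = 0" and Yx: "Y x \<bullet> \<xi> = 0" using X Y x by (auto simp: \<xi>_def)
    have yY: "y x \<times> \<xi> = Y x"
      using r Yx xx by (simp add: y_def \<xi>_def[symmetric] cross_mult_left cross_cross_left inner_commute)
    have linF: "linear (fd F x)" by (rule linear_frechet_derivative[OF smooth_imp_differentiable[OF sF]])
    have linY: "linear (fd Y x)" by (rule linear_frechet_derivative[OF smooth_imp_differentiable[OF Y(1)]])
    have "(\<Sum>e\<in>Basis. fd F x (e \<times> \<xi>) * (y x \<bullet> e)) = fd F x (\<Sum>e\<in>Basis. (y x \<bullet> e) *\<^sub>R (e \<times> \<xi>))"
      by (simp add: linear_sum[OF linF] linear_cmul[OF linF] mult.commute)
    also have "(\<Sum>e\<in>Basis. (y x \<bullet> e) *\<^sub>R (e \<times> \<xi>)) = (\<Sum>e\<in>Basis. (y x \<bullet> e) *\<^sub>R e) \<times> \<xi>"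
      by (simp add: sum_Basis_3 cross_add_left cross_mult_left)
    also have "\<dots> = Y x" by (simp add: euclidean_representation yY)
    finally have S1: "(\<Sum>e\<in>Basis. fd F x (e \<times> \<xi>) * (y x \<bullet> e)) = fd F x (Y x)" .
    have "(\<Sum>e\<in>Basis. ((e \<times> \<xi>) \<times> Y x) \<bullet> e) = - 2 * (Y x \<bullet> \<xi>)"
      by (simp add: sum_Basis_3 axis_cross inner_axis inner_axis') (simp add: cross3_simps)
    hence S2: "(\<Sum>e\<in>Basis. ((e \<times> \<xi>) \<times> Y x) \<bullet> e) = 0" using Yx by simp
    have "(\<xi> \<times> u) \<bullet> e = u \<bullet> (e \<times> \<xi>)" for u e by (metis cross_triple inner_commute)
    hence "(\<Sum>e\<in>Basis. (\<xi> \<times> fd Y x (e \<times> \<xi>)) \<bullet> e) = (\<Sum>e\<in>Basis. fd Y x (e \<times> \<xi>) \<bullet> (e \<times> \<xi>))"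
      by simp
    also have "\<dots> = r\<^sup>2 * surface_div ?M Y x"
      using r surface_div_sphere[OF r x smooth_imp_differentiable[OF Y(1)]] sum_cross_linear[OF linY, of \<xi>] xx
      by (simp add: \<xi>_def[symmetric] right_diff_distrib)
    finally have S3: "(\<Sum>e\<in>Basis. (\<xi> \<times> fd Y x (e \<times> \<xi>)) \<bullet> e) = r\<^sup>2 * surface_div ?M Y x" .
    have "(\<Sum>e\<in>Basis. fd y x (e \<times> \<xi>) \<bullet> e) = (1 / r\<^sup>2) * (\<Sum>e\<in>Basis. (\<xi> \<times> fd Y x (e \<times> \<xi>)) \<bullet> e + ((e \<times> \<xi>) \<times> Y x) \<bullet> e)"
      unfolding sum_distrib_left dy \<xi>_def[symmetric] by (intro sum.cong refl) (simp add: inner_add_left)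
    hence S4: "(\<Sum>e\<in>Basis. fd y x (e \<times> \<xi>) \<bullet> e) = surface_div ?M Y x"
      using r by (simp add: sum.distrib S2 S3)
    have "G x = F x * surface_div ?M Y x + fd F x (Y x)"
      unfolding G_def lie_def d\<psi> \<xi>_def[symmetric] sum.distrib S1 sum_distrib_left[symmetric] S4 ..
    \<comment> \<open>Only the component of \<open>\<omega>\<close> along \<open>\<xi>\<close>
      contributes, because \<open>X x\<close> and \<open>Y x\<close> are both tangent.\<close>
    moreover have "(\<omega> \<times> Y x) \<bullet> X x = J1 x"
    proof -
      have "(\<omega> \<times> Y x) \<bullet> X x = (\<omega> \<bullet> \<xi>) * (y x \<bullet> X x)"
        unfolding yY[symmetric] using Xx by (simp add: Lagrange inner_diff_left inner_diff_right inner_commute)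
      moreover have "(\<xi> \<times> Y x) \<bullet> X x = r\<^sup>2 * (y x \<bullet> X x)"
        using r by (simp add: y_def \<xi>_def)
      ultimately show ?thesis using r by (simp add: J1_def rotgrad_apply \<xi>_def[symmetric])
    qed
    moreover have "rotfield c \<omega> x \<bullet> cov_deriv ?M X x (Y x) = rotfield c \<omega> x \<bullet> fd X x (Y x)"
      unfolding cov_deriv_def
      by (rule tproj_sphere_inner[OF r x]) (simp add: rotfield_def dot_cross_self)
    ultimately show ?thesis by (simp add: dF J2_def F_def algebra_simps)
  qed
  have sG: "smooth G" unfolding G_def[abs_def] by (intro smooth_sum smooth_lie s\<psi>)
  have cJ1: "continuous_on UNIV J1"
    unfolding J1_def[abs_def] rotgrad_apply divide_inverse
    by (intro continuous_intros continuous_on_cross smooth_imp_continuous X Y)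
  have iG: "integrable ?\<mu> G" by (intro integrable_continuous r smooth_imp_continuous sG)
  have iJ: "integrable ?\<mu> J1" by (intro integrable_continuous r cJ1)
  \<comment> \<open>The identity concerns integrals over \<open>\<Omega>\<close>, rotation
    invariance concerns the whole sphere. They are reconciled by \<open>y\<close> vanishing on the
    sphere outside \<open>K\<close>, and with it every \<open>\<psi> e\<close>.\<close>
  have G0: "G x = 0" if "x \<in> ?M - K" for x
    unfolding G_def
  proof (intro sum.neutral ballI)
    fix e :: "real^3" assume "e \<in> Basis"
    thus "lie c e (\<psi> e) x = 0"
      using that K(1,3) by (intro lie_eq_0_outside[OF _ s\<psi> compact_imp_closed]) (auto simp: \<psi>_def y_def)
  qed
  have "(\<integral>x. G x \<partial>?\<mu>) = (\<Sum>e\<in>Basis. \<integral>x. lie c e (\<psi> e) x \<partial>?\<mu>)"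
    unfolding G_def by (intro Bochner_Integration.integral_sum integrable_continuous r smooth_imp_continuous smooth_lie s\<psi>)
  also have "\<dots> = 0" by (intro sum.neutral ballI integral_lie_eq_0_unit r s\<psi>) simp
  finally have IG: "(\<integral>x. G x \<partial>?\<mu>) = 0" .
  have "(LINT x:\<Omega>|?\<mu>. G x) = (\<integral>x. G x \<partial>?\<mu>)"
    unfolding set_lebesgue_integral_def
  proof (rule integral_cong_AE)
    have [measurable]: "G \<in> borel_measurable borel" by (intro borel_measurable_continuous_onI smooth_imp_continuous sG)
    show "(\<lambda>x. indicator \<Omega> x *\<^sub>R G x) \<in> borel_measurable ?\<mu>" "G \<in> borel_measurable ?\<mu>"
      using \<Omega> by measurable
    show "AE x in ?\<mu>. indicator \<Omega> x *\<^sub>R G x = G x"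
      using AE_sphere_area[OF r] by eventually_elim (use G0 K(2) in \<open>auto simp: indicator_def simp del: mem_sphere\<close>)
  qed
  hence "(LINT x:\<Omega>|?\<mu>. G x) = 0" using IG by simp
  moreover have "(LINT x:\<Omega>|?\<mu>. J2 x) = (LINT x:\<Omega>|?\<mu>. G x - J1 x)"
    unfolding set_lebesgue_integral_def
    by (intro Bochner_Integration.integral_cong refl) (use G \<Omega>(1) in \<open>auto simp: indicator_def simp del: mem_sphere\<close>)
  moreover have "(LINT x:\<Omega>|?\<mu>. G x - J1 x) = (LINT x:\<Omega>|?\<mu>. G x) - (LINT x:\<Omega>|?\<mu>. J1 x)"
    unfolding set_lebesgue_integral_def scaleR_diff_right
    using iG iJ \<Omega>(2) by (intro Bochner_Integration.integral_diff integrable_mult_indicator) auto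
  ultimately show "(LINT x:\<Omega>|?\<mu>. (rotgrad c r \<omega> x *v Y x) \<bullet> X x) =
      - (LINT x:\<Omega>|?\<mu>. rotfield c \<omega> x \<bullet> cov_deriv ?M X x (Y x) + (rotfield c \<omega> x \<bullet> X x) * surface_div ?M Y x)"
    by (simp add: J1_def J2_def)
qed

section \<open>The weak Killing equation\<close>

text \<open>Since \<open>A\<close> kills the normal and has tangent values, skewness on the tangent
  plane is skewness on the whole space. Hence \<open>A\<close> is the cross product with some
  \<open>\<beta>\<close>, and \<open>A *v \<xi> = 0\<close> makes \<open>\<beta>\<close> parallel to
  \<open>\<xi>\<close>.\<close>

lemma skew_tangent_endomorphism:
  assumes r: "r > 0" and x: "x \<in> sphere c r"
    and proj: "\<And>v. tproj (sphere c r) x (A *v tproj (sphere c r) x v) = A *v v"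
    and skew: "\<And>X Y. X \<bullet> (x - c) = 0 \<Longrightarrow> Y \<bullet> (x - c) = 0 \<Longrightarrow> (A *v Y) \<bullet> X + (A *v X) \<bullet> Y = 0"
  shows "\<exists>\<alpha>. \<forall>v. A *v v = \<alpha> *\<^sub>R ((x - c) \<times> v)"
proof -
  let ?P = "tproj (sphere c r) x"
  define \<xi> where "\<xi> = x - c"
  have xx: "\<xi> \<bullet> \<xi> = r\<^sup>2" using inner_sphere[OF x] by (simp add: \<xi>_def)
  have P: "?P v = v - ((v \<bullet> \<xi>) / r\<^sup>2) *\<^sub>R \<xi>" for v using tproj_sphere[OF r x] by (simp add: \<xi>_def)
  have Pt: "?P v \<bullet> \<xi> = 0" for v using r xx by (simp add: P inner_diff_left)
  have At: "(A *v v) \<bullet> \<xi> = 0" for v using Pt proj by metis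
  have PP: "?P v = v" if "v \<bullet> \<xi> = 0" for v using that by (simp add: P)
  have AP: "A *v ?P v = A *v v" for v using proj[of v] PP[OF At] by simp
  have inner_P: "(A *v v) \<bullet> ?P u = (A *v v) \<bullet> u" for u v using At by (simp add: P inner_diff_right)
  have sk: "(A *v u) \<bullet> v = - ((A *v v) \<bullet> u)" for u v
    using skew[of "?P u" "?P v"] Pt unfolding AP inner_P by (simp add: \<xi>_def)
  have "?P \<xi> = 0" using r xx by (simp add: P)
  hence A\<xi>: "A *v \<xi> = 0" using AP[of \<xi>] by simp
  \<comment> \<open>The three independent entries of a skew matrix, arranged as its axial
    vector.\<close>
  define \<beta> :: "real^3" where
    "\<beta> = vector [(A *v axis 2 1)$3, (A *v axis 3 1)$1, (A *v axis 1 1)$2]"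
  have ent: "(A *v axis i 1)$j = - (A *v axis j 1)$i" for i j
    using sk[of "axis i 1" "axis j 1"] by (simp add: inner_axis)
  have diag: "(A *v axis i 1)$i = 0" for i using ent[of i i] by simp
  have lin: "linear (\<lambda>v. A *v v)" by (rule matrix_vector_mul_linear)
  have cross: "A *v v = \<beta> \<times> v" for v
    unfolding linear_3[OF lin, of v] \<beta>_def
    using ent[of 1 2] ent[of 1 3] ent[of 2 3] ent[of 2 1] ent[of 3 1] ent[of 3 2]
    by (simp add: vec_eq_iff forall_3 cross_components diag algebra_simps)
  have "\<beta> \<times> \<xi> = 0" using A\<xi> cross by simp
  hence "\<xi> \<times> (\<beta> \<times> \<xi>) = 0" by simp
  hence "(\<xi> \<bullet> \<xi>) *\<^sub>R \<beta> = (\<xi> \<bullet> \<beta>) *\<^sub>R \<xi>" by (simp add: Lagrange)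
  hence "(1 / r\<^sup>2) *\<^sub>R (r\<^sup>2 *\<^sub>R \<beta>) = (1 / r\<^sup>2) *\<^sub>R ((\<xi> \<bullet> \<beta>) *\<^sub>R \<xi>)" by (simp only: xx)
  hence \<beta>: "\<beta> = ((\<xi> \<bullet> \<beta>) / r\<^sup>2) *\<^sub>R \<xi>" using r by simp
  have "\<forall>v. A *v v = ((\<xi> \<bullet> \<beta>) / r\<^sup>2) *\<^sub>R (\<xi> \<times> v)"
    unfolding cross_mult_left[symmetric] \<beta>[symmetric] using cross by blast
  thus ?thesis unfolding \<xi>_def by blast
qed

text \<open>The normalised inner product of \<open>A x\<close> with the quarter turn
  \<open>v \<mapsto> (x - c) \<times> v\<close>, whose squared norm on the sphere is
  \<open>2 * r\<^sup>2\<close>. Unlike a pointwise choice of the scalar, this formula is linear in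
  \<open>A x\<close>, so integrability carries over from \<open>A\<close>.\<close>

definition curl :: "real^3 \<Rightarrow> real \<Rightarrow> (real^3 \<Rightarrow> real^3^3) \<Rightarrow> real^3 \<Rightarrow> real" where
  "curl c r A x = (\<Sum>e\<in>Basis. (A x *v e) \<bullet> ((x - c) \<times> e)) / (2 * r\<^sup>2)"

lemma curl_eq:
  assumes "r > 0" "x \<in> sphere c r" "\<And>v. A x *v v = \<alpha> *\<^sub>R ((x - c) \<times> v)"
  shows "curl c r A x = \<alpha>"
proof -
  have "(\<Sum>e\<in>Basis. (\<xi> \<times> e) \<bullet> (\<xi> \<times> e)) = 2 * (\<xi> \<bullet> \<xi>)" for \<xi> :: "real^3"
    unfolding sum_Basis_3 by (simp add: cross3_def axis_def inner_vec_def sum_3)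
  hence "(\<Sum>e\<in>Basis. (A x *v e) \<bullet> ((x - c) \<times> e)) = \<alpha> * (2 * r\<^sup>2)"
    unfolding assms(3) inner_scaleR_left sum_distrib_left[symmetric] using inner_sphere[OF assms(2)] by simp
  thus ?thesis using assms(1) by (simp add: curl_def)
qed

section \<open>Integrability of the terms of the weak equation\<close>

lemma set_square_integrable_imp_integrable:
  assumes "set_square_integrable (sphere_area c r) \<Omega> f" "\<Omega> \<in> sets borel"
  shows "integrable (sphere_area c r) (\<lambda>x. indicator \<Omega> x *\<^sub>R f x)"
proof -
  have m: "(\<lambda>x. indicator \<Omega> x *\<^sub>R f x) \<in> borel_measurable (sphere_area c r)"
    and i: "integrable (sphere_area c r) (\<lambda>x. indicator \<Omega> x *\<^sub>R (norm (f x))\<^sup>2)"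
    using assms by (auto simp: set_square_integrable_def set_borel_measurable_def set_integrable_def)
  have "integrable (sphere_area c r) (\<lambda>x. 1 + indicator \<Omega> x *\<^sub>R (norm (f x))\<^sup>2)"
    by (intro Bochner_Integration.integrable_add i finite_measure.integrable_const finite_measure_sphere_area)
  thus ?thesis
  proof (rule Bochner_Integration.integrable_bound[OF _ m])
    \<comment> \<open>From \<open>t \<le> t\<^sup>2 + 1/4\<close>; the constant is integrable
      because the area is finite.\<close>
    have "norm (f x) \<le> 1 + (norm (f x))\<^sup>2" for x
      using zero_le_power2[of "norm (f x) - 1/2"] by (simp add: power2_eq_square algebra_simps)
    thus "AE x in sphere_area c r. norm (indicator \<Omega> x *\<^sub>R f x) \<le> norm (1 + indicator \<Omega> x *\<^sub>R (norm (f x))\<^sup>2)"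
      by (auto simp: indicator_def)
  qed
qed

lemma integrable_inner_continuous:
  fixes w Z :: "real^3 \<Rightarrow> real^3"
  assumes "r > 0" "integrable (sphere_area c r) w" "continuous_on UNIV Z"
  shows "integrable (sphere_area c r) (\<lambda>x. w x \<bullet> Z x)"
proof -
  have "integrable (sphere_area c r) (\<lambda>x. \<Sum>e\<in>Basis. (w x \<bullet> e) * (Z x \<bullet> e))"
    by (intro Bochner_Integration.integrable_sum integrable_mult_continuous assms integrable_inner_left continuous_intros)
  thus ?thesis by (subst euclidean_inner)
qed

lemma integrable_matrix_continuous:
  fixes A :: "real^3 \<Rightarrow> real^3^3" and Y Z :: "real^3 \<Rightarrow> real^3"
  assumes "r > 0" "integrable (sphere_area c r) A" "continuous_on UNIV Y" "continuous_on UNIV Z"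
  shows "integrable (sphere_area c r) (\<lambda>x. (A x *v Y x) \<bullet> Z x)"
proof -
  have A: "integrable (sphere_area c r) (\<lambda>x. A x *v e)" for e
  proof (rule integrable_bounded_linear[OF _ assms(2)])
    show "bounded_linear (\<lambda>B :: real^3^3. B *v e)"
      unfolding linear_conv_bounded_linear[symmetric]
      by (rule linearI) (simp_all add: matrix_vector_mult_add_rdistrib scaleR_matrix_vector_assoc)
  qed
  have "(A x *v Y x) \<bullet> Z x = (\<Sum>e\<in>Basis. (A x *v e) \<bullet> ((Y x \<bullet> e) *\<^sub>R Z x))" for x
  proof -
    have "A x *v Y x = (\<Sum>e\<in>Basis. (Y x \<bullet> e) *\<^sub>R (A x *v e))"
      using linear_sum[OF matrix_vector_mul_linear, of "A x" "\<lambda>e. (Y x \<bullet> e) *\<^sub>R e" Basis]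
      by (simp add: euclidean_representation matrix_vector_mult_scaleR)
    thus ?thesis by (simp add: inner_sum_left)
  qed
  moreover have "integrable (sphere_area c r) (\<lambda>x. \<Sum>e\<in>Basis. (A x *v e) \<bullet> ((Y x \<bullet> e) *\<^sub>R Z x))"
    by (intro Bochner_Integration.integrable_sum integrable_inner_continuous A assms continuous_intros)
  ultimately show ?thesis by simp
qed

text \<open>The weak equation for the test fields \<open>f x *\<^sub>R (a \<times> (x - c))\<close> and
  \<open>g x *\<^sub>R (b \<times> (x - c))\<close> only involves the product \<open>\<phi> x = f x * g x\<close>.\<close>

definition kf_integrand ::
  "real^3 \<Rightarrow> real \<Rightarrow> (real^3 \<Rightarrow> real) \<Rightarrow> (real^3 \<Rightarrow> real^3) \<Rightarrow> real^3 \<Rightarrow> real^3 \<Rightarrow> (real^3 \<Rightarrow> real) \<Rightarrow> real^3 \<Rightarrow> real"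
  where
  "kf_integrand c r \<alpha> w a b \<phi> x = \<alpha> x * (\<phi> x * (r\<^sup>2 * (b \<bullet> (a \<times> (x - c)))))
     + w x \<bullet> (lie c b \<phi> x *\<^sub>R (a \<times> (x - c)) + (\<phi> x * (a \<bullet> (x - c))) *\<^sub>R b)"

lemma integrable_kf_integrand:
  assumes "r > 0" "smooth \<phi>" "integrable (sphere_area c r) \<alpha>" "integrable (sphere_area c r) w"
  shows "integrable (sphere_area c r) (kf_integrand c r \<alpha> w a b \<phi>)"
  unfolding kf_integrand_def[abs_def]
  by (intro Bochner_Integration.integrable_add integrable_mult_continuous integrable_inner_continuous
      assms smooth_imp_continuous smooth_intros smooth_cross smooth_lie)

locale killing_field =
  fixes c :: "real^3" and r :: real and \<Omega> :: "(real^3) set"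
    and W :: "real^3 \<Rightarrow> real^3" and A :: "real^3 \<Rightarrow> real^3^3"
  assumes r: "r > 0" and \<Omega>: "\<Omega> \<subseteq> sphere c r" "\<Omega> \<in> sets borel"
    and W_tangent: "\<And>x. x \<in> \<Omega> \<Longrightarrow> W x \<in> tangent_space (sphere c r) x"
    and W_int: "set_square_integrable (sphere_area c r) \<Omega> W"
    and A_int: "set_square_integrable (sphere_area c r) \<Omega> A"
    and weak: "weak_cov_deriv (sphere c r) (sphere_area c r) \<Omega> W A"
    and skew: "AE x\<in>\<Omega> in sphere_area c r. \<forall>X\<in>tangent_space (sphere c r) x. \<forall>Y\<in>tangent_space (sphere c r) x.
          (A x *v Y) \<bullet> X + (A x *v X) \<bullet> Y = 0"
begin

abbreviation "\<mu> \<equiv> sphere_area c r"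

text \<open>Extension by zero turns integrals over \<open>\<Omega>\<close> into integrals over the
  whole sphere, where rotations act.\<close>

definition "w x = indicator \<Omega> x *\<^sub>R W x"
definition "\<alpha> x = indicator \<Omega> x * curl c r A x"

lemma w_int: "integrable \<mu> w"
  unfolding w_def[abs_def] by (rule set_square_integrable_imp_integrable[OF W_int \<Omega>(2)])

lemma w_normal: "w x \<bullet> (x - c) = 0"
  using W_tangent[of x] \<Omega> tangent_sphere_iff[OF r, of x c "W x"]
  by (cases "x \<in> \<Omega>") (auto simp: w_def simp del: mem_sphere)

lemma AE_curl: "AE x\<in>\<Omega> in \<mu>. \<forall>v. A x *v v = curl c r A x *\<^sub>R ((x - c) \<times> v)"
  using skew
proof eventually_elim
  fix x
  assume s: "x \<in> \<Omega> \<longrightarrow> (\<forall>X\<in>tangent_space (sphere c r) x. \<forall>Y\<in>tangent_space (sphere c r) x.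
      (A x *v Y) \<bullet> X + (A x *v X) \<bullet> Y = 0)"
  show "x \<in> \<Omega> \<longrightarrow> (\<forall>v. A x *v v = curl c r A x *\<^sub>R ((x - c) \<times> v))"
  proof
    assume x\<Omega>: "x \<in> \<Omega>"
    hence x: "x \<in> sphere c r" using \<Omega> by blast
    have "\<exists>\<alpha>. \<forall>v. A x *v v = \<alpha> *\<^sub>R ((x - c) \<times> v)"
    proof (rule skew_tangent_endomorphism[OF r x])
      show "tproj (sphere c r) x (A x *v tproj (sphere c r) x v) = A x *v v" for v
        using weak x\<Omega> unfolding weak_cov_deriv_def by blast
      show "(A x *v Y) \<bullet> X + (A x *v X) \<bullet> Y = 0" if "X \<bullet> (x - c) = 0" "Y \<bullet> (x - c) = 0" for X Y
        using s x\<Omega> that tangent_sphere_iff[OF r x] by blast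
    qed
    thus "\<forall>v. A x *v v = curl c r A x *\<^sub>R ((x - c) \<times> v)" using curl_eq[OF r x] by metis
  qed
qed

lemma \<alpha>_int: "integrable \<mu> \<alpha>"
proof -
  have "integrable \<mu> (\<lambda>x. \<Sum>e\<in>Basis. ((indicator \<Omega> x *\<^sub>R A x) *v e) \<bullet> ((x - c) \<times> e))"
    by (intro Bochner_Integration.integrable_sum integrable_matrix_continuous r continuous_intros
        continuous_on_cross set_square_integrable_imp_integrable A_int \<Omega>)
  hence "integrable \<mu> (\<lambda>x. (\<Sum>e\<in>Basis. ((indicator \<Omega> x *\<^sub>R A x) *v e) \<bullet> ((x - c) \<times> e)) / (2 * r\<^sup>2))"
    by (rule integrable_divide_zero)
  moreover have "(\<Sum>e\<in>Basis. ((indicator \<Omega> x *\<^sub>R A x) *v e) \<bullet> ((x - c) \<times> e)) / (2 * r\<^sup>2) = \<alpha> x" for x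
    by (simp add: \<alpha>_def curl_def scaleR_matrix_vector_assoc[symmetric] sum_distrib_left[symmetric])
  ultimately show ?thesis by simp
qed

text \<open>Differentiating \<open>f\<close> in the first field and taking the divergence of the
  second yield the two halves of the Leibniz rule for \<open>f x * g x\<close>. The remaining term
  \<open>a \<times> (b \<times> (x - c))\<close> reduces to a multiple of \<open>b\<close>, its part
  along \<open>x - c\<close> being orthogonal to \<open>W\<close>.\<close>

lemma kf_identity:
  assumes f: "smooth f" and g: "smooth g"
    and K: "compact K" "K \<subseteq> \<Omega>" "\<And>x. x \<in> sphere c r - K \<Longrightarrow> f x = 0" "\<And>x. x \<in> sphere c r - K \<Longrightarrow> g x = 0"
  shows "(\<integral>x. kf_integrand c r \<alpha> w a b (\<lambda>x. f x * g x) x \<partial>\<mu>) = 0"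
proof -
  let ?M = "sphere c r"
  define X where "X x = f x *\<^sub>R (a \<times> (x - c))" for x
  define Y where "Y x = g x *\<^sub>R (b \<times> (x - c))" for x
  define \<phi> where "\<phi> x = f x * g x" for x
  have s\<phi>: "smooth \<phi>" unfolding \<phi>_def[abs_def] by (intro smooth_intros f g)
  have sX: "smooth X" and sY: "smooth Y"
    unfolding X_def[abs_def] Y_def[abs_def] by (intro smooth_intros smooth_cross f g)+
  have lie\<phi>: "lie c b \<phi> x = f x * lie c b g x + g x * lie c b f x" for x
    unfolding lie_def \<phi>_def[abs_def]
    using fd_eq[OF has_derivative_mult[OF smooth_has_derivative[OF f] smooth_has_derivative[OF g]], of x] by simp
  have XY: "X \<in> test_fields ?M \<Omega>" "Y \<in> test_fields ?M \<Omega>"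
    using sX sY K
    by (auto simp: test_fields_def smooth_def tangent_sphere_iff[OF r] X_def Y_def dot_cross_self
        simp del: mem_sphere intro!: exI[of _ K])
  have eq: "(LINT x:\<Omega>|\<mu>. (A x *v Y x) \<bullet> X x) =
        - (LINT x:\<Omega>|\<mu>. W x \<bullet> cov_deriv ?M X x (Y x) + (W x \<bullet> X x) * surface_div ?M Y x)"
    using weak XY unfolding weak_cov_deriv_def by blast
  have cX: "continuous_on UNIV X" and cY: "continuous_on UNIV Y" using sX sY by (auto intro: smooth_imp_continuous)
  have iA: "integrable \<mu> (\<lambda>x. ((indicator \<Omega> x *\<^sub>R A x) *v Y x) \<bullet> X x)"
    by (intro integrable_matrix_continuous r cX cY set_square_integrable_imp_integrable A_int \<Omega>)
  have i1: "integrable \<mu> (\<lambda>x. \<alpha> x * (\<phi> x * (r\<^sup>2 * (b \<bullet> (a \<times> (x - c))))))"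
    by (intro integrable_mult_continuous r \<alpha>_int smooth_imp_continuous smooth_intros smooth_cross s\<phi>)
  have i2: "integrable \<mu> (\<lambda>x. w x \<bullet> (lie c b \<phi> x *\<^sub>R (a \<times> (x - c)) + (\<phi> x * (a \<bullet> (x - c))) *\<^sub>R b))"
    by (intro integrable_inner_continuous r w_int smooth_imp_continuous smooth_intros smooth_cross smooth_lie s\<phi>)
  have "(LINT x:\<Omega>|\<mu>. (A x *v Y x) \<bullet> X x) = (\<integral>x. ((indicator \<Omega> x *\<^sub>R A x) *v Y x) \<bullet> X x \<partial>\<mu>)"
    by (simp add: set_lebesgue_integral_def scaleR_matrix_vector_assoc[symmetric])
  also have "\<dots> = (\<integral>x. \<alpha> x * (\<phi> x * (r\<^sup>2 * (b \<bullet> (a \<times> (x - c))))) \<partial>\<mu>)"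
  proof (rule integral_cong_AE)
    show "AE x in \<mu>. ((indicator \<Omega> x *\<^sub>R A x) *v Y x) \<bullet> X x = \<alpha> x * (\<phi> x * (r\<^sup>2 * (b \<bullet> (a \<times> (x - c)))))"
      using AE_curl AE_sphere_area[OF r]
    proof eventually_elim
      case (elim x)
      have xx: "(x - c) \<bullet> (x - c) = r\<^sup>2" by (rule inner_sphere[OF elim(2)])
      have "((x - c) \<times> (b \<times> (x - c))) \<bullet> (a \<times> (x - c)) = r\<^sup>2 * (b \<bullet> (a \<times> (x - c)))"
        unfolding Lagrange xx by (simp add: inner_diff_left[of "r\<^sup>2 *\<^sub>R b"] dot_cross_self)
      thus ?case using elim(1)
        by (cases "x \<in> \<Omega>") (simp_all add: \<alpha>_def X_def Y_def \<phi>_def cross_mult_right)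
    qed
  qed (use iA i1 in auto)
  finally have L: "(LINT x:\<Omega>|\<mu>. (A x *v Y x) \<bullet> X x) = (\<integral>x. \<alpha> x * (\<phi> x * (r\<^sup>2 * (b \<bullet> (a \<times> (x - c))))) \<partial>\<mu>)" .
  have R: "(LINT x:\<Omega>|\<mu>. W x \<bullet> cov_deriv ?M X x (Y x) + (W x \<bullet> X x) * surface_div ?M Y x) =
      (\<integral>x. w x \<bullet> (lie c b \<phi> x *\<^sub>R (a \<times> (x - c)) + (\<phi> x * (a \<bullet> (x - c))) *\<^sub>R b) \<partial>\<mu>)"
    unfolding set_lebesgue_integral_def
  proof (rule Bochner_Integration.integral_cong[OF refl])
    fix x
    show "indicator \<Omega> x *\<^sub>R (W x \<bullet> cov_deriv ?M X x (Y x) + (W x \<bullet> X x) * surface_div ?M Y x) =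
        w x \<bullet> (lie c b \<phi> x *\<^sub>R (a \<times> (x - c)) + (\<phi> x * (a \<bullet> (x - c))) *\<^sub>R b)"
    proof (cases "x \<in> \<Omega>")
      case True
      hence x: "x \<in> ?M" using \<Omega> by blast
      have Wx: "W x \<bullet> (x - c) = 0" using W_tangent[OF True] tangent_sphere_iff[OF r x] by blast
      have 1: "fd f x (g x *\<^sub>R v) = g x * fd f x v" for v
        using linear_cmul[OF linear_frechet_derivative[OF smooth_imp_differentiable[OF f]]] by simp
      have "W x \<bullet> cov_deriv ?M X x (Y x) = W x \<bullet> fd X x (Y x)"
        unfolding cov_deriv_def by (rule tproj_sphere_inner[OF r x Wx])
      also have "fd X x (Y x) = (g x * lie c b f x) *\<^sub>R (a \<times> (x - c)) + \<phi> x *\<^sub>R (a \<times> (b \<times> (x - c)))"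
        unfolding X_def[abs_def] fd_scaleR_cross[OF f] by (simp add: Y_def 1 lie_def \<phi>_def cross_mult_right)
      finally have 2: "W x \<bullet> cov_deriv ?M X x (Y x) =
          g x * lie c b f x * (W x \<bullet> (a \<times> (x - c))) + \<phi> x * ((a \<bullet> (x - c)) * (W x \<bullet> b))"
        using Wx by (simp add: Lagrange inner_add_right inner_diff_right)
      have "surface_div ?M Y x = lie c b g x"
        unfolding Y_def[abs_def] lie_def by (rule surface_div_scaled_rotation[OF r x g])
      with 2 show ?thesis using True
        by (simp add: w_def lie\<phi> X_def inner_add_right algebra_simps)
    qed (simp add: w_def)
  qed
  from eq L R have "(\<integral>x. \<alpha> x * (\<phi> x * (r\<^sup>2 * (b \<bullet> (a \<times> (x - c))))) \<partial>\<mu>) +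
      (\<integral>x. w x \<bullet> (lie c b \<phi> x *\<^sub>R (a \<times> (x - c)) + (\<phi> x * (a \<bullet> (x - c))) *\<^sub>R b) \<partial>\<mu>) = 0" by simp
  thus ?thesis
    unfolding \<phi>_def[abs_def, symmetric] kf_integrand_def Bochner_Integration.integral_add[OF i1 i2] .
qed

end

text \<open>A function of the distance to \<open>p\<close> alone, which makes it symmetric in
  \<open>p\<close> and \<open>x\<close> and lets rotations act on the centre. The squared distance
  keeps it smooth at the centre.\<close>

definition bump :: "real^3 \<Rightarrow> real \<Rightarrow> real \<Rightarrow> nat \<Rightarrow> real^3 \<Rightarrow> real" where
  "bump p \<delta> \<kappa> j x = eflat \<kappa> j (\<delta>\<^sup>2 - (x - p) \<bullet> (x - p))"

lemma smooth_bump: "\<kappa> > 0 \<Longrightarrow> smooth (bump p \<delta> \<kappa> j)"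
  unfolding bump_def[abs_def] by (intro smooth_eflat smooth_intros)

lemma bump_eq_0: "\<delta> > 0 \<Longrightarrow> x \<notin> ball p \<delta> \<Longrightarrow> bump p \<delta> \<kappa> j x = 0"
proof -
  assume "\<delta> > 0" "x \<notin> ball p \<delta>"
  hence "\<delta>\<^sup>2 \<le> (norm (x - p))\<^sup>2" by (intro power_mono) (auto simp: dist_norm norm_minus_commute)
  thus ?thesis by (simp add: bump_def eflat_def power2_norm_eq_inner)
qed

lemma fd_bump:
  assumes "\<kappa> > 0"
  shows "fd (bump p \<delta> \<kappa> j) x v =
    (\<kappa> * bump p \<delta> \<kappa> (j + 2) x - j * bump p \<delta> \<kappa> (j + 1) x) * (- 2 * ((x - p) \<bullet> v))"
proof -
  have "((\<lambda>x. \<delta>\<^sup>2 - (x - p) \<bullet> (x - p)) has_derivative (\<lambda>v. - 2 * ((x - p) \<bullet> v))) (at x)"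
    by (auto intro!: derivative_eq_intros simp: inner_commute)
  from fd_eq[OF has_derivative_compose[OF this eflat_derivative[OF assms, of j, unfolded has_field_derivative_def]]]
  have "fd (bump p \<delta> \<kappa> j) x = (\<lambda>v. (\<kappa> * bump p \<delta> \<kappa> (j + 2) x - j * bump p \<delta> \<kappa> (j + 1) x) * (- 2 * ((x - p) \<bullet> v)))"
    unfolding bump_def .
  thus ?thesis by (simp only:)
qed

context killing_field
begin

text \<open>\<open>spin a\<close> is the component along \<open>a\<close> of the angular velocity of \<open>W\<close>.\<close>

definition "spin a x = \<alpha> x * (a \<bullet> (x - c)) + (w x \<bullet> (a \<times> (x - c))) / r\<^sup>2"

lemma spin_int: "integrable \<mu> (spin a)"
  unfolding spin_def[abs_def]
  by (intro Bochner_Integration.integrable_add integrable_divide_zero integrable_mult_continuous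
      integrable_inner_continuous r \<alpha>_int w_int continuous_intros continuous_on_cross)

text \<open>Both test fields must vanish outside \<open>\<Omega>\<close>, so \<open>bump p \<delta> 2 2\<close> is factored into
  two bumps with the same support.\<close>

lemma kf_identity_bump:
  assumes "\<delta> > 0" "cball p \<delta> \<inter> sphere c r \<subseteq> \<Omega>" "smooth P" "\<And>x. \<phi> x = P x * bump p \<delta> 2 2 x"
  shows "(\<integral>x. kf_integrand c r \<alpha> w a b \<phi> x \<partial>\<mu>) = 0"
proof -
  have "\<phi> = (\<lambda>x. (P x * bump p \<delta> 1 2 x) * bump p \<delta> 1 0 x)"
    unfolding assms(4)[abs_def] by (simp add: bump_def eflat_mult mult.assoc)
  moreover have "bump p \<delta> \<kappa> j x = 0" if "x \<in> sphere c r - cball p \<delta> \<inter> sphere c r" for \<kappa> j x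
    using that by (intro bump_eq_0 assms) (auto simp del: mem_sphere)
  ultimately show ?thesis
    by (simp only:, intro kf_identity[of _ _ "cball p \<delta> \<inter> sphere c r"] assms(2))
      (simp_all add: smooth_mult smooth_bump assms(3) compact_Int del: mem_sphere Diff_iff)
qed

text \<open>Let \<open>k\<close> be the bump, \<open>h x = (a \<bullet> (x - c)) * k x\<close> and \<open>G\<close> the gradient of \<open>h\<close>. The equation is a
  combination of the weak Killing equations for \<open>k\<close> with axes \<open>a, b\<close>, for the components
  \<open>G \<bullet> e\<close> with axes \<open>b, e\<close>, and for \<open>(b \<bullet> (x - c)) * h x\<close> with axes \<open>e, e\<close>; the second
  derivatives of \<open>h\<close> cancel because its Hessian is symmetric.\<close>

lemma spin_lie_bump:
  assumes \<delta>: "\<delta> > 0" "cball p \<delta> \<inter> sphere c r \<subseteq> \<Omega>"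
  shows "(\<integral>x. spin a x * lie c b (bump p \<delta> 2 0) x \<partial>\<mu>) = 0"
proof -
  define k where "k = bump p \<delta> 2 0"
  define E where "E = bump p \<delta> 2 2"
  define q where "q x = \<delta>\<^sup>2 - (x - p) \<bullet> (x - p)" for x
  define h where "h x = (a \<bullet> (x - c)) * k x" for x
  define G where "G x = k x *\<^sub>R a - (4 * (a \<bullet> (x - c)) * E x) *\<^sub>R (x - p)" for x
  define \<phi> where "\<phi> x = (b \<bullet> (x - c)) * h x" for x
  \<comment> \<open>All functions put into the weak equation must be smooth multiples of the same
    \<open>E\<close>. Differentiating \<open>k\<close> raises its index from 0 to 2, so
    \<open>k\<close> itself is written with \<open>E\<close> too.\<close>
  have kE: "k x = (q x)\<^sup>2 * E x" for x
    using eflat_shift[of "q x" 2 2 0] by (simp add: k_def E_def bump_def q_def)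
  have sq: "smooth q" unfolding q_def[abs_def] by (intro smooth_intros)
  have sk: "smooth k" and sE: "smooth E" by (simp_all add: k_def E_def smooth_bump)
  have sh: "smooth h" unfolding h_def[abs_def] by (intro smooth_intros sk)
  have sG: "smooth G" unfolding G_def[abs_def] by (intro smooth_intros sk sE)
  have s\<phi>: "smooth \<phi>" unfolding \<phi>_def[abs_def] by (intro smooth_intros sh)
  have dlin: "((\<lambda>x. d \<bullet> (x - c)) has_derivative (\<lambda>v. d \<bullet> v)) (at x)" for d x :: "real^3"
    by (auto intro!: derivative_eq_intros)
  have dk: "(k has_derivative (\<lambda>v. - 4 * E x * ((x - p) \<bullet> v))) (at x)" for x
  proof -
    have "fd k x = (\<lambda>v. - 4 * E x * ((x - p) \<bullet> v))"
      unfolding k_def E_def fun_eq_iff fd_bump[OF zero_less_numeral] by (simp add: numeral_2_eq_2)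
    thus ?thesis using smooth_has_derivative[OF sk, of x] by simp
  qed
  have dh: "(h has_derivative (\<lambda>v. G x \<bullet> v)) (at x)" for x
  proof -
    have "(\<lambda>v. (a \<bullet> (x - c)) * (- 4 * E x * ((x - p) \<bullet> v)) + (a \<bullet> v) * k x) = (\<lambda>v. G x \<bullet> v)"
      by (simp add: fun_eq_iff G_def inner_diff_left)
    thus ?thesis unfolding h_def[abs_def] using has_derivative_mult[OF dlin dk, of a x] by simp
  qed
  have d\<phi>: "(\<phi> has_derivative (\<lambda>v. (b \<bullet> (x - c)) * (G x \<bullet> v) + (b \<bullet> v) * h x)) (at x)" for x
    unfolding \<phi>_def[abs_def] by (rule has_derivative_mult[OF dlin dh])
  \<comment> \<open>This is the Hessian of \<open>h\<close> contracted with the skew map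
    \<open>e \<mapsto> e \<times> (x - c)\<close>. The Hessian consists of symmetrised products of
    \<open>a\<close> and \<open>x - p\<close>, handled by the bilinear identity below, and a
    multiple of the identity, which drops out since \<open>e \<times> (x - c)\<close> is orthogonal
    to \<open>e\<close>.\<close>
  have Gsym: "(\<Sum>e\<in>Basis. lie c e (\<lambda>x. G x \<bullet> e) x) = 0" for x
  proof -
    define E' where "E' = fd E x"
    obtain \<epsilon> where \<epsilon>: "\<And>v. E' v = \<epsilon> * ((x - p) \<bullet> v)"
      by (rule that[of "(2 * bump p \<delta> 2 (2 + 2) x - 2 * bump p \<delta> 2 (2 + 1) x) * - 2"])
        (simp only: E'_def E_def fd_bump[OF zero_less_numeral] of_nat_numeral mult.assoc)
    have "((\<lambda>x. G x \<bullet> e) has_derivative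
        (\<lambda>v. (- 4 * E x * ((x - p) \<bullet> v)) * (a \<bullet> e) - 4 * (a \<bullet> v) * E x * ((x - p) \<bullet> e)
          - 4 * (a \<bullet> (x - c)) * (\<epsilon> * ((x - p) \<bullet> v)) * ((x - p) \<bullet> e) - 4 * (a \<bullet> (x - c)) * E x * (v \<bullet> e))) (at x)" for e
    proof -
      have dE: "(E has_derivative (\<lambda>v. \<epsilon> * ((x - p) \<bullet> v))) (at x)"
      proof -
        have "fd E x = (\<lambda>v. \<epsilon> * ((x - p) \<bullet> v))" using \<epsilon> by (simp add: E'_def fun_eq_iff)
        thus ?thesis using smooth_has_derivative[OF sE, of x] by simp
      qed
      show ?thesis unfolding G_def[abs_def] inner_diff_left inner_scaleR_left
        by (rule derivative_eq_intros dk dE dlin refl | simp)+ (auto simp: algebra_simps fun_eq_iff)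
    qed
    from fd_eq[OF this] have "lie c e (\<lambda>x. G x \<bullet> e) x =
        (- 4 * E x * ((x - p) \<bullet> (e \<times> (x - c)))) * (a \<bullet> e) - 4 * (a \<bullet> (e \<times> (x - c))) * E x * ((x - p) \<bullet> e)
          - 4 * (a \<bullet> (x - c)) * (\<epsilon> * ((x - p) \<bullet> (e \<times> (x - c)))) * ((x - p) \<bullet> e)" for e
      unfolding lie_def by (simp add: dot_cross_self)
    moreover have "(\<Sum>e\<in>Basis. (u \<bullet> (e \<times> \<xi>)) * (v \<bullet> e) + (v \<bullet> (e \<times> \<xi>)) * (u \<bullet> e)) = 0" for u v \<xi> :: "real^3"
      unfolding sum_Basis_3 axis_cross inner_axis inner_axis' by (simp add: inner_vec_def sum_3 algebra_simps)
    note z = this this[of "x - p" "x - p" "x - c"]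
    ultimately have "(\<Sum>e\<in>Basis. lie c e (\<lambda>x. G x \<bullet> e) x) =
      (- 4 * E x) * (\<Sum>e\<in>Basis. ((x - p) \<bullet> (e \<times> (x - c))) * (a \<bullet> e) + (a \<bullet> (e \<times> (x - c))) * ((x - p) \<bullet> e))
      + (- 2 * (a \<bullet> (x - c)) * \<epsilon>) * (\<Sum>e\<in>Basis. ((x - p) \<bullet> (e \<times> (x - c))) * ((x - p) \<bullet> e) + ((x - p) \<bullet> (e \<times> (x - c))) * ((x - p) \<bullet> e))"
      unfolding sum_distrib_left sum.distrib[symmetric] by (intro sum.cong refl) (simp add: algebra_simps)
    thus ?thesis unfolding z by simp
  qed
  let ?I = "kf_integrand c r \<alpha> w"
  have Ik: "(\<integral>x. ?I a b k x \<partial>\<mu>) = 0"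
    by (rule kf_identity_bump[OF \<delta>, of "\<lambda>x. (q x)\<^sup>2"]) (simp_all add: kE E_def smooth_power[OF sq])
  have IG: "(\<integral>x. ?I b e (\<lambda>x. G x \<bullet> e) x \<partial>\<mu>) = 0" for e
    by (rule kf_identity_bump[OF \<delta>, of "\<lambda>x. (a \<bullet> e) * (q x)\<^sup>2 - 4 * (a \<bullet> (x - c)) * ((x - p) \<bullet> e)"])
      (intro smooth_intros sq, simp add: G_def kE E_def inner_diff_left algebra_simps)
  have I\<phi>: "(\<integral>x. ?I e e \<phi> x \<partial>\<mu>) = 0" for e
    by (rule kf_identity_bump[OF \<delta>, of "\<lambda>x. (b \<bullet> (x - c)) * ((a \<bullet> (x - c)) * (q x)\<^sup>2)"])
      (intro smooth_intros sq, simp add: \<phi>_def h_def kE E_def)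
  have iI: "integrable \<mu> (?I a b k)" "\<And>e. integrable \<mu> (?I b e (\<lambda>x. G x \<bullet> e))" "\<And>e. integrable \<mu> (?I e e \<phi>)"
    by (intro integrable_kf_integrand r \<alpha>_int w_int sk s\<phi> smooth_intros sG)+
  \<comment> \<open>Antisymmetry of \<open>a \<bullet> (b \<times> \<xi>)\<close> in
    \<open>a\<close> and \<open>b\<close> leaves
    \<open>r\<^sup>2 * \<alpha> x * (a \<bullet> \<xi>) * lie c b k x\<close> of the terms with
    \<open>\<alpha>\<close>. The terms with \<open>w\<close> that do not belong to
    \<open>spin\<close> are exactly the derivative of \<open>\<phi>\<close> along \<open>w\<close>,
    which the last sum subtracts.\<close>
  have key: "r\<^sup>2 * (spin a x * lie c b k x) = ?I a b k x + (\<Sum>e\<in>Basis. ?I b e (\<lambda>x. G x \<bullet> e) x)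
      - (\<Sum>e\<in>Basis. ?I e e \<phi> x) / r\<^sup>2" if x: "x \<in> sphere c r" for x
  proof -
    define \<xi> where "\<xi> = x - c"
    have xx: "\<xi> \<bullet> \<xi> = r\<^sup>2" using inner_sphere[OF x] by (simp add: \<xi>_def)
    have wx: "w x \<bullet> \<xi> = 0" using w_normal by (simp add: \<xi>_def)
    have lh: "G x \<bullet> (b \<times> \<xi>) = (a \<bullet> \<xi>) * lie c b k x + k x * (a \<bullet> (b \<times> \<xi>))"
      using fd_eq[OF dk, of x] by (simp add: lie_def G_def \<xi>_def inner_diff_left)
    have e1: "(\<Sum>e\<in>Basis. (G x \<bullet> e) * (e \<bullet> v)) = G x \<bullet> v" for v
      using euclidean_inner[of "G x" v] by (simp add: inner_commute)
    have e2: "(\<Sum>e\<in>Basis. (G x \<bullet> e) * (w x \<bullet> e)) = G x \<bullet> w x"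
      by (rule euclidean_inner[symmetric])
    have S1: "(\<Sum>e\<in>Basis. ?I b e (\<lambda>x. G x \<bullet> e) x) = r\<^sup>2 * \<alpha> x * (G x \<bullet> (b \<times> \<xi>)) + (b \<bullet> \<xi>) * (G x \<bullet> w x)"
    proof -
      have "(\<Sum>e\<in>Basis. ?I b e (\<lambda>x. G x \<bullet> e) x) = (r\<^sup>2 * \<alpha> x) * (\<Sum>e\<in>Basis. (G x \<bullet> e) * (e \<bullet> (b \<times> \<xi>)))
          + (\<Sum>e\<in>Basis. lie c e (\<lambda>x. G x \<bullet> e) x) * (w x \<bullet> (b \<times> \<xi>)) + (b \<bullet> \<xi>) * (\<Sum>e\<in>Basis. (G x \<bullet> e) * (w x \<bullet> e))"
        unfolding sum_distrib_left sum_distrib_right sum.distrib[symmetric] kf_integrand_def \<xi>_def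
        by (intro sum.cong refl) (simp add: inner_add_right algebra_simps)
      thus ?thesis by (simp add: e1 e2 Gsym)
    qed
    \<comment> \<open>The maps built from \<open>e \<times> \<xi>\<close> sum to
      \<open>r\<^sup>2\<close> times the tangential projection, and \<open>w x\<close> is
      tangent.\<close>
    have wsum: "(\<Sum>e\<in>Basis. (w x \<bullet> (e \<times> \<xi>)) *\<^sub>R (e \<times> \<xi>)) = r\<^sup>2 *\<^sub>R w x"
    proof -
      have "w x \<bullet> (e \<times> \<xi>) = (\<xi> \<times> w x) \<bullet> e" for e by (metis cross_triple inner_commute)
      hence "(\<Sum>e\<in>Basis. (w x \<bullet> (e \<times> \<xi>)) *\<^sub>R (e \<times> \<xi>)) = (\<Sum>e\<in>Basis. ((\<xi> \<times> w x) \<bullet> e) *\<^sub>R e) \<times> \<xi>"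
        by (simp add: sum_Basis_3 cross_add_left cross_mult_left)
      also have "\<dots> = r\<^sup>2 *\<^sub>R w x"
        by (simp add: euclidean_representation cross_cross_left xx wx)
      finally show ?thesis .
    qed
    define D where "D = fd \<phi> x"
    have D: "D v = (b \<bullet> \<xi>) * (G x \<bullet> v) + (b \<bullet> v) * h x" for v
      using fd_eq[OF d\<phi>] by (simp add: D_def \<xi>_def)
    have linD: "linear D" unfolding D_def by (rule linear_frechet_derivative[OF smooth_imp_differentiable[OF s\<phi>]])
    \<comment> \<open>Equal axes \<open>e, e\<close> remove \<open>\<alpha>\<close> from the
      equation, as \<open>e \<bullet> (e \<times> \<xi>) = 0\<close>; what is left is a pure
      derivative along \<open>w\<close>.\<close>
    have S2: "(\<Sum>e\<in>Basis. ?I e e \<phi> x) = r\<^sup>2 * D (w x)"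
    proof -
      have "(\<Sum>e\<in>Basis. (e \<bullet> \<xi>) * (w x \<bullet> e)) = 0"
        using euclidean_inner[of \<xi> "w x"] wx by (simp add: inner_commute)
      hence z: "(\<Sum>e\<in>Basis. \<phi> x * ((e \<bullet> \<xi>) * (w x \<bullet> e))) = 0" unfolding sum_distrib_left[symmetric] by simp
      have "(\<Sum>e\<in>Basis. ?I e e \<phi> x) = (\<Sum>e\<in>Basis. (w x \<bullet> (e \<times> \<xi>)) * D (e \<times> \<xi>)) + (\<Sum>e\<in>Basis. \<phi> x * ((e \<bullet> \<xi>) * (w x \<bullet> e)))"
        unfolding sum.distrib[symmetric] kf_integrand_def lie_def D_def \<xi>_def
        by (intro sum.cong refl) (simp add: inner_add_right dot_cross_self algebra_simps)
      also have "\<dots> = D (\<Sum>e\<in>Basis. (w x \<bullet> (e \<times> \<xi>)) *\<^sub>R (e \<times> \<xi>))"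
        by (simp add: z linear_sum[OF linD] linear_cmul[OF linD])
      finally show ?thesis by (simp add: wsum linear_cmul[OF linD])
    qed
    have anti: "a \<bullet> (b \<times> \<xi>) = - (b \<bullet> (a \<times> \<xi>))"
      by (metis cross_skew cross_triple inner_minus_right inner_commute)
    show ?thesis
      unfolding S1 S2 unfolding lh D spin_def kf_integrand_def \<xi>_def[symmetric] h_def
      using r by (simp add: inner_add_right anti inner_commute[of "w x"] field_simps)
  qed
  have "(\<integral>x. r\<^sup>2 * (spin a x * lie c b k x) \<partial>\<mu>) =
      (\<integral>x. ?I a b k x + (\<Sum>e\<in>Basis. ?I b e (\<lambda>x. G x \<bullet> e) x) - (\<Sum>e\<in>Basis. ?I e e \<phi> x) / r\<^sup>2 \<partial>\<mu>)"
  proof (rule integral_cong_AE)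
    show "AE x in \<mu>. r\<^sup>2 * (spin a x * lie c b k x) = ?I a b k x + (\<Sum>e\<in>Basis. ?I b e (\<lambda>x. G x \<bullet> e) x)
        - (\<Sum>e\<in>Basis. ?I e e \<phi> x) / r\<^sup>2"
      using AE_sphere_area[OF r] by eventually_elim (rule key)
    show "(\<lambda>x. r\<^sup>2 * (spin a x * lie c b k x)) \<in> borel_measurable \<mu>"
      by (intro borel_measurable_times borel_measurable_const borel_measurable_integrable[OF spin_int]
          continuous_imp_measurable_sphere_area[OF smooth_imp_continuous[OF smooth_lie[OF sk]]])
    show "(\<lambda>x. ?I a b k x + (\<Sum>e\<in>Basis. ?I b e (\<lambda>x. G x \<bullet> e) x) - (\<Sum>e\<in>Basis. ?I e e \<phi> x) / r\<^sup>2) \<in> borel_measurable \<mu>"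
      using iI by (intro borel_measurable_diff borel_measurable_add borel_measurable_sum borel_measurable_divide) auto
  qed
  also have "\<dots> = 0"
    using iI by (simp add: Ik IG I\<phi>)
  finally show ?thesis using r by (simp add: k_def)
qed

end

section \<open>Averages over bumps\<close>

text \<open>Rotation along a great circle. The chord satisfies \<open>(dist (rotc c b s p)
  p)\<^sup>2 = 2 * r\<^sup>2 * (1 - cos s)\<close>, which increases up to \<open>s = pi\<close>, so
  the arc never gets farther from \<open>p\<close> than \<open>q\<close> is.\<close>

lemma exists_rotation_arc:
  assumes r: "r > 0" and p: "p \<in> sphere c r" and q: "q \<in> sphere c r"
  obtains b \<theta> where "norm b = 1" "0 \<le> \<theta>" "rotc c b \<theta> p = q"
    "\<And>s. 0 \<le> s \<Longrightarrow> s \<le> \<theta> \<Longrightarrow> dist (rotc c b s p) p \<le> dist q p"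
proof -
  define P Q where "P = p - c" and "Q = q - c"
  have PP: "P \<bullet> P = r\<^sup>2" and QQ: "Q \<bullet> Q = r\<^sup>2"
    using inner_sphere[OF p] inner_sphere[OF q] by (simp_all add: P_def Q_def)
  have nP: "norm P = r" using norm_sphere[OF p] by (simp add: P_def)
  define u where "u = (P \<bullet> Q) / r\<^sup>2"
  have "\<bar>P \<bullet> Q\<bar> \<le> r * r"
    using Cauchy_Schwarz_ineq2[of P Q] norm_sphere[OF p] norm_sphere[OF q] by (simp add: P_def Q_def)
  hence u1: "\<bar>u\<bar> \<le> 1" using r by (simp add: u_def power2_eq_square abs_mult)
  define \<theta> where "\<theta> = arccos u"
  have \<theta>: "0 \<le> \<theta>" "\<theta> \<le> pi" "cos \<theta> = u"
    using u1 by (auto simp: \<theta>_def arccos_lbound arccos_ubound cos_arccos_abs)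
  define V where "V = Q - u *\<^sub>R P"
  have PV: "P \<bullet> V = 0" using r by (simp add: V_def inner_diff_right PP u_def)
  have "V \<bullet> V = (r * sin \<theta>)\<^sup>2"
  proof -
    have PQ: "P \<bullet> Q = u * r\<^sup>2" using r by (simp add: u_def)
    have "V \<bullet> V = r\<^sup>2 - 2 * u * (P \<bullet> Q) + u\<^sup>2 * r\<^sup>2"
      by (simp add: V_def inner_diff_left inner_diff_right PP QQ inner_commute[of Q P] power2_eq_square algebra_simps)
    also have "\<dots> = r\<^sup>2 * (1 - (cos \<theta>)\<^sup>2)" unfolding PQ \<theta>(3) by (simp add: power2_eq_square algebra_simps)
    finally show ?thesis by (simp add: sin_squared_eq power_mult_distrib)
  qed
  hence VV: "(norm V)\<^sup>2 = (r * sin \<theta>)\<^sup>2" by (simp only: power2_norm_eq_inner)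
  have "0 \<le> r * sin \<theta>" using r \<theta> by (simp add: sin_ge_zero)
  hence nV: "norm V = r * sin \<theta>" by (rule power2_eq_imp_eq[OF VV norm_ge_zero])
  \<comment> \<open>If \<open>V = 0\<close>, then \<open>q\<close> is \<open>p\<close> or its
    antipode and every direction orthogonal to \<open>P\<close> will do.\<close>
  obtain n where n: "norm n = 1" "P \<bullet> n = 0" "V = (r * sin \<theta>) *\<^sub>R n"
  proof (cases "V = 0")
    case True
    obtain y where y: "y \<noteq> 0" "orthogonal P y"
      using orthogonal_to_vector_exists[of P] by auto
    show ?thesis by (rule that[of "(1 / norm y) *\<^sub>R y"]) (use y True nV in \<open>auto simp: orthogonal_def\<close>)
  next
    case False
    show ?thesis
    proof (rule that[of "(1 / norm V) *\<^sub>R V"])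
      show "V = (r * sin \<theta>) *\<^sub>R ((1 / norm V) *\<^sub>R V)" unfolding nV[symmetric] using False by simp
    qed (use False PV in auto)
  qed
  have nn: "n \<bullet> n = 1" using n(1) by (simp add: norm_eq_1)
  \<comment> \<open>The axis is normal to the plane of \<open>P\<close> and \<open>n\<close>,
    oriented so that \<open>b \<times> P = r *\<^sub>R n\<close>.\<close>
  define b where "b = (1 / r) *\<^sub>R (P \<times> n)"
  have "(norm (P \<times> n))\<^sup>2 = r\<^sup>2" using norm_cross_dot[of P n] n nP by simp
  hence "norm (P \<times> n) = r" using r by (simp add: power2_eq_iff_nonneg)
  hence b: "norm b = 1" using r by (simp add: b_def)
  have bP: "b \<times> P = r *\<^sub>R n" using n(2) r
    by (simp add: b_def cross_mult_left cross_cross_left PP inner_commute power2_eq_square)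
  have bP0: "b \<bullet> P = 0" by (simp add: b_def dot_cross_self)
  have rotP: "rot b s P = cos s *\<^sub>R P + (r * sin s) *\<^sub>R n" for s
    by (simp add: rot_def bP bP0 mult.commute)
  have "rotc c b \<theta> p = c + Q"
    unfolding rotc_def P_def[symmetric] rotP \<theta>(3) n(3)[symmetric] by (simp add: V_def)
  hence 1: "rotc c b \<theta> p = q" by (simp add: Q_def)
  have d: "(dist (rotc c b s p) p)\<^sup>2 = 2 * r\<^sup>2 * (1 - cos s)" for s
  proof -
    have eq: "rotc c b s p - p = (cos s - 1) *\<^sub>R P + (r * sin s) *\<^sub>R n"
      unfolding rotc_def P_def[symmetric] rotP by (simp add: P_def algebra_simps)
    have "(dist (rotc c b s p) p)\<^sup>2 = (cos s - 1)\<^sup>2 * r\<^sup>2 + (r * sin s)\<^sup>2"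
      unfolding dist_norm power2_norm_eq_inner eq using n(2) by (simp add: inner_add_left inner_add_right PP nn
          inner_commute[of n P] power2_eq_square)
    also have "\<dots> = r\<^sup>2 * (2 - 2 * cos s)"
      unfolding power_mult_distrib sin_squared_eq by (simp add: power2_eq_square algebra_simps)
    finally show ?thesis by simp
  qed
  have 2: "dist (rotc c b s p) p \<le> dist q p" if "0 \<le> s" "s \<le> \<theta>" for s
  proof -
    have "cos \<theta> \<le> cos s" using that \<theta> by (intro cos_monotone_0_pi_le) auto
    hence "(dist (rotc c b s p) p)\<^sup>2 \<le> (dist (rotc c b \<theta> p) p)\<^sup>2"
      unfolding d by (intro mult_left_mono) auto
    thus ?thesis unfolding 1 by (rule power2_le_imp_le) simp
  qed
  show ?thesis by (rule that[OF b \<theta>(1) 1 2])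
qed

section \<open>Bumps under rotations\<close>

lemma dist_rotc: "norm b = 1 \<Longrightarrow> dist (rotc c b t x) (rotc c b t y) = dist x y"
proof -
  assume b: "norm b = 1"
  have "rotc c b t x - rotc c b t y = rot b t (x - y)"
    using linear_diff[OF linear_rot, of b t "x - c" "y - c"] by (simp add: rotc_def)
  thus ?thesis by (simp add: dist_norm norm_rot[OF b])
qed

lemma bump_dist: "bump p \<delta> \<kappa> j x = eflat \<kappa> j (\<delta>\<^sup>2 - (dist x p)\<^sup>2)"
  by (simp add: bump_def dist_norm power2_norm_eq_inner)

lemma bump_commute: "bump p \<delta> \<kappa> j x = bump x \<delta> \<kappa> j p"
  by (simp add: bump_dist dist_commute)

lemma bump_rotc:
  assumes b: "norm b = 1" shows "bump p \<delta> \<kappa> j (rotc c b t x) = bump (rotc c b (- t) p) \<delta> \<kappa> j x"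
proof -
  have "p = rotc c b t (rotc c b (- t) p)" by (simp add: rotc_rotc[OF b])
  hence "dist (rotc c b t x) p = dist x (rotc c b (- t) p)" using dist_rotc[OF b] by metis
  thus ?thesis by (simp add: bump_dist)
qed

text \<open>Rotations about one axis commute, so both sides are the derivative at 0 of the same
  function of the angle.\<close>

lemma lie_bump_rotc:
  assumes b: "norm b = 1" and "\<kappa> > 0"
  shows "lie c b (bump p \<delta> \<kappa> j) (rotc c b t x) = lie c b (bump (rotc c b (- t) p) \<delta> \<kappa> j) x"
proof -
  let ?k = "bump p \<delta> \<kappa> j" and ?k' = "bump (rotc c b (- t) p) \<delta> \<kappa> j"
  have "((\<lambda>s. ?k (rotc c b s x)) has_real_derivative lie c b ?k (rotc c b t x)) (at (0 + t))"
    unfolding add_0 by (rule rotc_compose_derivative[OF b smooth_bump[OF assms(2)]])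
  hence "((\<lambda>s. ?k (rotc c b (s + t) x)) has_real_derivative lie c b ?k (rotc c b t x)) (at 0)"
    by (subst (asm) DERIV_shift)
  moreover have "?k (rotc c b (s + t) x) = ?k' (rotc c b s x)" for s
    using bump_rotc[OF b, of p \<delta> \<kappa> j c t "rotc c b s x"] by (simp add: rotc_rotc[OF b] add.commute)
  ultimately have "((\<lambda>s. ?k' (rotc c b s x)) has_real_derivative lie c b ?k (rotc c b t x)) (at 0)" by simp
  moreover have "((\<lambda>s. ?k' (rotc c b s x)) has_real_derivative lie c b ?k' (rotc c b 0 x)) (at 0)"
    by (rule rotc_compose_derivative[OF b smooth_bump[OF assms(2)]])
  ultimately show ?thesis using DERIV_unique by fastforce
qed

lemma bump_average_constant:
  assumes r: "r > 0" and u: "integrable (sphere_area c r) u"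
    and Z: "\<And>b p'. p' \<in> sphere c r \<Longrightarrow> dist p' p \<le> dist q p \<Longrightarrow>
      (\<integral>x. u x * lie c b (bump p' \<delta> 2 0) x \<partial>sphere_area c r) = 0"
    and pq: "p \<in> sphere c r" "q \<in> sphere c r"
  shows "(\<integral>x. u x * bump q \<delta> 2 0 x \<partial>sphere_area c r) = (\<integral>x. u x * bump p \<delta> 2 0 x \<partial>sphere_area c r)"
proof -
  obtain b \<theta> where b: "norm b = 1" and \<theta>: "0 \<le> \<theta>" "rotc c b \<theta> p = q"
    "\<And>s. 0 \<le> s \<Longrightarrow> s \<le> \<theta> \<Longrightarrow> dist (rotc c b s p) p \<le> dist q p"
    using exists_rotation_arc[OF r pq] by metis
  define F where "F t = (\<integral>x. u x * bump p \<delta> 2 0 (rotc c b t x) \<partial>sphere_area c r)" for t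
  have dF: "(F has_real_derivative (\<integral>x. u x * lie c b (bump p \<delta> 2 0) (rotc c b s x) \<partial>sphere_area c r)) (at s)" for s
    unfolding F_def[abs_def] by (intro rotation_average_derivative r b u smooth_bump) simp
  have z: "(F has_real_derivative 0) (at s)" if "- \<theta> \<le> s" "s \<le> 0" for s
  proof -
    have "(\<integral>x. u x * lie c b (bump p \<delta> 2 0) (rotc c b s x) \<partial>sphere_area c r) = 0"
      unfolding lie_bump_rotc[OF b zero_less_numeral]
      by (intro Z rotc_in_sphere b pq \<theta>) (use that in auto)
    thus ?thesis using dF[of s] by simp
  qed
  \<comment> \<open>Rotating the argument by \<open>t\<close> moves the centre by
    \<open>- t\<close>; the angles therefore run through \<open>{- \<theta>..0}\<close> to carry
    \<open>p\<close> to \<open>q\<close>.\<close>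
  have "F 0 = F (- \<theta>)"
  proof (cases "\<theta> = 0")
    case False
    show ?thesis
    proof (rule DERIV_isconst_end[of "- \<theta>" 0 F])
      show "- \<theta> < 0" using \<theta> False by simp
      show "continuous_on {- \<theta>..0} F" using dF DERIV_isCont by (auto intro!: continuous_at_imp_continuous_on)
    qed (use z in auto)
  qed simp
  thus ?thesis unfolding F_def bump_rotc[OF b] using \<theta>(2) by (simp add: rotc_0)
qed

lemma integral_bump_constant:
  assumes "r > 0" "p \<in> sphere c r" "q \<in> sphere c r"
  shows "(\<integral>x. bump q \<delta> 2 0 x \<partial>sphere_area c r) = (\<integral>x. bump p \<delta> 2 0 x \<partial>sphere_area c r)"
proof -
  obtain b \<theta> where b: "norm b = 1" and \<theta>: "rotc c b \<theta> p = q"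
    using exists_rotation_arc[OF assms] by metis
  have "(\<integral>x. bump p \<delta> 2 0 (rotc c b (- \<theta>) x) \<partial>sphere_area c r) = (\<integral>x. bump p \<delta> 2 0 x \<partial>sphere_area c r)"
    by (intro integral_rotc b borel_measurable_continuous_onI smooth_imp_continuous smooth_bump) simp
  thus ?thesis using \<theta> by (simp add: bump_rotc[OF b])
qed

lemma bump_nonneg: "bump p \<delta> \<kappa> j x \<ge> 0"
  by (simp add: bump_def eflat_nonneg)

lemma integrable_bump:
  "r > 0 \<Longrightarrow> \<kappa> > 0 \<Longrightarrow> integrable (sphere_area c r) (bump p \<delta> \<kappa> j)"
  by (intro integrable_continuous smooth_imp_continuous smooth_bump)

lemma integral_bump_pos:
  assumes "r > 0" "p \<in> sphere c r" "\<delta> > 0"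
  shows "(\<integral>x. bump p \<delta> 2 0 x \<partial>sphere_area c r) > 0"
proof -
  let ?\<mu> = "sphere_area c r"
  have int: "integrable ?\<mu> (bump p \<delta> 2 0)" by (rule integrable_bump[OF assms(1)]) simp
  have "(\<integral>x. bump p \<delta> 2 0 x \<partial>?\<mu>) \<noteq> 0"
  proof
    assume "(\<integral>x. bump p \<delta> 2 0 x \<partial>?\<mu>) = 0"
    hence "AE x in ?\<mu>. bump p \<delta> 2 0 x = 0"
      using integral_nonneg_eq_0_iff_AE[OF int] by (simp add: bump_nonneg)
    hence "AE x in ?\<mu>. x \<notin> ball p \<delta>"
    proof eventually_elim
      fix x assume 0: "bump p \<delta> 2 0 x = 0"
      show "x \<notin> ball p \<delta>"
      proof
        assume "x \<in> ball p \<delta>"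
        hence "(dist x p)\<^sup>2 < \<delta>\<^sup>2" by (intro power_strict_mono) (auto simp: dist_commute)
        hence "0 < bump p \<delta> 2 0 x" unfolding bump_dist by (intro eflat_pos) simp
        thus False using 0 by simp
      qed
    qed
    hence "emeasure ?\<mu> (ball p \<delta>) = 0"
      by (subst (asm) AE_iff_measurable[of "ball p \<delta>"]) auto
    thus False using emeasure_sphere_area_pos[OF assms(1), of "ball p \<delta>" p c] assms by simp
  qed
  moreover have "(\<integral>x. bump p \<delta> 2 0 x \<partial>?\<mu>) \<ge> 0" by (intro integral_nonneg_AE) (simp add: bump_nonneg)
  ultimately show ?thesis by simp
qed

text \<open>Continuous tests determine the integrals of \<open>h\<close> over open subsets of
  \<open>U\<close>, Dynkin's argument extends this to Borel sets, and the sets where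
  \<open>h\<close> is positive or negative finish the proof.\<close>

lemma AE_eq_0_of_continuous_tests:
  fixes h :: "real^3 \<Rightarrow> real"
  assumes h: "integrable M h" and M: "sets M = sets borel" and U: "open U" "U \<noteq> UNIV"
    and test: "\<And>g. continuous_on UNIV g \<Longrightarrow> (\<And>x. x \<notin> U \<Longrightarrow> g x = 0) \<Longrightarrow> (\<And>x. \<bar>g x\<bar> \<le> 1) \<Longrightarrow>
       (\<integral>x. h x * g x \<partial>M) = (0::real)"
  shows "AE x in M. x \<in> U \<longrightarrow> h x = 0"
proof -
  have sp: "space M = UNIV" using sets_eq_imp_space_eq[OF M] by simp
  have [measurable]: "h \<in> borel_measurable M" using h by simp
  have bm: "A \<in> sets M" if "A \<in> sets borel" for A using that M by simp
  have I: "integrable M (\<lambda>x. indicator A x * h x)" if "A \<in> sets borel" for A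
    using integrable_mult_indicator[OF bm[OF that] h] by simp
  have op: "(\<integral>x. indicator S x * h x \<partial>M) = 0" if S: "open S" "S \<subseteq> U" for S
  proof -
    \<comment> \<open>These increase to the indicator of \<open>S\<close>. The distance to an empty
      set is 0 by convention, so \<open>S\<close> must have a non-empty complement; this is where
      \<open>U \<noteq> UNIV\<close> enters.\<close>
    define g where "g n x = min 1 (real n * infdist x (- S))" for n x
    have ne: "- S \<noteq> {}" using S U by auto
    have [measurable]: "S \<in> sets M" by (rule bm[OF borel_open[OF S(1)]])
    have gc: "continuous_on UNIV (g n)" for n unfolding g_def[abs_def] by (intro continuous_intros)
    have [measurable]: "g n \<in> borel_measurable M" for n
      using borel_measurable_continuous_onI[OF gc] measurable_cong_sets[OF M refl] by blast
    have g0: "g n x = 0" if "x \<notin> S" for n x using that by (simp add: g_def)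
    have gn: "0 \<le> g n x" "g n x \<le> 1" for n x by (simp_all add: g_def infdist_nonneg)
    have "(\<lambda>n. \<integral>x. h x * g n x \<partial>M) \<longlonglongrightarrow> (\<integral>x. indicator S x * h x \<partial>M)"
    proof (rule integral_dominated_convergence[where w = "\<lambda>x. \<bar>h x\<bar>"])
      show "AE x in M. (\<lambda>n. h x * g n x) \<longlonglongrightarrow> indicator S x * h x"
      proof (rule AE_I2)
        fix x
        show "(\<lambda>n. h x * g n x) \<longlonglongrightarrow> indicator S x * h x"
        proof (cases "x \<in> S")
          case True
          have "infdist x (- S) > 0" using True S ne by (simp add: infdist_pos_not_in_closed closed_Compl)
          then obtain N :: nat where N: "1 < N * infdist x (- S)" using reals_Archimedean3 by blast
          have "eventually (\<lambda>n. h x * g n x = h x) sequentially"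
            using eventually_ge_at_top[of N]
          proof eventually_elim
            fix n assume "N \<le> n"
            hence "N * infdist x (- S) \<le> n * infdist x (- S)" by (intro mult_right_mono) (auto simp: infdist_nonneg)
            hence "1 \<le> n * infdist x (- S)" using N by linarith
            thus "h x * g n x = h x" by (simp add: g_def)
          qed
          thus ?thesis using True by (simp add: tendsto_eventually)
        qed (simp add: g0)
      qed
      show "AE x in M. norm (h x * g n x) \<le> \<bar>h x\<bar>" for n
      proof (rule AE_I2)
        fix x
        have "\<bar>g n x\<bar> \<le> 1" using gn[of n x] by simp
        hence "\<bar>h x\<bar> * \<bar>g n x\<bar> \<le> \<bar>h x\<bar> * 1" by (rule mult_left_mono) simp
        thus "norm (h x * g n x) \<le> \<bar>h x\<bar>" by (simp add: abs_mult)
      qed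
      show "integrable M (\<lambda>x. \<bar>h x\<bar>)" using h by simp
      show "(\<lambda>x. indicator S x * h x) \<in> borel_measurable M" by measurable
      show "(\<lambda>x. h x * g n x) \<in> borel_measurable M" for n by measurable
    qed
    moreover have "(\<integral>x. h x * g n x \<partial>M) = 0" for n
    proof (rule test[OF gc])
      show "\<bar>g n x\<bar> \<le> 1" for x using gn[of n x] by simp
    qed (use g0 S in auto)
    ultimately show ?thesis using LIMSEQ_unique[OF _ tendsto_const] by simp
  qed
  have all: "(\<integral>x. indicator (A \<inter> U) x * h x \<partial>M) = 0" if A: "A \<in> sets borel" for A
  proof -
    have "A \<in> sigma_sets UNIV {S. open S}" using A by (simp add: borel_def)
    have Is: "Int_stable {S :: (real^3) set. open S}" by (auto simp: Int_stable_def)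
    have sub: "{S :: (real^3) set. open S} \<subseteq> Pow UNIV" by simp
    from Is sub \<open>A \<in> sigma_sets UNIV {S. open S}\<close> show ?thesis
    proof (induct rule: sigma_sets_induct_disjoint)
      case (basic A)
      thus ?case using op[of "A \<inter> U"] U by auto
    next
      case (compl A)
      have Ab: "A \<in> sets borel" using compl(1) by (simp add: borel_def)
      have "indicator ((UNIV - A) \<inter> U) x * h x = indicator U x * h x - indicator (A \<inter> U) x * h x" for x
        by (auto simp: indicator_def)
      moreover have "integrable M (\<lambda>x. indicator U x * h x)" "integrable M (\<lambda>x. indicator (A \<inter> U) x * h x)"
        using I Ab U by auto
      ultimately show ?case using compl(2) op[OF U(1)] by simp
    next
      case (union A)
      have Ab: "A i \<in> sets borel" for i using union(2) by (auto simp: borel_def)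
      have "(LINT x:(\<Union>i. A i \<inter> U)|M. h x) = (\<Sum>i. (LINT x:(A i \<inter> U)|M. h x))"
      proof (rule lebesgue_integral_countable_add)
        show "A i \<inter> U \<in> sets M" for i using Ab U by (intro bm) auto
        show "i \<noteq> j \<Longrightarrow> A i \<inter> U \<inter> (A j \<inter> U) = {}" for i j using union(1) by (auto simp: disjoint_family_on_def)
        show "set_integrable M (\<Union>i. A i \<inter> U) h"
          unfolding set_integrable_def using I[of "\<Union>i. A i \<inter> U"] Ab U by auto
      qed
      moreover have "(\<Union>i. A i \<inter> U) = (\<Union>i. A i) \<inter> U" by auto
      ultimately show ?case using union(3) by (simp add: set_lebesgue_integral_def)
    qed simp
  qed
  have "AE x in M. indicator ({x. h x > 0} \<inter> U) x * h x = 0"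
    "AE x in M. - (indicator ({x. h x < 0} \<inter> U) x * h x) = 0"
  proof -
    have m: "{x. h x > 0} \<in> sets borel" "{x. h x < 0} \<in> sets borel"
    proof -
      have "{x \<in> space M. h x > 0} \<in> sets M" "{x \<in> space M. h x < 0} \<in> sets M" by measurable
      thus "{x. h x > 0} \<in> sets borel" "{x. h x < 0} \<in> sets borel" using M sp by simp_all
    qed
    have "integrable M (\<lambda>x. indicator ({x. h x > 0} \<inter> U) x * h x)"
      "integrable M (\<lambda>x. - (indicator ({x. h x < 0} \<inter> U) x * h x))"
      using I m U by auto
    from this[THEN integral_nonneg_eq_0_iff_AE] all[OF m(1)] all[OF m(2)]
    show "AE x in M. indicator ({x. h x > 0} \<inter> U) x * h x = 0"
      "AE x in M. - (indicator ({x. h x < 0} \<inter> U) x * h x) = 0"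
      by (auto simp: indicator_def)
  qed
  thus ?thesis
  proof eventually_elim
    fix x
    assume "indicator ({x. h x > 0} \<inter> U) x * h x = 0" "- (indicator ({x. h x < 0} \<inter> U) x * h x) = 0"
    thus "x \<in> U \<longrightarrow> h x = 0" by (cases "h x > 0"; cases "h x < 0") auto
  qed
qed

section \<open>Functions with vanishing weak derivatives\<close>

lemma eflat_measurable [measurable]: "eflat \<kappa> j \<in> borel_measurable borel"
  unfolding eflat_def[abs_def] by measurable

lemma bump_le_1: "bump p \<delta> 2 0 x \<le> 1"
  by (simp add: bump_def eflat_def)

text \<open>Averaging \<open>u\<close> against bumps gives the constant \<open>C n / N n\<close>
  throughout the ball. Fubini and the symmetry of the kernel move the averaging from
  \<open>u\<close> to a continuous test function, where it converges pointwise, so no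
  differentiation theorem for integrals is involved.\<close>

lemma locally_AE_constant:
  assumes r: "r > 0" and p0: "p0 \<in> sphere c r" and \<rho>: "\<rho> > 0"
    and u: "integrable (sphere_area c r) u"
    and Z: "\<And>b p \<delta>. p \<in> sphere c r \<Longrightarrow> \<delta> > 0 \<Longrightarrow> dist p p0 + \<delta> \<le> 2 * \<rho> \<Longrightarrow>
      (\<integral>x. u x * lie c b (bump p \<delta> 2 0) x \<partial>sphere_area c r) = 0"
  shows "\<exists>D. AE x in sphere_area c r. x \<in> ball p0 \<rho> \<longrightarrow> u x = D"
proof -
  let ?M = "sphere c r" and ?\<mu> = "sphere_area c r"
  interpret \<mu>: finite_measure ?\<mu> by (rule finite_measure_sphere_area)
  interpret P: pair_sigma_finite ?\<mu> ?\<mu> ..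
  have [measurable]: "u \<in> borel_measurable ?\<mu>" using u by simp
  \<comment> \<open>Always at most \<open>\<rho>\<close>, so a centre in
    \<open>ball p0 \<rho>\<close> and the radius together stay below the \<open>2 * \<rho>\<close>
    in the hypothesis.\<close>
  define \<delta> where "\<delta> n = \<rho> / real (Suc n)" for n
  have \<delta>: "\<delta> n > 0" "\<delta> n \<le> \<rho>" for n using \<rho> by (simp_all add: \<delta>_def field_simps)
  have \<delta>0: "\<delta> \<longlonglongrightarrow> 0" unfolding \<delta>_def[abs_def] by (rule lim_const_over_n[THEN LIMSEQ_Suc])
  define k where "k n p x = bump p (\<delta> n) 2 0 x" for n and p x :: "real^3"
  define N where "N n = (\<integral>x. k n p0 x \<partial>?\<mu>)" for n
  define C where "C n = (\<integral>x. u x * k n p0 x \<partial>?\<mu>)" for n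
  have k0: "0 \<le> k n p x" and k1: "k n p x \<le> 1" for n p x by (simp_all add: k_def bump_nonneg bump_le_1)
  have kc: "continuous_on UNIV (k n p)" for n p
    unfolding k_def[abs_def] by (intro smooth_imp_continuous smooth_bump) simp
  have ksym: "k n p x = k n x p" for n p x unfolding k_def by (rule bump_commute)
  have ik: "integrable ?\<mu> (k n p)" for n p by (intro integrable_continuous r kc)
  have N: "(\<integral>x. k n p x \<partial>?\<mu>) = N n" if "p \<in> ?M" for n p
    unfolding k_def N_def by (rule integral_bump_constant[OF r p0 that])
  have Np: "N n > 0" for n unfolding N_def k_def by (rule integral_bump_pos[OF r p0 \<delta>(1)])
  have C: "(\<integral>x. u x * k n p x \<partial>?\<mu>) = C n" if "p \<in> ?M" "p \<in> ball p0 \<rho>" for n p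
    unfolding k_def C_def
  proof (rule bump_average_constant[OF r u _ p0 that(1)])
    fix b p' assume "p' \<in> ?M" "dist p' p0 \<le> dist p p0"
    thus "(\<integral>x. u x * lie c b (bump p' (\<delta> n) 2 0) x \<partial>?\<mu>) = 0"
      using that(2) \<delta>[of n] by (intro Z) (auto simp: dist_commute)
  qed
  have lim: "(\<lambda>n. C n / N n * (\<integral>x. g x \<partial>?\<mu>)) \<longlonglongrightarrow> (\<integral>x. u x * g x \<partial>?\<mu>)"
    if g: "continuous_on UNIV g" "\<And>x. x \<notin> ball p0 \<rho> \<Longrightarrow> g x = 0" "\<And>x. \<bar>g x\<bar> \<le> 1" for g
  proof -
    have gm [measurable]: "g \<in> borel_measurable borel" by (rule borel_measurable_continuous_onI[OF g(1)])
    have km [measurable]: "(\<lambda>z. k n (fst z) (snd z)) \<in> borel_measurable (borel \<Otimes>\<^sub>M borel)" for n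
      unfolding k_def bump_def by measurable
    have ikg: "integrable ?\<mu> (\<lambda>p. k n x p * g p)" for n x
      by (intro integrable_mult_continuous r g(1) ik)
    \<comment> \<open>The test function averaged with total weight 1 at points of the sphere:
      \<open>k n x\<close> has integral \<open>N n\<close>.\<close>
    define gg where "gg n x = (\<integral>p. k n x p * g p \<partial>?\<mu>) / N n" for n x
    have ggm [measurable]: "gg n \<in> borel_measurable borel" for n
    proof -
      have "(\<lambda>(x, p). k n x p * g p) \<in> borel_measurable (borel \<Otimes>\<^sub>M ?\<mu>)"
        using measurable_compose[OF measurable_snd gm] km[of n]
        by (simp add: split_beta' cong: measurable_cong_sets)
      thus ?thesis unfolding gg_def[abs_def]
        by (intro borel_measurable_divide borel_measurable_const \<mu>.borel_measurable_lebesgue_integral)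
    qed
    have gg1: "\<bar>gg n x\<bar> \<le> 1" if "x \<in> ?M" for n x
    proof -
      have "\<bar>\<integral>p. k n x p * g p \<partial>?\<mu>\<bar> \<le> (\<integral>p. k n x p \<partial>?\<mu>)"
      proof (rule integral_abs_bound[THEN order_trans], rule integral_mono)
        show "\<bar>k n x p * g p\<bar> \<le> k n x p" for p
          using mult_left_mono[OF g(3)[of p] k0[of n x p]] k0[of n x p] by (simp add: abs_mult)
      qed (use ikg ik in auto)
      thus ?thesis using Np[of n] by (simp add: gg_def N[OF that] field_simps)
    qed
    have gglim: "(\<lambda>n. gg n x) \<longlonglongrightarrow> g x" if x: "x \<in> ?M" for x
    proof (rule LIMSEQ_I)
      fix \<epsilon> :: real assume \<epsilon>: "\<epsilon> > 0"
      have "isCont g x" using g(1) by (simp add: continuous_on_eq_continuous_at)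
      then obtain \<eta> where \<eta>: "\<eta> > 0" "\<And>p. dist p x < \<eta> \<Longrightarrow> dist (g p) (g x) < \<epsilon> / 2"
        using \<epsilon> unfolding continuous_at_eps_delta by (metis half_gt_zero)
      obtain n0 where "\<forall>n\<ge>n0. norm (\<delta> n - 0) < \<eta>" using LIMSEQ_D[OF \<delta>0 \<eta>(1)] by blast
      hence n0: "\<And>n. n \<ge> n0 \<Longrightarrow> \<delta> n < \<eta>" by (simp add: abs_less_iff)
      have "norm (gg n x - g x) < \<epsilon>" if n: "n \<ge> n0" for n
      proof -
        have eq: "gg n x - g x = (\<integral>p. k n x p * (g p - g x) \<partial>?\<mu>) / N n"
          using Np[of n] ikg ik N[OF x] by (simp add: gg_def right_diff_distrib diff_divide_distrib)
        have "\<bar>\<integral>p. k n x p * (g p - g x) \<partial>?\<mu>\<bar> \<le> (\<integral>p. k n x p * (\<epsilon> / 2) \<partial>?\<mu>)"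
        proof (rule integral_abs_bound[THEN order_trans], rule integral_mono)
          show "integrable ?\<mu> (\<lambda>p. k n x p * (\<epsilon> / 2))" using ik by simp
          show "integrable ?\<mu> (\<lambda>p. \<bar>k n x p * (g p - g x)\<bar>)"
            by (intro integrable_abs integrable_mult_continuous r ik continuous_intros g(1))
          show "\<bar>k n x p * (g p - g x)\<bar> \<le> k n x p * (\<epsilon> / 2)" for p
          proof (cases "p \<in> ball x (\<delta> n)")
            case True
            hence "dist p x < \<eta>" using n0[OF n] by (simp add: dist_commute)
            from \<eta>(2)[OF this] have "\<bar>g p - g x\<bar> \<le> \<epsilon> / 2" by (simp add: dist_real_def)
            hence "k n x p * \<bar>g p - g x\<bar> \<le> k n x p * (\<epsilon> / 2)" by (rule mult_left_mono[OF _ k0])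
            thus ?thesis unfolding abs_mult abs_of_nonneg[OF k0] .
          next
            case False
            hence "k n x p = 0" unfolding k_def by (intro bump_eq_0 \<delta>)
            thus ?thesis by simp
          qed
        qed
        moreover have "(\<integral>p. k n x p * (\<epsilon> / 2) \<partial>?\<mu>) = N n * (\<epsilon> / 2)" using N[OF x] by simp
        ultimately have "\<bar>\<integral>p. k n x p * (g p - g x) \<partial>?\<mu>\<bar> \<le> \<epsilon> / 2 * N n"
          by (simp only: mult.commute)
        hence "\<bar>gg n x - g x\<bar> \<le> \<epsilon> / 2"
          unfolding eq abs_divide abs_of_pos[OF Np] using Np[of n] by (simp only: pos_divide_le_eq)
        thus ?thesis using \<epsilon> by simp
      qed
      thus "\<exists>n0. \<forall>n\<ge>n0. norm (gg n x - g x) < \<epsilon>" by blast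
    qed
    have "(\<lambda>n. \<integral>x. u x * gg n x \<partial>?\<mu>) \<longlonglongrightarrow> (\<integral>x. u x * g x \<partial>?\<mu>)"
    proof (rule integral_dominated_convergence[where w = "\<lambda>x. \<bar>u x\<bar>"])
      show "AE x in ?\<mu>. (\<lambda>n. u x * gg n x) \<longlonglongrightarrow> u x * g x"
        using AE_sphere_area[OF r] by eventually_elim (intro tendsto_intros gglim)
      show "AE x in ?\<mu>. norm (u x * gg n x) \<le> \<bar>u x\<bar>" for n
        using AE_sphere_area[OF r]
      proof eventually_elim
        fix x assume "x \<in> ?M"
        from mult_left_mono[OF gg1[OF this, of n] abs_ge_zero[of "u x"]]
        show "norm (u x * gg n x) \<le> \<bar>u x\<bar>" by (simp add: abs_mult)
      qed
      show "integrable ?\<mu> (\<lambda>x. \<bar>u x\<bar>)" using u by simp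
      show "(\<lambda>x. u x * g x) \<in> borel_measurable ?\<mu>" by measurable
      show "(\<lambda>x. u x * gg n x) \<in> borel_measurable ?\<mu>" for n by measurable
    qed
    \<comment> \<open>After exchanging the integrals, the inner one is \<open>C n\<close> for
      \<open>p\<close> in the ball, and \<open>g\<close> vanishes for all other
      \<open>p\<close>.\<close>
    moreover have "(\<integral>x. u x * gg n x \<partial>?\<mu>) = C n / N n * (\<integral>x. g x \<partial>?\<mu>)" for n
    proof -
      define f where "f x p = u x * (k n x p * g p)" for x p
      have fm: "case_prod f \<in> borel_measurable (?\<mu> \<Otimes>\<^sub>M ?\<mu>)"
      proof -
        have 1: "(\<lambda>z. k n (fst z) (snd z)) \<in> borel_measurable (?\<mu> \<Otimes>\<^sub>M ?\<mu>)"
          using km[of n] by (simp cong: measurable_cong_sets)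
        thus ?thesis unfolding f_def split_beta' by measurable
      qed
      have iu: "integrable (?\<mu> \<Otimes>\<^sub>M ?\<mu>) (\<lambda>z. u (fst z))"
        by (rule P.Fubini_integrable) (use u in auto)
      have "integrable (?\<mu> \<Otimes>\<^sub>M ?\<mu>) (case_prod f)"
      proof (rule Bochner_Integration.integrable_bound[OF iu fm], rule AE_I2)
        fix z
        have "\<bar>k n (fst z) (snd z) * g (snd z)\<bar> \<le> 1 * 1"
          unfolding abs_mult using k0 k1 g(3) by (intro mult_mono) auto
        from mult_left_mono[OF this abs_ge_zero[of "u (fst z)"]]
        show "norm (case_prod f z) \<le> norm (u (fst z))"
          by (simp add: f_def split_beta' abs_mult)
      qed
      from P.Fubini_integral[OF this]
      have "(\<integral>x. (\<integral>p. f x p \<partial>?\<mu>) \<partial>?\<mu>) = (\<integral>p. (\<integral>x. f x p \<partial>?\<mu>) \<partial>?\<mu>)" ..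
      also have "\<dots> = (\<integral>p. C n * g p \<partial>?\<mu>)"
      proof (rule integral_cong_AE)
        show "(\<lambda>p. \<integral>x. f x p \<partial>?\<mu>) \<in> borel_measurable ?\<mu>"
        proof (rule \<mu>.borel_measurable_lebesgue_integral)
          show "(\<lambda>(p, x). f x p) \<in> borel_measurable (?\<mu> \<Otimes>\<^sub>M ?\<mu>)"
            using measurable_pair_swap[OF fm] by (simp add: split_beta')
        qed
        show "AE p in ?\<mu>. (\<integral>x. f x p \<partial>?\<mu>) = C n * g p"
          using AE_sphere_area[OF r]
        proof eventually_elim
          fix p assume p: "p \<in> ?M"
          have "(\<integral>x. f x p \<partial>?\<mu>) = (\<integral>x. u x * k n p x \<partial>?\<mu>) * g p"
            unfolding f_def ksym[of n _ p] by (simp flip: integral_mult_left_zero add: mult.assoc)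
          thus "(\<integral>x. f x p \<partial>?\<mu>) = C n * g p"
            using C[OF p] g(2)[of p] by (cases "p \<in> ball p0 \<rho>") auto
        qed
      qed measurable
      finally have "(\<integral>x. u x * (\<integral>p. k n x p * g p \<partial>?\<mu>) \<partial>?\<mu>) = C n * (\<integral>x. g x \<partial>?\<mu>)"
        by (simp add: f_def)
      thus ?thesis by (simp add: gg_def)
    qed
    ultimately show ?thesis by simp
  qed
  \<comment> \<open>One test function with positive integral shows that \<open>C n / N n\<close>
    converges; its limit \<open>D\<close> then serves for all tests.\<close>
  define g0 where "g0 = bump p0 \<rho> 2 0"
  have g0c: "continuous_on UNIV g0" unfolding g0_def by (intro smooth_imp_continuous smooth_bump) simp
  have g0p: "(\<integral>x. g0 x \<partial>?\<mu>) > 0" unfolding g0_def by (rule integral_bump_pos[OF r p0 \<rho>])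
  define D where "D = (\<integral>x. u x * g0 x \<partial>?\<mu>) / (\<integral>x. g0 x \<partial>?\<mu>)"
  have "(\<lambda>n. C n / N n * (\<integral>x. g0 x \<partial>?\<mu>)) \<longlonglongrightarrow> (\<integral>x. u x * g0 x \<partial>?\<mu>)"
    by (rule lim[OF g0c]) (auto simp: g0_def bump_eq_0[OF \<rho>] bump_nonneg bump_le_1 simp del: mem_ball)
  from tendsto_divide[OF this tendsto_const, of "\<integral>x. g0 x \<partial>?\<mu>"]
  have limD: "(\<lambda>n. C n / N n) \<longlonglongrightarrow> D" using g0p by (simp add: D_def)
  have "AE x in ?\<mu>. x \<in> ball p0 \<rho> \<longrightarrow> u x - D = 0"
  proof (rule AE_eq_0_of_continuous_tests)
    show "integrable ?\<mu> (\<lambda>x. u x - D)" using u by simp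
    show "ball p0 \<rho> \<noteq> UNIV" using bounded_ball[of p0 \<rho>] not_bounded_UNIV by metis
    fix g :: "real^3 \<Rightarrow> real"
    assume g: "continuous_on UNIV g" "\<And>x. x \<notin> ball p0 \<rho> \<Longrightarrow> g x = 0" "\<And>x. \<bar>g x\<bar> \<le> 1"
    have "(\<lambda>n. C n / N n * (\<integral>x. g x \<partial>?\<mu>)) \<longlonglongrightarrow> D * (\<integral>x. g x \<partial>?\<mu>)"
      by (intro tendsto_intros limD)
    hence "(\<integral>x. u x * g x \<partial>?\<mu>) = D * (\<integral>x. g x \<partial>?\<mu>)" using lim[OF g] LIMSEQ_unique by blast
    thus "(\<integral>x. (u x - D) * g x \<partial>?\<mu>) = 0"
      using integrable_mult_continuous[OF r g(1) u] integrable_continuous[OF r g(1)]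
      by (simp add: left_diff_distrib)
  qed auto
  thus ?thesis by auto
qed

lemma connected_AE_constant:
  assumes r: "r > 0" and \<Omega>: "openin (top_of_set (sphere c r)) \<Omega>" "connected \<Omega>"
    and u: "integrable (sphere_area c r) u"
    and Z: "\<And>b p \<delta>. \<delta> > 0 \<Longrightarrow> cball p \<delta> \<inter> sphere c r \<subseteq> \<Omega> \<Longrightarrow>
      (\<integral>x. u x * lie c b (bump p \<delta> 2 0) x \<partial>sphere_area c r) = 0"
  shows "\<exists>D. AE x\<in>\<Omega> in sphere_area c r. u x = D"
proof -
  let ?M = "sphere c r" and ?\<mu> = "sphere_area c r"
  have \<Omega>M: "\<Omega> \<subseteq> ?M" using openin_imp_subset[OF \<Omega>(1)] .
  define good where "good p \<rho> D \<longleftrightarrow> \<rho> > 0 \<and> ball p \<rho> \<inter> ?M \<subseteq> \<Omega> \<and>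
    (AE x in ?\<mu>. x \<in> ball p \<rho> \<longrightarrow> u x = D)" for p \<rho> D
  have "\<exists>\<rho> D. good p \<rho> D" if p: "p \<in> \<Omega>" for p
  proof -
    obtain e where e: "e > 0" "ball p e \<inter> ?M \<subseteq> \<Omega>"
      using \<Omega>(1) p unfolding openin_contains_ball by blast
    \<comment> \<open>With radius \<open>e/3\<close> only bumps reaching up to
      \<open>2 * (e/3)\<close> from \<open>p\<close> occur, and their closed supports stay inside
      \<open>ball p e\<close>.\<close>
    have "\<exists>D. AE x in ?\<mu>. x \<in> ball p (e/3) \<longrightarrow> u x = D"
    proof (rule locally_AE_constant[OF r _ _ u])
      show "p \<in> ?M" using p \<Omega>M by blast
      fix b p' and \<delta> :: real assume \<delta>: "\<delta> > 0" "dist p' p + \<delta> \<le> 2 * (e / 3)"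
      have "cball p' \<delta> \<subseteq> ball p e"
      proof
        fix y assume "y \<in> cball p' \<delta>"
        hence "dist p y \<le> dist p' p + \<delta>" using dist_triangle[of p y p'] by (simp add: dist_commute)
        thus "y \<in> ball p e" using \<delta> e by simp
      qed
      thus "(\<integral>x. u x * lie c b (bump p' \<delta> 2 0) x \<partial>?\<mu>) = 0" using e by (intro Z \<delta>) auto
    qed (use e in simp)
    then obtain D where "AE x in ?\<mu>. x \<in> ball p (e/3) \<longrightarrow> u x = D" ..
    moreover have "ball p (e/3) \<inter> ?M \<subseteq> \<Omega>" using e by auto
    moreover have "e / 3 > 0" using e by simp
    ultimately have "good p (e / 3) D" unfolding good_def by (intro conjI)
    thus ?thesis by blast
  qed
  hence "\<exists>\<rho> D. \<forall>p\<in>\<Omega>. good p (\<rho> p) (D p)" by metis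
  then obtain \<rho> D where \<rho>: "\<And>p. p \<in> \<Omega> \<Longrightarrow> \<rho> p > 0" "\<And>p. p \<in> \<Omega> \<Longrightarrow> ball p (\<rho> p) \<inter> ?M \<subseteq> \<Omega>"
    and D: "\<And>p. p \<in> \<Omega> \<Longrightarrow> AE x in ?\<mu>. x \<in> ball p (\<rho> p) \<longrightarrow> u x = D p"
    unfolding good_def by blast
  have "D constant_on \<Omega>"
  proof (rule locally_constant_imp_constant[OF \<Omega>(2)])
    fix p assume p: "p \<in> \<Omega>"
    have "D q = D p" if q: "q \<in> \<Omega>" "q \<in> ball p (\<rho> p)" for q
    proof (rule ccontr)
      assume ne: "D q \<noteq> D p"
      \<comment> \<open>This open set contains the point \<open>q\<close> of the sphere, so it has
        positive area and cannot carry two different almost everywhere values.\<close>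
      let ?U = "ball p (\<rho> p) \<inter> ball q (\<rho> q)"
      have "AE x in ?\<mu>. x \<notin> ?U"
        using D[OF p] D[OF q(1)] by eventually_elim (use ne in auto)
      hence "emeasure ?\<mu> ?U = 0"
        by (subst (asm) AE_iff_measurable[of ?U]) auto
      moreover have "emeasure ?\<mu> ?U > 0"
        using q \<rho>(1)[OF q(1)] \<Omega>M by (intro emeasure_sphere_area_pos[of r ?U q c] r) auto
      ultimately show False by simp
    qed
    hence "\<forall>x\<in>\<Omega> \<inter> ball p (\<rho> p). D x = D p" by blast
    moreover have "openin (top_of_set \<Omega>) (\<Omega> \<inter> ball p (\<rho> p))" by (rule openin_open_Int) simp
    moreover have "p \<in> \<Omega> \<inter> ball p (\<rho> p)" using p \<rho>(1)[OF p] by simp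
    ultimately show "\<exists>T. openin (top_of_set \<Omega>) T \<and> p \<in> T \<and> (\<forall>x\<in>T. D x = D p)" by blast
  qed
  then obtain d where d: "\<And>p. p \<in> \<Omega> \<Longrightarrow> D p = d" unfolding constant_on_def by blast
  \<comment> \<open>There is one null set per ball; a countable subcover keeps their union
    null.\<close>
  obtain F where F: "F \<subseteq> (\<lambda>p. ball p (\<rho> p)) ` \<Omega>" "countable F" "\<Union>F = (\<Union>p\<in>\<Omega>. ball p (\<rho> p))"
    using Lindelof[of "(\<lambda>p. ball p (\<rho> p)) ` \<Omega>"] by auto
  have "AE x in ?\<mu>. \<forall>S\<in>F. x \<in> S \<longrightarrow> u x = d"
  proof (rule AE_ball_countable'[OF _ F(2)])
    fix S assume "S \<in> F"
    then obtain p where p: "p \<in> \<Omega>" "S = ball p (\<rho> p)" using F(1) by auto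
    show "AE x in ?\<mu>. x \<in> S \<longrightarrow> u x = d" using D[OF p(1)] d[OF p(1)] p(2) by simp
  qed
  hence "AE x\<in>\<Omega> in ?\<mu>. u x = d"
  proof eventually_elim
    fix x assume x: "\<forall>S\<in>F. x \<in> S \<longrightarrow> u x = d"
    show "x \<in> \<Omega> \<longrightarrow> u x = d"
    proof
      assume "x \<in> \<Omega>"
      hence "x \<in> (\<Union>p\<in>\<Omega>. ball p (\<rho> p))" using \<rho>(1) by force
      thus "u x = d" using x F(3) by blast
    qed
  qed
  thus ?thesis ..
qed

section \<open>The space of Killing fields\<close>

lemma field_real_ring: "field real_ring"
proof -
  interpret cring real_ring
    by (rule cringI, rule abelian_groupI, auto intro!: comm_monoidI exI[of _ "- _"] simp: real_ring_def distrib_right)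
  show ?thesis
  proof (rule cring_fieldI2)
    fix a assume "a \<noteq> \<zero>\<^bsub>real_ring\<^esub>"
    thus "\<exists>b\<in>carrier real_ring. a \<otimes>\<^bsub>real_ring\<^esub> b = \<one>\<^bsub>real_ring\<^esub>"
      by (intro bexI[of _ "inverse a"]) (simp_all add: real_ring_def)
  qed (simp add: real_ring_def)
qed

text \<open>The module axioms are transported along \<open>E\<close> together with the standard
  basis, so the quotient space is never treated axiomatically on its own.\<close>

lemma has_dimension_DIM:
  fixes V :: "(real, 'v, 'x) module_scheme" and E :: "'a::euclidean_space \<Rightarrow> 'v"
  assumes bij: "bij_betw E UNIV (carrier V)"
    and zero: "\<zero>\<^bsub>V\<^esub> = E 0"
    and add: "\<And>x y. E x \<oplus>\<^bsub>V\<^esub> E y = E (x + y)"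
    and smult: "\<And>a x. a \<odot>\<^bsub>V\<^esub> E x = E (a *\<^sub>R x)"
  shows "has_dimension V DIM('a)"
proof -
  have inj: "inj E" and C: "carrier V = range E" using bij by (auto simp: bij_betw_def)
  interpret K: field real_ring by (rule field_real_ring)
  have ag: "abelian_group V"
  proof (rule abelian_groupI)
    fix x assume "x \<in> carrier V"
    then obtain v where "x = E v" using C by auto
    thus "\<exists>y\<in>carrier V. y \<oplus>\<^bsub>V\<^esub> x = \<zero>\<^bsub>V\<^esub>" by (intro bexI[of _ "E (- v)"]) (simp_all add: C zero add)
  qed (auto simp: C zero add algebra_simps)
  have "module real_ring V"
    by (rule moduleI[OF K.is_cring ag])
      (auto simp: C smult add real_ring_def scaleR_add_left scaleR_add_right)
  then interpret vectorspace real_ring V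
    by (intro vectorspace.intro field_real_ring)
  have fs: "finsum V (\<lambda>e. E (f e)) S = E (\<Sum>e\<in>S. f e)" if "finite S" for S and f :: "'a \<Rightarrow> 'a"
    using that
  proof induction
    case (insert x S)
    thus ?case by (simp add: C add)
  qed (simp add: zero)
  define A where "A = E ` (Basis :: 'a set)"
  have lc: "lincomb a A = E (\<Sum>e\<in>Basis. a (E e) *\<^sub>R e)" for a
  proof -
    have "lincomb a A = finsum V (\<lambda>e. a (E e) \<odot>\<^bsub>V\<^esub> E e) Basis"
      unfolding lincomb_def A_def
      by (subst finsum_reindex) (auto simp: C smult intro: inj_on_subset[OF inj])
    thus ?thesis by (simp add: smult fs)
  qed
  have A: "finite A" "A \<subseteq> carrier V" by (auto simp: A_def C)
  have gen: "gen_set A"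
  proof (intro equalityI subsetI)
    fix x assume "x \<in> carrier V"
    then obtain v where v: "x = E v" using C by auto
    have "x = lincomb (\<lambda>y. v \<bullet> inv_into UNIV E y) A"
      unfolding lc v by (simp add: inj euclidean_representation)
    thus "x \<in> span A" unfolding span_def using A by (auto simp: real_ring_def)
  next
    fix x assume "x \<in> span A"
    thus "x \<in> carrier V" using A by (simp add: span_closed)
  qed
  have "lin_indpt A"
  proof (rule finite_lin_indpt2[OF A], rule ballI)
    fix a v assume "lincomb a A = \<zero>\<^bsub>V\<^esub>" "v \<in> A"
    then obtain e where e: "e \<in> Basis" "v = E e" and "(\<Sum>e\<in>Basis. a (E e) *\<^sub>R e) = 0"
      unfolding lc zero using inj by (auto simp: A_def inj_eq)
    hence "(\<Sum>e\<in>Basis. a (E e) *\<^sub>R e) \<bullet> e = 0" by simp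
    thus "a v = \<zero>\<^bsub>real_ring\<^esub>" using e by (simp add: real_ring_def)
  qed
  hence b: "basis A" using gen A by (simp add: basis_def)
  have "dim = card A" by (rule dim_basis[OF A(1) b])
  also have "\<dots> = DIM('a)" unfolding A_def by (intro card_image inj_on_subset[OF inj]) simp
  finally have "dim = DIM('a)" .
  moreover have "fin_dim" using A gen unfolding fin_dim_def by blast
  ultimately show ?thesis unfolding has_dimension_def using vectorspace_axioms by blast
qed

context killing_field
begin

lemma eq_rotfield:
  assumes "openin (top_of_set (sphere c r)) \<Omega>" "connected \<Omega>"
  shows "\<exists>\<omega>. AE x\<in>\<Omega> in \<mu>. W x = rotfield c \<omega> x"
proof -
  have "\<exists>D. AE x\<in>\<Omega> in \<mu>. spin e x = D" for e
    by (rule connected_AE_constant[OF r assms spin_int spin_lie_bump])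
  then obtain d where d: "\<And>e. AE x\<in>\<Omega> in \<mu>. spin e x = d e" by metis
  define \<omega> where "\<omega> = (\<Sum>e\<in>Basis. d e *\<^sub>R e)"
  have "AE x in \<mu>. \<forall>e\<in>Basis. x \<in> \<Omega> \<longrightarrow> spin e x = d e"
    by (rule AE_ball_countable'[OF d]) (simp add: countable_finite)
  hence "AE x\<in>\<Omega> in \<mu>. W x = rotfield c \<omega> x"
  proof eventually_elim
    fix x assume s: "\<forall>e\<in>Basis. x \<in> \<Omega> \<longrightarrow> spin e x = d e"
    show "x \<in> \<Omega> \<longrightarrow> W x = rotfield c \<omega> x"
    proof
      assume x: "x \<in> \<Omega>"
      define \<xi> where "\<xi> = x - c"
      have xx: "\<xi> \<bullet> \<xi> = r\<^sup>2" using inner_sphere[of x c r] x \<Omega> by (auto simp: \<xi>_def simp del: mem_sphere)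
      have "\<omega> = \<alpha> x *\<^sub>R \<xi> + (1 / r\<^sup>2) *\<^sub>R (\<xi> \<times> w x)"
      proof (rule euclidean_eqI)
        fix e :: "real^3" assume e: "e \<in> Basis"
        have "w x \<bullet> (e \<times> \<xi>) = (\<xi> \<times> w x) \<bullet> e" by (metis cross_triple inner_commute)
        moreover have "\<omega> \<bullet> e = spin e x" using e s x by (simp add: \<omega>_def)
        ultimately show "\<omega> \<bullet> e = (\<alpha> x *\<^sub>R \<xi> + (1 / r\<^sup>2) *\<^sub>R (\<xi> \<times> w x)) \<bullet> e"
          by (simp add: spin_def \<xi>_def[symmetric] inner_add_left inner_commute[of e])
      qed
      \<comment> \<open>The cross product with \<open>\<xi>\<close> removes the unknown
        \<open>\<alpha>\<close> and recovers \<open>W\<close> alone.\<close>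
      hence "\<omega> \<times> \<xi> = (1 / r\<^sup>2) *\<^sub>R ((\<xi> \<times> w x) \<times> \<xi>)"
        by (simp add: cross_add_left cross_mult_left)
      also have "\<dots> = w x" using r w_normal[of x] by (simp add: cross_cross_left xx \<xi>_def[symmetric])
      finally show "W x = rotfield c \<omega> x" using x by (simp add: rotfield_def \<xi>_def w_def)
    qed
  qed
  thus ?thesis ..
qed

end

section \<open>Stability of the weak equation under changes on null sets\<close>

lemma rotfield_tangent:
  "r > 0 \<Longrightarrow> x \<in> sphere c r \<Longrightarrow> rotfield c \<omega> x \<in> tangent_space (sphere c r) x"
  by (simp add: tangent_sphere_iff rotfield_def dot_cross_self del: mem_sphere)

lemma continuous_rotfield: "continuous_on S (rotfield c \<omega>)"
  unfolding rotfield_def[abs_def] by (intro continuous_intros continuous_on_cross)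

lemma set_square_integrable_continuous:
  fixes f :: "real^3 \<Rightarrow> 'b::euclidean_space"
  assumes "r > 0" "\<Omega> \<in> sets borel" "continuous_on UNIV f"
  shows "set_square_integrable (sphere_area c r) \<Omega> f"
  unfolding set_square_integrable_def set_borel_measurable_def set_integrable_def
proof (intro conjI)
  have [measurable]: "f \<in> borel_measurable borel" by (rule borel_measurable_continuous_onI[OF assms(3)])
  show "(\<lambda>x. indicator \<Omega> x *\<^sub>R f x) \<in> borel_measurable (sphere_area c r)" using assms(2) by measurable
  show "integrable (sphere_area c r) (\<lambda>x. indicator \<Omega> x *\<^sub>R (norm (f x))\<^sup>2)"
    using assms(2) by (intro integrable_mult_indicator integrable_continuous assms continuous_intros) auto
qed

lemma set_square_integrable_cong_AE:
  assumes "set_square_integrable M \<Omega> f" "set_borel_measurable M \<Omega> g" "AE x\<in>\<Omega> in M. g x = f x"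
  shows "set_square_integrable M \<Omega> g"
proof -
  have "(\<lambda>x. indicator \<Omega> x *\<^sub>R (norm (g x))\<^sup>2) = (\<lambda>x. (norm (indicator \<Omega> x *\<^sub>R g x))\<^sup>2)"
    by (auto simp: indicator_def)
  moreover have "(\<lambda>x. indicator \<Omega> x *\<^sub>R g x) \<in> borel_measurable M"
    using assms(2) by (simp add: set_borel_measurable_def)
  hence "(\<lambda>x. (norm (indicator \<Omega> x *\<^sub>R g x))\<^sup>2) \<in> borel_measurable M" by measurable
  ultimately have m: "(\<lambda>x. indicator \<Omega> x *\<^sub>R (norm (g x))\<^sup>2) \<in> borel_measurable M" by (simp only:)
  have i: "integrable M (\<lambda>x. indicator \<Omega> x *\<^sub>R (norm (f x))\<^sup>2)"
    using assms(1) by (simp add: set_square_integrable_def set_integrable_def)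
  have "AE x in M. indicator \<Omega> x *\<^sub>R (norm (f x))\<^sup>2 = indicator \<Omega> x *\<^sub>R (norm (g x))\<^sup>2"
    using assms(3) by eventually_elim (auto simp: indicator_def)
  hence "integrable M (\<lambda>x. indicator \<Omega> x *\<^sub>R (norm (g x))\<^sup>2)"
    using integrable_cong_AE[OF _ m] i borel_measurable_integrable[OF i] by blast
  thus ?thesis using assms(2) by (simp add: set_square_integrable_def set_integrable_def)
qed

lemma weak_cov_deriv_cong_AE:
  assumes r: "r > 0" and \<Omega>: "\<Omega> \<subseteq> sphere c r"
    and W: "weak_cov_deriv (sphere c r) (sphere_area c r) \<Omega> W A"
    and tan: "\<And>x. x \<in> \<Omega> \<Longrightarrow> W x \<in> tangent_space (sphere c r) x"
      "\<And>x. x \<in> \<Omega> \<Longrightarrow> W' x \<in> tangent_space (sphere c r) x"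
    and meas: "set_borel_measurable (sphere_area c r) \<Omega> W" "set_borel_measurable (sphere_area c r) \<Omega> W'"
    and eq: "AE x\<in>\<Omega> in sphere_area c r. W' x = W x"
  shows "weak_cov_deriv (sphere c r) (sphere_area c r) \<Omega> W' A"
proof -
  let ?M = "sphere c r" and ?\<mu> = "sphere_area c r"
  have "(LINT x:\<Omega>|?\<mu>. W' x \<bullet> cov_deriv ?M X x (Y x) + (W' x \<bullet> X x) * surface_div ?M Y x) =
      (LINT x:\<Omega>|?\<mu>. W x \<bullet> cov_deriv ?M X x (Y x) + (W x \<bullet> X x) * surface_div ?M Y x)"
    if XY: "X \<in> test_fields ?M \<Omega>" "Y \<in> test_fields ?M \<Omega>" for X Y
  proof -
    have sX: "smooth X" and sY: "smooth Y" using XY by (auto simp: test_fields_def smooth_def)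
    \<comment> \<open>A smooth ambient field which, against tangent vectors, represents the
      integrand on \<open>\<Omega>\<close>. It provides the measurability that the projections in
      \<open>cov_deriv\<close> and \<open>surface_div\<close> do not display.\<close>
    define Z where "Z x = fd X x (Y x) +
      ((\<Sum>e\<in>Basis. fd Y x e \<bullet> e) - (fd Y x (x - c) \<bullet> (x - c)) * (1 / r\<^sup>2)) *\<^sub>R X x" for x
    have "smooth Z" unfolding Z_def[abs_def]
      by (intro smooth_intros smooth_fd_comp sX sY)
    hence [measurable]: "Z \<in> borel_measurable ?\<mu>"
      by (intro continuous_imp_measurable_sphere_area smooth_imp_continuous)
    have *: "(LINT x:\<Omega>|?\<mu>. V x \<bullet> cov_deriv ?M X x (Y x) + (V x \<bullet> X x) * surface_div ?M Y x) =
        (\<integral>x. (indicator \<Omega> x *\<^sub>R V x) \<bullet> Z x \<partial>?\<mu>)"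
      if V: "\<And>x. x \<in> \<Omega> \<Longrightarrow> V x \<in> tangent_space ?M x" for V
      unfolding set_lebesgue_integral_def
    proof (rule Bochner_Integration.integral_cong[OF refl])
      fix x
      show "indicator \<Omega> x *\<^sub>R (V x \<bullet> cov_deriv ?M X x (Y x) + (V x \<bullet> X x) * surface_div ?M Y x) =
          (indicator \<Omega> x *\<^sub>R V x) \<bullet> Z x"
      proof (cases "x \<in> \<Omega>")
        case True
        hence x: "x \<in> ?M" using \<Omega> by blast
        have Vx: "V x \<bullet> (x - c) = 0" using V[OF True] tangent_sphere_iff[OF r x] by blast
        show ?thesis using True
          by (simp add: cov_deriv_def tproj_sphere_inner[OF r x Vx]
              surface_div_sphere[OF r x smooth_imp_differentiable[OF sY]] Z_def inner_add_right)
      qed simp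
    qed
    have m: "(\<lambda>x. (indicator \<Omega> x *\<^sub>R V x) \<bullet> Z x) \<in> borel_measurable ?\<mu>"
      if "set_borel_measurable ?\<mu> \<Omega> V" for V
      using that unfolding set_borel_measurable_def by measurable
    have "(\<integral>x. (indicator \<Omega> x *\<^sub>R W' x) \<bullet> Z x \<partial>?\<mu>) = (\<integral>x. (indicator \<Omega> x *\<^sub>R W x) \<bullet> Z x \<partial>?\<mu>)"
    proof (rule integral_cong_AE[OF m[OF meas(2)] m[OF meas(1)]])
      show "AE x in ?\<mu>. (indicator \<Omega> x *\<^sub>R W' x) \<bullet> Z x = (indicator \<Omega> x *\<^sub>R W x) \<bullet> Z x"
        using eq by eventually_elim (auto simp: indicator_def)
    qed
    thus ?thesis using *[OF tan(1)] *[OF tan(2)] by simp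
  qed
  thus ?thesis using W unfolding weak_cov_deriv_def by simp
qed

lemma openin_sphere_borel:
  fixes c :: "real^3"
  assumes "openin (top_of_set (sphere c r)) \<Omega>"
  shows "\<Omega> \<in> sets borel"
proof -
  obtain T where T: "open T" "\<Omega> = sphere c r \<inter> T" using assms unfolding openin_open by blast
  show ?thesis unfolding T(2) by (rule sets.Int[OF borel_closed[OF closed_sphere] borel_open[OF T(1)]])
qed

lemma H1_kf_sphere:
  assumes r: "r > 0" and \<Omega>: "openin (top_of_set (sphere c r)) \<Omega>" "connected \<Omega>"
  shows "W \<in> H1_kf (sphere c r) (sphere_area c r) \<Omega> \<longleftrightarrow>
    (\<forall>x\<in>\<Omega>. W x \<in> tangent_space (sphere c r) x) \<and> set_borel_measurable (sphere_area c r) \<Omega> W \<and>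
    (\<exists>\<omega>. AE x\<in>\<Omega> in sphere_area c r. W x = rotfield c \<omega> x)"
    (is "?L \<longleftrightarrow> ?R")
proof
  let ?M = "sphere c r" and ?\<mu> = "sphere_area c r"
  have \<Omega>M: "\<Omega> \<subseteq> ?M" using openin_imp_subset[OF \<Omega>(1)] .
  have \<Omega>b: "\<Omega> \<in> sets borel" by (rule openin_sphere_borel[OF \<Omega>(1)])
  {
    assume ?L
    then obtain A where W: "\<forall>x\<in>\<Omega>. W x \<in> tangent_space ?M x" "set_square_integrable ?\<mu> \<Omega> W"
      and A: "set_square_integrable ?\<mu> \<Omega> A" "weak_cov_deriv ?M ?\<mu> \<Omega> W A"
        "AE x\<in>\<Omega> in ?\<mu>. \<forall>X\<in>tangent_space ?M x. \<forall>Y\<in>tangent_space ?M x. (A x *v Y) \<bullet> X + (A x *v X) \<bullet> Y = 0"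
      unfolding H1_kf_def H1_def by blast
    interpret killing_field c r \<Omega> W A
      by unfold_locales (use r \<Omega>M \<Omega>b W A in blast)+
    show ?R using eq_rotfield[OF assms(2,3)] W unfolding set_square_integrable_def by blast
  next
    assume ?R
    then obtain \<omega> where W: "\<And>x. x \<in> \<Omega> \<Longrightarrow> W x \<in> tangent_space ?M x" "set_borel_measurable ?\<mu> \<Omega> W"
      and \<omega>: "AE x\<in>\<Omega> in ?\<mu>. W x = rotfield c \<omega> x" by blast
    have R: "set_square_integrable ?\<mu> \<Omega> (rotfield c \<omega>)" "set_square_integrable ?\<mu> \<Omega> (rotgrad c r \<omega>)"
      by (intro set_square_integrable_continuous r \<Omega>b continuous_rotfield continuous_rotgrad)+
    have "set_square_integrable ?\<mu> \<Omega> W"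
      by (rule set_square_integrable_cong_AE[OF R(1) W(2) \<omega>])
    moreover have wk: "weak_cov_deriv ?M ?\<mu> \<Omega> W (rotgrad c r \<omega>)"
    proof (rule weak_cov_deriv_cong_AE[OF r \<Omega>M weak_cov_deriv_rotfield[OF r \<Omega>M \<Omega>b, of \<omega>] _ W(1) _ W(2) \<omega>])
      show "rotfield c \<omega> x \<in> tangent_space ?M x" if "x \<in> \<Omega>" for x
        using that \<Omega>M by (intro rotfield_tangent r) auto
      show "set_borel_measurable ?\<mu> \<Omega> (rotfield c \<omega>)" using R(1) by (simp add: set_square_integrable_def)
    qed
    moreover have "AE x\<in>\<Omega> in ?\<mu>. \<forall>X\<in>tangent_space ?M x. \<forall>Y\<in>tangent_space ?M x.
        (rotgrad c r \<omega> x *v Y) \<bullet> X + (rotgrad c r \<omega> x *v X) \<bullet> Y = 0"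
    proof (rule AE_I2, intro impI ballI)
      fix x X Y
      have "((x - c) \<times> Y) \<bullet> X = - (((x - c) \<times> X) \<bullet> Y)"
        by (metis cross_skew cross_triple inner_minus_left inner_commute)
      thus "(rotgrad c r \<omega> x *v Y) \<bullet> X + (rotgrad c r \<omega> x *v X) \<bullet> Y = 0"
        by (simp add: rotgrad_apply)
    qed
    ultimately show ?L using W(1) R(2) unfolding H1_kf_def H1_def by blast
  }
qed

lemma rotfield_add: "rotfield c \<omega> x + rotfield c \<omega>' x = rotfield c (\<omega> + \<omega>') x"
  and rotfield_scaleR: "a *\<^sub>R rotfield c \<omega> x = rotfield c (a *\<^sub>R \<omega>) x"
  by (simp_all add: rotfield_def cross_add_left cross_mult_left)

text \<open>A nonzero rotation field does vanish on its axis, so one point is not enough.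
  Differentiating along a rotation about some \<open>b\<close> orthogonal to \<open>\<xi>\<close>
  gives \<open>\<omega> \<times> (b \<times> \<xi>) = 0\<close>, hence
  \<open>\<omega> \<bullet> \<xi> = 0\<close>, while \<open>\<omega> \<times> \<xi> = 0\<close>
  already holds.\<close>

lemma cross_eq_0_on_sphere_open:
  assumes r: "r > 0" and U: "open U" "x \<in> U" "x \<in> sphere c r"
    and z: "\<And>y. y \<in> U \<Longrightarrow> y \<in> sphere c r \<Longrightarrow> \<omega> \<times> (y - c) = 0"
  shows "\<omega> = 0"
proof -
  define \<xi> where "\<xi> = x - c"
  have \<xi>0: "\<xi> \<noteq> 0" using norm_sphere[OF U(3)] r by (auto simp: \<xi>_def)
  have cr: "\<omega> \<times> \<xi> = 0" using z[OF U(2,3)] by (simp add: \<xi>_def)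
  obtain y where y: "y \<noteq> 0" "orthogonal \<xi> y" using orthogonal_to_vector_exists[of \<xi>] by auto
  define b where "b = (1 / norm y) *\<^sub>R y"
  have b: "norm b = 1" "\<xi> \<bullet> b = 0" using y by (simp_all add: b_def orthogonal_def)
  have bb: "b \<bullet> b = 1" using b(1) by (simp add: norm_eq_1)
  have "continuous (at 0) (\<lambda>t. rotc c b t x)"
    using has_vector_derivative_continuous[OF rotc_derivative[OF b(1)]] .
  hence "((\<lambda>t. rotc c b t x) \<longlongrightarrow> x) (at 0)" by (simp add: continuous_within)
  hence "eventually (\<lambda>t. rotc c b t x \<in> U) (at 0)" by (rule topological_tendstoD) (use U in auto)
  hence "eventually (\<lambda>t. rotc c b t x \<in> U) (nhds 0)" using U by (simp add: eventually_nhds_conv_at)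
  then obtain S where S: "open S" "0 \<in> S" "\<And>t. t \<in> S \<Longrightarrow> rotc c b t x \<in> U"
    unfolding eventually_nhds by blast
  have "((\<lambda>t. rotc c b t x - c) has_vector_derivative b \<times> \<xi>) (at 0)"
    using has_vector_derivative_diff[OF rotc_derivative[OF b(1), of c x 0] has_vector_derivative_const[of c]]
    by (simp add: \<xi>_def)
  hence "((\<lambda>t. \<omega> \<times> (rotc c b t x - c)) has_vector_derivative \<omega> \<times> (b \<times> \<xi>)) (at 0)"
    by (rule bounded_linear.has_vector_derivative[OF bounded_bilinear.bounded_linear_right[OF bounded_bilinear_cross3]])
  moreover have "((\<lambda>t. \<omega> \<times> (rotc c b t x - c)) has_vector_derivative 0) (at 0)"
    by (rule has_vector_derivative_transform_within_open[OF has_vector_derivative_const S(1,2)])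
      (use z[OF S(3) rotc_in_sphere[OF b(1) U(3)]] in simp)
  ultimately have "\<omega> \<times> (b \<times> \<xi>) = 0" by (rule vector_derivative_unique_at)
  hence "((\<omega> \<bullet> \<xi>) *\<^sub>R b - (\<omega> \<bullet> b) *\<^sub>R \<xi>) \<bullet> b = 0" by (simp add: Lagrange)
  hence "\<omega> \<bullet> \<xi> = 0" using b(2) bb by (simp add: inner_diff_left)
  thus ?thesis using cr \<xi>0 norm_and_cross_eq_0 by blast
qed

text \<open>The set where two rotation fields differ is open; meeting the sphere inside
  \<open>\<Omega>\<close> it would have positive area.\<close>

lemma rotfield_AE_inject:
  assumes r: "r > 0" and \<Omega>: "openin (top_of_set (sphere c r)) \<Omega>" "\<Omega> \<noteq> {}"
    and eq: "AE x\<in>\<Omega> in sphere_area c r. rotfield c \<omega> x = rotfield c \<omega>' x"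
  shows "\<omega> = \<omega>'"
proof -
  obtain T where T: "open T" "\<Omega> = sphere c r \<inter> T" using \<Omega>(1) by (auto simp: openin_open)
  obtain p where p: "p \<in> T" "p \<in> sphere c r" using \<Omega>(2) T(2) by blast
  define d where "d = \<omega> - \<omega>'"
  have "d = 0"
  proof (rule cross_eq_0_on_sphere_open[OF r T(1) p])
    fix y assume y: "y \<in> T" "y \<in> sphere c r"
    show "d \<times> (y - c) = 0"
    proof (rule ccontr)
      assume ne: "d \<times> (y - c) \<noteq> 0"
      let ?U = "T \<inter> {x. d \<times> (x - c) \<noteq> 0}"
      have "open {x. d \<times> (x - c) \<noteq> 0}"
        by (intro open_Collect_neq continuous_intros continuous_on_cross)
      hence U: "open ?U" using T(1) by auto
      have "AE x in sphere_area c r. x \<notin> ?U"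
        using eq AE_sphere_area[OF r]
        by eventually_elim (auto simp: T(2) d_def rotfield_def Cross3.left_diff_distrib simp del: mem_sphere)
      hence "emeasure (sphere_area c r) ?U = 0"
        by (subst (asm) AE_iff_measurable[of ?U]) (use U in auto)
      moreover have "emeasure (sphere_area c r) ?U > 0"
        by (rule emeasure_sphere_area_pos[OF r U _ y(2)]) (use y ne in auto)
      ultimately show False by simp
    qed
  qed
  thus ?thesis by (simp add: d_def)
qed

text \<open>Sending \<open>\<omega>\<close> to the class of \<open>rotfield c \<omega>\<close> is a
  linear bijection from \<open>real^3\<close>: onto by \<open>H1_kf_sphere\<close>, injective by
  \<open>rotfield_AE_inject\<close>.\<close>

theorem corollary2p1:
  fixes c :: "real^3" and r \<kappa> :: real and M \<Omega> :: "(real^3) set"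
  assumes "r > 0" and "M = sphere c r"
    and "\<kappa> > 0" and "\<forall>x\<in>M. has_gauss_curvature M x \<kappa>"
    and "openin (top_of_set M) \<Omega>" and "connected \<Omega>" and "\<Omega> \<noteq> {}"
  shows "has_dimension (ae_space (sphere_area c r) \<Omega> (H1_kf M (sphere_area c r) \<Omega>)) 3"
proof -
  define \<mu> where "\<mu> = sphere_area c r"
  define V where "V = H1_kf M \<mu> \<Omega>"
  define R where "R = ae_rel \<mu> \<Omega> V"
  define E where "E \<omega> = R `` {rotfield c \<omega>}" for \<omega>
  note r = \<open>r > 0\<close>
  have op: "openin (top_of_set (sphere c r)) \<Omega>" using assms by simp
  have \<Omega>M: "\<Omega> \<subseteq> sphere c r" and \<Omega>b: "\<Omega> \<in> sets borel"
    using openin_imp_subset[OF op] openin_sphere_borel[OF op] by auto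
  have V: "W \<in> V \<longleftrightarrow> (\<forall>x\<in>\<Omega>. W x \<in> tangent_space (sphere c r) x) \<and> set_borel_measurable \<mu> \<Omega> W \<and>
      (\<exists>\<omega>. AE x\<in>\<Omega> in \<mu>. W x = rotfield c \<omega> x)" for W
    unfolding V_def \<mu>_def assms(2) by (rule H1_kf_sphere[OF r op assms(6)])
  have rot_V: "rotfield c \<omega> \<in> V" for \<omega>
  proof -
    have "set_borel_measurable \<mu> \<Omega> (rotfield c \<omega>)"
      using set_square_integrable_continuous[OF r \<Omega>b continuous_rotfield]
      by (simp add: set_square_integrable_def \<mu>_def)
    moreover have "AE x\<in>\<Omega> in \<mu>. rotfield c \<omega> x = rotfield c \<omega> x" by simp
    ultimately show ?thesis unfolding V using rotfield_tangent[OF r] \<Omega>M by blast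
  qed
  have V_class: "W \<in> V \<Longrightarrow> \<exists>\<omega>. W \<in> E \<omega>" for W
  proof -
    assume W: "W \<in> V"
    then obtain \<omega> where "AE x\<in>\<Omega> in \<mu>. W x = rotfield c \<omega> x" unfolding V by blast
    hence "AE x\<in>\<Omega> in \<mu>. rotfield c \<omega> x = W x" by eventually_elim auto
    thus ?thesis using W rot_V unfolding E_def R_def ae_rel_def by auto
  qed
  have E_iff: "W \<in> E \<omega> \<longleftrightarrow> W \<in> V \<and> (AE x\<in>\<Omega> in \<mu>. rotfield c \<omega> x = W x)" for W \<omega>
    using rot_V by (auto simp: E_def R_def ae_rel_def)
  have class_eq: "R `` {W} = E \<omega>" if "W \<in> E \<omega>" for W \<omega>
  proof -
    have W: "W \<in> V" "AE x\<in>\<Omega> in \<mu>. rotfield c \<omega> x = W x" using that by (simp_all add: E_iff)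
    show ?thesis
    proof (intro equalityI subsetI)
      fix f assume "f \<in> R `` {W}"
      hence f: "f \<in> V" "AE x\<in>\<Omega> in \<mu>. W x = f x" by (auto simp: R_def ae_rel_def)
      have "AE x\<in>\<Omega> in \<mu>. rotfield c \<omega> x = f x" using W(2) f(2) by eventually_elim auto
      thus "f \<in> E \<omega>" using f by (simp add: E_iff)
    next
      fix f assume "f \<in> E \<omega>"
      hence f: "f \<in> V" "AE x\<in>\<Omega> in \<mu>. rotfield c \<omega> x = f x" by (simp_all add: E_iff)
      have "AE x\<in>\<Omega> in \<mu>. W x = f x" using W(2) f(2) by eventually_elim auto
      thus "f \<in> R `` {W}" using f W by (auto simp: R_def ae_rel_def)
    qed
  qed
  have self: "rotfield c \<omega> \<in> E \<omega>" for \<omega> by (simp add: E_iff rot_V)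
  have sumE: "(\<lambda>x. f x + g x) \<in> E (\<omega> + \<omega>')" if f: "f \<in> E \<omega>" and g: "g \<in> E \<omega>'" for f g \<omega> \<omega>'
  proof -
    have eq: "AE x\<in>\<Omega> in \<mu>. rotfield c (\<omega> + \<omega>') x = f x + g x"
      using f[unfolded E_iff, THEN conjunct2] g[unfolded E_iff, THEN conjunct2]
      by eventually_elim (auto simp: rotfield_add[symmetric])
    hence "AE x\<in>\<Omega> in \<mu>. f x + g x = rotfield c (\<omega> + \<omega>') x" by eventually_elim auto
    moreover have "set_borel_measurable \<mu> \<Omega> (\<lambda>x. f x + g x)"
      using f g unfolding E_iff V set_borel_measurable_def scaleR_add_right
      by (intro borel_measurable_add) blast+
    moreover have "\<forall>x\<in>\<Omega>. f x + g x \<in> tangent_space (sphere c r) x"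
    proof
      fix x assume x: "x \<in> \<Omega>"
      hence "f x \<in> tangent_space (sphere c r) x" "g x \<in> tangent_space (sphere c r) x"
        using f g unfolding E_iff V by blast+
      thus "f x + g x \<in> tangent_space (sphere c r) x"
        using tangent_sphere_iff[OF r subsetD[OF \<Omega>M x]] by (simp only: inner_add_left add_0)
    qed
    ultimately have "(\<lambda>x. f x + g x) \<in> V" unfolding V by blast
    thus ?thesis using eq by (simp add: E_iff)
  qed
  have scaleE: "(\<lambda>x. a *\<^sub>R f x) \<in> E (a *\<^sub>R \<omega>)" if f: "f \<in> E \<omega>" for a f \<omega>
  proof -
    have eq: "AE x\<in>\<Omega> in \<mu>. rotfield c (a *\<^sub>R \<omega>) x = a *\<^sub>R f x"
      using f[unfolded E_iff, THEN conjunct2] by eventually_elim (auto simp: rotfield_scaleR[symmetric])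
    hence "AE x\<in>\<Omega> in \<mu>. a *\<^sub>R f x = rotfield c (a *\<^sub>R \<omega>) x" by eventually_elim auto
    moreover have "set_borel_measurable \<mu> \<Omega> (\<lambda>x. a *\<^sub>R f x)"
    proof -
      have "(\<lambda>x. a *\<^sub>R (indicator \<Omega> x *\<^sub>R f x)) \<in> borel_measurable \<mu>"
      proof (rule borel_measurable_scaleR[OF borel_measurable_const])
        show "(\<lambda>x. indicator \<Omega> x *\<^sub>R f x) \<in> borel_measurable \<mu>"
          using f unfolding E_iff V set_borel_measurable_def by blast
      qed
      thus ?thesis by (simp add: set_borel_measurable_def mult.commute)
    qed
    moreover have "\<forall>x\<in>\<Omega>. a *\<^sub>R f x \<in> tangent_space (sphere c r) x"
    proof
      fix x assume x: "x \<in> \<Omega>"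
      hence "f x \<in> tangent_space (sphere c r) x" using f unfolding E_iff V by blast
      thus "a *\<^sub>R f x \<in> tangent_space (sphere c r) x"
        using tangent_sphere_iff[OF r subsetD[OF \<Omega>M x]] by (simp only: inner_scaleR_left mult_zero_right)
    qed
    ultimately have "(\<lambda>x. a *\<^sub>R f x) \<in> V" unfolding V by blast
    thus ?thesis using eq by (simp add: E_iff)
  qed
  have "has_dimension (ae_space \<mu> \<Omega> V) DIM(real^3)"
  proof (rule has_dimension_DIM)
    show "bij_betw E UNIV (carrier (ae_space \<mu> \<Omega> V))"
    proof (rule bij_betwI')
      fix \<omega> \<omega>' :: "real^3"
      show "E \<omega> = E \<omega>' \<longleftrightarrow> \<omega> = \<omega>'"
      proof
        assume "E \<omega> = E \<omega>'"
        hence "rotfield c \<omega>' \<in> E \<omega>" using self by blast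
        hence "AE x\<in>\<Omega> in \<mu>. rotfield c \<omega> x = rotfield c \<omega>' x" unfolding E_iff by blast
        thus "\<omega> = \<omega>'" unfolding \<mu>_def by (rule rotfield_AE_inject[OF r op assms(7)])
      qed simp
      show "E \<omega> \<in> carrier (ae_space \<mu> \<Omega> V)"
        using rot_V unfolding ae_space_def E_def R_def by (simp add: quotientI)
    next
      fix C assume "C \<in> carrier (ae_space \<mu> \<Omega> V)"
      then obtain W where W: "W \<in> V" "C = R `` {W}" unfolding ae_space_def R_def by (auto elim: quotientE)
      then obtain \<omega> where "W \<in> E \<omega>" using V_class by blast
      thus "\<exists>\<omega>\<in>UNIV. C = E \<omega>" using class_eq W(2) by blast
    qed
    have "(\<lambda>x. 0) \<in> E 0" using self[of 0] by (simp add: rotfield_def[abs_def])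
    thus "\<zero>\<^bsub>ae_space \<mu> \<Omega> V\<^esub> = E 0" using class_eq by (simp add: ae_space_def R_def)
    \<comment> \<open>Addition is a union over all pairs of representatives. Every member of the
      union is the same class, and \<open>self\<close> makes the index sets non-empty.\<close>
    show "E \<omega> \<oplus>\<^bsub>ae_space \<mu> \<Omega> V\<^esub> E \<omega>' = E (\<omega> + \<omega>')" for \<omega> \<omega>'
    proof -
      have "(\<Union>f\<in>E \<omega>. \<Union>g\<in>E \<omega>'. R `` {\<lambda>x. f x + g x}) = (\<Union>f\<in>E \<omega>. \<Union>g\<in>E \<omega>'. E (\<omega> + \<omega>'))"
        by (intro SUP_cong refl class_eq sumE)
      also have "\<dots> = E (\<omega> + \<omega>')" using self by auto
      finally show ?thesis by (simp add: ae_space_def R_def)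
    qed
    show "a \<odot>\<^bsub>ae_space \<mu> \<Omega> V\<^esub> E \<omega> = E (a *\<^sub>R \<omega>)" for a \<omega>
    proof -
      have "(\<Union>f\<in>E \<omega>. R `` {\<lambda>x. a *\<^sub>R f x}) = (\<Union>f\<in>E \<omega>. E (a *\<^sub>R \<omega>))"
        by (intro SUP_cong refl class_eq scaleE)
      also have "\<dots> = E (a *\<^sub>R \<omega>)" using self by auto
      finally show ?thesis by (simp add: ae_space_def R_def)
    qed
  qed
  thus ?thesis by (simp add: V_def \<mu>_def)
qed

end
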